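(* A differential linear category is equivalently a symmetric monoidal category with a monoidal bialgebra modality equipped with a codereliction.
   Context: Conventions: composition is written diagrammatically, $f;g$ means first $f$ then $g$. Symmetric monoidal categories are taken to be strict, with product $\otimes$, unit $I$, symmetry $\sigma_{A,B}:A\otimes B\to B\otimes A$. Additive category: each homset is a commutative monoid $(+,0)$ with $f;(g+h)=f;g+f;h$, $f;0=0$, $(g+h);k=g;k+h;k$, $0;k=0$. Additive symmetric monoidal category: a symmetric monoidal category that is additive and satisfies $f\otimes(g+h)=f\otimes g+f\otimes h$, $f\otimes 0=0$, $(g+h)\otimes k=g\otimes k+h\otimes k$, $0\otimes k=0$. Coalgebra modality $(!,\delta,\varepsilon,\Delta,\mathsf{e})$: a comonad $(!,\delta,\varepsilon)$, with $\delta_A:!(A)\to!!(A)$, $\varepsilon_A:!(A)\to A$, together with natural transformations $\Delta_A:!(A)\to!(A)\otimes!(A)$, $\mathsf{e}_A:!(A)\to I$ such that each $(!(A),\Delta_A,\mathsf{e}_A)$ is a cocommutative comonoid and $\delta_A$ is a comonoid morphism: $\delta_A;\Delta_{!(A)}=\Delta_A;(\delta_A\otimes\delta_A)$, $\delta_A;\mathsf{e}_{!(A)}=\mathsf{e}_A$. Monoidal coalgebra modality $(!,\delta,\varepsilon,\Delta,\mathsf{e},\mathsf{m},\mathsf{m}_I)$: a coalgebra modality with a natural transformation $\mathsf{m}_{A,B}:!(A)\otimes!(B)\to!(A\otimes B)$ and a map $\mathsf{m}_I:I\to!(I)$ making $!$ a symmetric (lax) monoidal endofunctor, such that - $\mathsf{m}_{A,B};\delta_{A\otimes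 B}=(\delta_A\otimes\delta_B);\mathsf{m}_{!(A),!(B)};!(\mathsf{m}_{A,B})$, $\mathsf{m}_I;\delta_I=\mathsf{m}_I;!(\mathsf{m}_I)$, $\mathsf{m}_{A,B};\varepsilon_{A\otimes B}=\varepsilon_A\otimes\varepsilon_B$, $\mathsf{m}_I;\varepsilon_I=1_I$; - $\mathsf{m}_{A,B};\Delta_{A\otimes B}=(\Delta_A\otimes\Delta_B);(1\otimes\sigma_{!(A),!(B)}\otimes1);(\mathsf{m}_{A,B}\otimes\mathsf{m}_{A,B})$, $\mathsf{m}_{A,B};\mathsf{e}_{A\otimes B}=\mathsf{e}_A\otimes\mathsf{e}_B$, $\mathsf{m}_I;\Delta_I=\mathsf{m}_I\otimes\mathsf{m}_I$, $\mathsf{m}_I;\mathsf{e}_I=1_I$; - $\delta_A;!(\Delta_A)=\Delta_A;(\delta_A\otimes\delta_A);\mathsf{m}_{!(A),!(A)}$, $\delta_A;!(\mathsf{e}_A)=\mathsf{e}_A;\mathsf{m}_I$. Bialgebra modality $(!,\delta,\varepsilon,\Delta,\mathsf{e},\nabla,\mathsf{u})$: a coalgebra modality with natural transformations $\nabla_A:!(A)\otimes!(A)\to!(A)$, $\mathsf{u}_A:I\to!(A)$ such that each $(!(A),\nabla_A,\mathsf{u}_A)$ is a commutative monoid and $(!(A),\nabla_A,\mathsf{u}_A,\Delta_A,\mathsf{e}_A)$ is a bimonoid. Monoidal bialgebra modality $(!,\delta,\varepsilon,\Delta,\mathsf{e},\mathsf{m},\mathsf{m}_I,\nabla,\mathsf{u})$: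 both a monoidal coalgebra modality and a bialgebra modality (on the same coalgebra modality) such that - $(1_{!(A)}\otimes\nabla_B);\mathsf{m}_{A,B}=(\Delta_A\otimes1\otimes1);(1\otimes\sigma_{!(A),!(B)}\otimes1);(\mathsf{m}_{A,B}\otimes\mathsf{m}_{A,B});\nabla_{A\otimes B}$; - $(\nabla_A\otimes1_{!(B)});\mathsf{m}_{A,B}=(1\otimes1\otimes\Delta_B);(1\otimes\sigma_{!(A),!(B)}\otimes1);(\mathsf{m}_{A,B}\otimes\mathsf{m}_{A,B});\nabla_{A\otimes B}$; - $(\mathsf{u}_A\otimes1_{!(B)});\mathsf{m}_{A,B}=\mathsf{e}_B;\mathsf{u}_{A\otimes B}$, $(1_{!(A)}\otimes\mathsf{u}_B);\mathsf{m}_{A,B}=\mathsf{e}_A;\mathsf{u}_{A\otimes B}$; - $\nabla_A;\delta_A=(\delta_A\otimes\delta_A);\mathsf{m}_{!(A),!(A)};!(\nabla_A)$, $\mathsf{u}_A;\delta_A=\mathsf{m}_I;!(\mathsf{u}_A)$. Pre-codereliction for a monoidal coalgebra modality: a natural transformation $\eta_A:A\to!(A)$ such that $\eta_A;\varepsilon_A=1_A$, $(\eta_A\otimes1_{!(B)});\mathsf{m}_{A,B}=(1_A\otimes\varepsilon_B);\eta_{A\otimes B}$, and $(1_{!(A)}\otimes\eta_B);\mathsf{m}_{A,B}=(\varepsilon_A\otimes1_B);\eta_{A\otimes B}$. Codereliction for a monoidal bialgebra modality on a (not assumed additive) symmetric monoidal category: a pre-codereliction $\eta$ on the underlying monoidal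 coalgebra modality which also satisfies the chain rule $\eta_A;\delta_A=(\mathsf{u}_A\otimes\eta_A);(\delta_A\otimes\eta_{!(A)});\nabla_{!(A)}$. Monoidal differential modality $(!,\delta,\varepsilon,\Delta,\mathsf{e},\mathsf{m},\mathsf{m}_I,\mathsf{d})$ on an additive symmetric monoidal category: a monoidal coalgebra modality together with a natural transformation $\mathsf{d}_A:!(A)\otimes A\to!(A)$ (deriving transformation) such that [D.1] $\mathsf{d}_A;\mathsf{e}_A=0$; [D.2] $\mathsf{d}_A;\Delta_A=(\Delta_A\otimes1_A);\big((1_{!(A)}\otimes\sigma_{!(A),A});(\mathsf{d}_A\otimes1_{!(A)})+(1_{!(A)}\otimes\mathsf{d}_A)\big)$; [D.3] $\mathsf{d}_A;\varepsilon_A=\mathsf{e}_A\otimes1_A$; [D.4] $\mathsf{d}_A;\delta_A=(\Delta_A\otimes1_A);(\delta_A\otimes\mathsf{d}_A);\mathsf{d}_{!(A)}$; [D.5] $(\mathsf{d}_A\otimes1_A);\mathsf{d}_A=(1_{!(A)}\otimes\sigma_{A,A});(\mathsf{d}_A\otimes1_A);\mathsf{d}_A$. Differential linear category: an additive symmetric monoidal category with a monoidal differential modality. *)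

theory Defs
  imports Main "HOL-Library.FuncSet"
begin

text \<open>
  Composition \<open>f ;; g\<close> is diagrammatic (first \<open>f\<close>, then \<open>g\<close>) and is only constrained on
  composable arrows.  Monoidal categories are strict, so \<open>\<odot>\<close> makes the objects a monoid on the nose.
  \<open>\<one> A\<close> is the identity arrow of the object \<open>A\<close>.
\<close>

record ('o, 'm) smc =
  Obj :: "'o set"
  Arr :: "'m set"
  Dom :: "'m \<Rightarrow> 'o"
  Cod :: "'m \<Rightarrow> 'o"
  Idt :: "'o \<Rightarrow> 'm"  ("\<one>\<index>")
  Comp :: "'m \<Rightarrow> 'm \<Rightarrow> 'm"  (infixl ";;\<index>" 60)
  TenO :: "'o \<Rightarrow> 'o \<Rightarrow> 'o"  (infixl "\<odot>\<index>" 75)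
  TenA :: "'m \<Rightarrow> 'm \<Rightarrow> 'm"  (infixl "\<otimes>\<index>" 70)
  Unit :: "'o"  ("\<I>\<index>")
  Symm :: "'o \<Rightarrow> 'o \<Rightarrow> 'm"  ("\<sigma>\<index>")

definition Hom :: "('o, 'm) smc \<Rightarrow> 'o \<Rightarrow> 'o \<Rightarrow> 'm set"  ("Hom\<index>")
  where "Hom\<^bsub>C\<^esub> A B = {f \<in> Arr C. Dom C f = A \<and> Cod C f = B}"


section \<open>Categories, functors, natural transformations\<close>

locale category =
  fixes C :: "('o, 'm) smc" (structure)
  assumes Dom_Obj: "f \<in> Arr C \<Longrightarrow> Dom C f \<in> Obj C"
    and Cod_Obj: "f \<in> Arr C \<Longrightarrow> Cod C f \<in> Obj C"
    and Idt_Hom: "A \<in> Obj C \<Longrightarrow> \<one> A \<in> Hom A A"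
    and Comp_Hom: "f \<in> Hom A B \<Longrightarrow> g \<in> Hom B D \<Longrightarrow> f ;; g \<in> Hom A D"
    and Idt_left: "f \<in> Hom A B \<Longrightarrow> \<one> A ;; f = f"
    and Idt_right: "f \<in> Hom A B \<Longrightarrow> f ;; \<one> B = f"
    and Comp_assoc: "f \<in> Hom A B \<Longrightarrow> g \<in> Hom B D \<Longrightarrow> h \<in> Hom D E \<Longrightarrow> (f ;; g) ;; h = f ;; (g ;; h)"
begin

definition endofunctor :: "('o \<Rightarrow> 'o) \<Rightarrow> ('m \<Rightarrow> 'm) \<Rightarrow> bool"
  where "endofunctor Fo Fa \<longleftrightarrow>
    Fo \<in> Obj C \<rightarrow> Obj C \<and>
    (\<forall>A\<in>Obj C. \<forall>B\<in>Obj C. Fa \<in> Hom A B \<rightarrow> Hom (Fo A) (Fo B)) \<and>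
    (\<forall>A\<in>Obj C. Fa (\<one> A) = \<one> (Fo A)) \<and>
    (\<forall>f\<in>Arr C. \<forall>g\<in>Arr C. Cod C f = Dom C g \<longrightarrow> Fa (f ;; g) = Fa f ;; Fa g)"

text \<open>
  A natural transformation is a family indexed by the objects.  It is taken in \<open>\<Pi>\<^sub>E\<close> (that is,
  \<open>undefined\<close> off the objects), so that HOL equality is equality of families.
\<close>

definition natural ::
    "('o \<Rightarrow> 'o) \<Rightarrow> ('m \<Rightarrow> 'm) \<Rightarrow> ('o \<Rightarrow> 'o) \<Rightarrow> ('m \<Rightarrow> 'm) \<Rightarrow> ('o \<Rightarrow> 'm) \<Rightarrow> bool"
  where "natural Fo Fa Go Ga \<tau> \<longleftrightarrow>
    \<tau> \<in> (\<Pi>\<^sub>E A\<in>Obj C. Hom (Fo A) (Go A)) \<and>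
    (\<forall>f\<in>Arr C. Fa f ;; \<tau> (Cod C f) = \<tau> (Dom C f) ;; Ga f)"

end


section \<open>Symmetric monoidal categories\<close>

locale symmetric_monoidal_category = category C
  for C :: "('o, 'm) smc" (structure) +
  assumes Unit_Obj: "\<I> \<in> Obj C"
    and TenO_Obj: "A \<in> Obj C \<Longrightarrow> B \<in> Obj C \<Longrightarrow> A \<odot> B \<in> Obj C"
    and TenO_assoc: "A \<in> Obj C \<Longrightarrow> B \<in> Obj C \<Longrightarrow> D \<in> Obj C \<Longrightarrow> (A \<odot> B) \<odot> D = A \<odot> (B \<odot> D)"
    and TenO_Unit_left: "A \<in> Obj C \<Longrightarrow> \<I> \<odot> A = A"
    and TenO_Unit_right: "A \<in> Obj C \<Longrightarrow> A \<odot> \<I> = A"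
    and TenA_Hom: "f \<in> Hom A B \<Longrightarrow> g \<in> Hom A' B' \<Longrightarrow> f \<otimes> g \<in> Hom (A \<odot> A') (B \<odot> B')"
    and TenA_Idt: "A \<in> Obj C \<Longrightarrow> B \<in> Obj C \<Longrightarrow> \<one> A \<otimes> \<one> B = \<one> (A \<odot> B)"
    and TenA_Comp: "f \<in> Hom A B \<Longrightarrow> g \<in> Hom B D \<Longrightarrow> f' \<in> Hom A' B' \<Longrightarrow> g' \<in> Hom B' D' \<Longrightarrow>
          (f ;; g) \<otimes> (f' ;; g') = (f \<otimes> f') ;; (g \<otimes> g')"
    and TenA_assoc: "f \<in> Arr C \<Longrightarrow> g \<in> Arr C \<Longrightarrow> h \<in> Arr C \<Longrightarrow> (f \<otimes> g) \<otimes> h = f \<otimes> (g \<otimes> h)"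
    and TenA_Unit_left: "f \<in> Arr C \<Longrightarrow> \<one> \<I> \<otimes> f = f"
    and TenA_Unit_right: "f \<in> Arr C \<Longrightarrow> f \<otimes> \<one> \<I> = f"
    and Symm_Hom: "A \<in> Obj C \<Longrightarrow> B \<in> Obj C \<Longrightarrow> \<sigma> A B \<in> Hom (A \<odot> B) (B \<odot> A)"
    and Symm_natural: "f \<in> Hom A A' \<Longrightarrow> g \<in> Hom B B' \<Longrightarrow> (f \<otimes> g) ;; \<sigma> A' B' = \<sigma> A B ;; (g \<otimes> f)"
    and Symm_Symm: "A \<in> Obj C \<Longrightarrow> B \<in> Obj C \<Longrightarrow> \<sigma> A B ;; \<sigma> B A = \<one> (A \<odot> B)"
    and Symm_hexagon: "A \<in> Obj C \<Longrightarrow> B \<in> Obj C \<Longrightarrow> D \<in> Obj C \<Longrightarrow>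
          \<sigma> A (B \<odot> D) = (\<sigma> A B \<otimes> \<one> D) ;; (\<one> B \<otimes> \<sigma> A D)"
    and Symm_Unit: "A \<in> Obj C \<Longrightarrow> \<sigma> A \<I> = \<one> A"
begin

definition cocommutative_comonoid :: "'o \<Rightarrow> 'm \<Rightarrow> 'm \<Rightarrow> bool"
  where "cocommutative_comonoid A \<Delta> e \<longleftrightarrow>
    A \<in> Obj C \<and> \<Delta> \<in> Hom A (A \<odot> A) \<and> e \<in> Hom A \<I> \<and>
    \<Delta> ;; (\<Delta> \<otimes> \<one> A) = \<Delta> ;; (\<one> A \<otimes> \<Delta>) \<and>
    \<Delta> ;; (e \<otimes> \<one> A) = \<one> A \<and>
    \<Delta> ;; (\<one> A \<otimes> e) = \<one> A \<and>
    \<Delta> ;; \<sigma> A A = \<Delta>"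

definition comonoid_morphism :: "'o \<Rightarrow> 'm \<Rightarrow> 'm \<Rightarrow> 'o \<Rightarrow> 'm \<Rightarrow> 'm \<Rightarrow> 'm \<Rightarrow> bool"
  where "comonoid_morphism A \<Delta> e B \<Delta>' e' f \<longleftrightarrow>
    f \<in> Hom A B \<and> f ;; \<Delta>' = \<Delta> ;; (f \<otimes> f) \<and> f ;; e' = e"

definition commutative_monoid :: "'o \<Rightarrow> 'm \<Rightarrow> 'm \<Rightarrow> bool"
  where "commutative_monoid A nab u \<longleftrightarrow>
    A \<in> Obj C \<and> nab \<in> Hom (A \<odot> A) A \<and> u \<in> Hom \<I> A \<and>
    (nab \<otimes> \<one> A) ;; nab = (\<one> A \<otimes> nab) ;; nab \<and>
    (u \<otimes> \<one> A) ;; nab = \<one> A \<and>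
    (\<one> A \<otimes> u) ;; nab = \<one> A \<and>
    \<sigma> A A ;; nab = nab"

definition bimonoid :: "'o \<Rightarrow> 'm \<Rightarrow> 'm \<Rightarrow> 'm \<Rightarrow> 'm \<Rightarrow> bool"
  where "bimonoid A nab u \<Delta> e \<longleftrightarrow>
    commutative_monoid A nab u \<and> cocommutative_comonoid A \<Delta> e \<and>
    nab ;; \<Delta> = (\<Delta> \<otimes> \<Delta>) ;; (\<one> A \<otimes> \<sigma> A A \<otimes> \<one> A) ;; (nab \<otimes> nab) \<and>
    nab ;; e = e \<otimes> e \<and>
    u ;; \<Delta> = u \<otimes> u \<and>
    u ;; e = \<one> \<I>"

end


section \<open>Additive structure\<close>

locale additive_category = category C
  for C :: "('o, 'm) smc" (structure) +
  fixes add :: "'m \<Rightarrow> 'm \<Rightarrow> 'm"  (infixl "\<oplus>" 55)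
    and zero :: "'o \<Rightarrow> 'o \<Rightarrow> 'm"
  assumes add_Hom: "add \<in> (\<Pi>\<^sub>E f\<in>Arr C. Hom (Dom C f) (Cod C f) \<rightarrow>\<^sub>E Hom (Dom C f) (Cod C f))"
    and zero_Hom: "zero \<in> (\<Pi>\<^sub>E A\<in>Obj C. \<Pi>\<^sub>E B\<in>Obj C. Hom A B)"
    and add_assoc: "f \<in> Hom A B \<Longrightarrow> g \<in> Hom A B \<Longrightarrow> h \<in> Hom A B \<Longrightarrow> (f \<oplus> g) \<oplus> h = f \<oplus> (g \<oplus> h)"
    and add_commute: "f \<in> Hom A B \<Longrightarrow> g \<in> Hom A B \<Longrightarrow> f \<oplus> g = g \<oplus> f"
    and add_zero: "f \<in> Hom A B \<Longrightarrow> f \<oplus> zero A B = f"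
    and Comp_add: "f \<in> Hom A B \<Longrightarrow> g \<in> Hom B D \<Longrightarrow> h \<in> Hom B D \<Longrightarrow> f ;; (g \<oplus> h) = (f ;; g) \<oplus> (f ;; h)"
    and Comp_zero: "f \<in> Hom A B \<Longrightarrow> D \<in> Obj C \<Longrightarrow> f ;; zero B D = zero A D"
    and add_Comp: "g \<in> Hom A B \<Longrightarrow> h \<in> Hom A B \<Longrightarrow> k \<in> Hom B D \<Longrightarrow> (g \<oplus> h) ;; k = (g ;; k) \<oplus> (h ;; k)"
    and zero_Comp: "A \<in> Obj C \<Longrightarrow> k \<in> Hom B D \<Longrightarrow> zero A B ;; k = zero A D"

locale additive_symmetric_monoidal_category =
  symmetric_monoidal_category C + additive_category C add zero
  for C :: "('o, 'm) smc" (structure)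
    and add :: "'m \<Rightarrow> 'm \<Rightarrow> 'm"  (infixl "\<oplus>" 55)
    and zero :: "'o \<Rightarrow> 'o \<Rightarrow> 'm" +
  assumes TenA_add: "f \<in> Hom A B \<Longrightarrow> g \<in> Hom A' B' \<Longrightarrow> h \<in> Hom A' B' \<Longrightarrow>
          f \<otimes> (g \<oplus> h) = (f \<otimes> g) \<oplus> (f \<otimes> h)"
    and TenA_zero: "f \<in> Hom A B \<Longrightarrow> A' \<in> Obj C \<Longrightarrow> B' \<in> Obj C \<Longrightarrow>
          f \<otimes> zero A' B' = zero (A \<odot> A') (B \<odot> B')"
    and add_TenA: "g \<in> Hom A B \<Longrightarrow> h \<in> Hom A B \<Longrightarrow> k \<in> Hom A' B' \<Longrightarrow>
          (g \<oplus> h) \<otimes> k = (g \<otimes> k) \<oplus> (h \<otimes> k)"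
    and zero_TenA: "A \<in> Obj C \<Longrightarrow> B \<in> Obj C \<Longrightarrow> k \<in> Hom A' B' \<Longrightarrow>
          zero A B \<otimes> k = zero (A \<odot> A') (B \<odot> B')"


section \<open>Modalities\<close>

text \<open>\<open>bang\<close> and \<open>bmap\<close> are the actions of \<open>!\<close> on objects and on arrows.\<close>

locale coalgebra_modality = symmetric_monoidal_category C
  for C :: "('o, 'm) smc" (structure) +
  fixes bang :: "'o \<Rightarrow> 'o"
    and bmap :: "'m \<Rightarrow> 'm"
    and \<delta> \<epsilon> \<Delta> e :: "'o \<Rightarrow> 'm"
  assumes bang_functor: "endofunctor bang bmap"
    and \<delta>_natural: "natural bang bmap (\<lambda>A. bang (bang A)) (\<lambda>f. bmap (bmap f)) \<delta>"
    and \<epsilon>_natural: "natural bang bmap (\<lambda>A. A) (\<lambda>f. f) \<epsilon>"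
    and \<delta>_coassoc: "A \<in> Obj C \<Longrightarrow> \<delta> A ;; \<delta> (bang A) = \<delta> A ;; bmap (\<delta> A)"
    and \<delta>_\<epsilon>_bang: "A \<in> Obj C \<Longrightarrow> \<delta> A ;; \<epsilon> (bang A) = \<one> (bang A)"
    and \<delta>_bmap_\<epsilon>: "A \<in> Obj C \<Longrightarrow> \<delta> A ;; bmap (\<epsilon> A) = \<one> (bang A)"
    and \<Delta>_natural: "natural bang bmap (\<lambda>A. bang A \<odot> bang A) (\<lambda>f. bmap f \<otimes> bmap f) \<Delta>"
    and e_natural: "natural bang bmap (\<lambda>_. \<I>) (\<lambda>_. \<one> \<I>) e"
    and bang_comonoid: "A \<in> Obj C \<Longrightarrow> cocommutative_comonoid (bang A) (\<Delta> A) (e A)"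
    and \<delta>_comonoid_morphism: "A \<in> Obj C \<Longrightarrow>
          comonoid_morphism (bang A) (\<Delta> A) (e A) (bang (bang A)) (\<Delta> (bang A)) (e (bang A)) (\<delta> A)"

locale monoidal_coalgebra_modality = coalgebra_modality C bang bmap \<delta> \<epsilon> \<Delta> e
  for C :: "('o, 'm) smc" (structure)
    and bang bmap \<delta> \<epsilon> \<Delta> e +
  fixes m :: "'o \<Rightarrow> 'o \<Rightarrow> 'm"
    and mI :: "'m"
  assumes m_Hom: "m \<in> (\<Pi>\<^sub>E A\<in>Obj C. \<Pi>\<^sub>E B\<in>Obj C. Hom (bang A \<odot> bang B) (bang (A \<odot> B)))"
    and m_natural: "f \<in> Hom A A' \<Longrightarrow> g \<in> Hom B B' \<Longrightarrow>
          (bmap f \<otimes> bmap g) ;; m A' B' = m A B ;; bmap (f \<otimes> g)"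
    and mI_Hom: "mI \<in> Hom \<I> (bang \<I>)"
    and m_assoc: "A \<in> Obj C \<Longrightarrow> B \<in> Obj C \<Longrightarrow> D \<in> Obj C \<Longrightarrow>
          (m A B \<otimes> \<one> (bang D)) ;; m (A \<odot> B) D = (\<one> (bang A) \<otimes> m B D) ;; m A (B \<odot> D)"
    and m_unit_left: "A \<in> Obj C \<Longrightarrow> (mI \<otimes> \<one> (bang A)) ;; m \<I> A = \<one> (bang A)"
    and m_unit_right: "A \<in> Obj C \<Longrightarrow> (\<one> (bang A) \<otimes> mI) ;; m A \<I> = \<one> (bang A)"
    and m_symmetric: "A \<in> Obj C \<Longrightarrow> B \<in> Obj C \<Longrightarrow>
          m A B ;; bmap (\<sigma> A B) = \<sigma> (bang A) (bang B) ;; m B A"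
    and m_\<delta>: "A \<in> Obj C \<Longrightarrow> B \<in> Obj C \<Longrightarrow>
          m A B ;; \<delta> (A \<odot> B) = (\<delta> A \<otimes> \<delta> B) ;; m (bang A) (bang B) ;; bmap (m A B)"
    and mI_\<delta>: "mI ;; \<delta> \<I> = mI ;; bmap mI"
    and m_\<epsilon>: "A \<in> Obj C \<Longrightarrow> B \<in> Obj C \<Longrightarrow> m A B ;; \<epsilon> (A \<odot> B) = \<epsilon> A \<otimes> \<epsilon> B"
    and mI_\<epsilon>: "mI ;; \<epsilon> \<I> = \<one> \<I>"
    and m_\<Delta>: "A \<in> Obj C \<Longrightarrow> B \<in> Obj C \<Longrightarrow>
          m A B ;; \<Delta> (A \<odot> B) =
            (\<Delta> A \<otimes> \<Delta> B) ;; (\<one> (bang A) \<otimes> \<sigma> (bang A) (bang B) \<otimes> \<one> (bang B)) ;; (m A B \<otimes> m A B)"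
    and m_e: "A \<in> Obj C \<Longrightarrow> B \<in> Obj C \<Longrightarrow> m A B ;; e (A \<odot> B) = e A \<otimes> e B"
    and mI_\<Delta>: "mI ;; \<Delta> \<I> = mI \<otimes> mI"
    and mI_e: "mI ;; e \<I> = \<one> \<I>"
    and \<delta>_bmap_\<Delta>: "A \<in> Obj C \<Longrightarrow>
          \<delta> A ;; bmap (\<Delta> A) = \<Delta> A ;; (\<delta> A \<otimes> \<delta> A) ;; m (bang A) (bang A)"
    and \<delta>_bmap_e: "A \<in> Obj C \<Longrightarrow> \<delta> A ;; bmap (e A) = e A ;; mI"

locale bialgebra_modality = coalgebra_modality C bang bmap \<delta> \<epsilon> \<Delta> e
  for C :: "('o, 'm) smc" (structure)
    and bang bmap \<delta> \<epsilon> \<Delta> e +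
  fixes nab u :: "'o \<Rightarrow> 'm"
  assumes nab_natural: "natural (\<lambda>A. bang A \<odot> bang A) (\<lambda>f. bmap f \<otimes> bmap f) bang bmap nab"
    and u_natural: "natural (\<lambda>_. \<I>) (\<lambda>_. \<one> \<I>) bang bmap u"
    and bang_monoid: "A \<in> Obj C \<Longrightarrow> commutative_monoid (bang A) (nab A) (u A)"
    and bang_bimonoid: "A \<in> Obj C \<Longrightarrow> bimonoid (bang A) (nab A) (u A) (\<Delta> A) (e A)"

locale monoidal_bialgebra_modality =
  monoidal_coalgebra_modality C bang bmap \<delta> \<epsilon> \<Delta> e m mI +
  bialgebra_modality C bang bmap \<delta> \<epsilon> \<Delta> e nab u
  for C :: "('o, 'm) smc" (structure)
    and bang bmap \<delta> \<epsilon> \<Delta> e m mI nab u +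
  assumes nab_right_m: "A \<in> Obj C \<Longrightarrow> B \<in> Obj C \<Longrightarrow>
          (\<one> (bang A) \<otimes> nab B) ;; m A B =
            (\<Delta> A \<otimes> \<one> (bang B) \<otimes> \<one> (bang B)) ;;
            (\<one> (bang A) \<otimes> \<sigma> (bang A) (bang B) \<otimes> \<one> (bang B)) ;; (m A B \<otimes> m A B) ;; nab (A \<odot> B)"
    and nab_left_m: "A \<in> Obj C \<Longrightarrow> B \<in> Obj C \<Longrightarrow>
          (nab A \<otimes> \<one> (bang B)) ;; m A B =
            (\<one> (bang A) \<otimes> \<one> (bang A) \<otimes> \<Delta> B) ;;
            (\<one> (bang A) \<otimes> \<sigma> (bang A) (bang B) \<otimes> \<one> (bang B)) ;; (m A B \<otimes> m A B) ;; nab (A \<odot> B)"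
    and u_left_m: "A \<in> Obj C \<Longrightarrow> B \<in> Obj C \<Longrightarrow> (u A \<otimes> \<one> (bang B)) ;; m A B = e B ;; u (A \<odot> B)"
    and u_right_m: "A \<in> Obj C \<Longrightarrow> B \<in> Obj C \<Longrightarrow> (\<one> (bang A) \<otimes> u B) ;; m A B = e A ;; u (A \<odot> B)"
    and nab_\<delta>: "A \<in> Obj C \<Longrightarrow>
          nab A ;; \<delta> A = (\<delta> A \<otimes> \<delta> A) ;; m (bang A) (bang A) ;; bmap (nab A)"
    and u_\<delta>: "A \<in> Obj C \<Longrightarrow> u A ;; \<delta> A = mI ;; bmap (u A)"


section \<open>Coderelictions\<close>

locale pre_codereliction = monoidal_coalgebra_modality C bang bmap \<delta> \<epsilon> \<Delta> e m mI
  for C :: "('o, 'm) smc" (structure)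
    and bang bmap \<delta> \<epsilon> \<Delta> e m mI +
  fixes \<eta> :: "'o \<Rightarrow> 'm"
  assumes \<eta>_natural: "natural (\<lambda>A. A) (\<lambda>f. f) bang bmap \<eta>"
    and \<eta>_\<epsilon>: "A \<in> Obj C \<Longrightarrow> \<eta> A ;; \<epsilon> A = \<one> A"
    and \<eta>_left_m: "A \<in> Obj C \<Longrightarrow> B \<in> Obj C \<Longrightarrow>
          (\<eta> A \<otimes> \<one> (bang B)) ;; m A B = (\<one> A \<otimes> \<epsilon> B) ;; \<eta> (A \<odot> B)"
    and \<eta>_right_m: "A \<in> Obj C \<Longrightarrow> B \<in> Obj C \<Longrightarrow>
          (\<one> (bang A) \<otimes> \<eta> B) ;; m A B = (\<epsilon> A \<otimes> \<one> B) ;; \<eta> (A \<odot> B)"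

locale codereliction =
  monoidal_bialgebra_modality C bang bmap \<delta> \<epsilon> \<Delta> e m mI nab u +
  pre_codereliction C bang bmap \<delta> \<epsilon> \<Delta> e m mI \<eta>
  for C :: "('o, 'm) smc" (structure)
    and bang bmap \<delta> \<epsilon> \<Delta> e m mI nab u \<eta> +
  assumes chain_rule: "A \<in> Obj C \<Longrightarrow>
          \<eta> A ;; \<delta> A = (u A \<otimes> \<eta> A) ;; (\<delta> A \<otimes> \<eta> (bang A)) ;; nab (bang A)"


section \<open>Differential linear categories\<close>

locale monoidal_differential_modality =
  additive_symmetric_monoidal_category C add zero +
  monoidal_coalgebra_modality C bang bmap \<delta> \<epsilon> \<Delta> e m mI
  for C :: "('o, 'm) smc" (structure)
    and add  (infixl "\<oplus>" 55)
    and zero bang bmap \<delta> \<epsilon> \<Delta> e m mI +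
  fixes d :: "'o \<Rightarrow> 'm"
  assumes d_natural: "natural (\<lambda>A. bang A \<odot> A) (\<lambda>f. bmap f \<otimes> f) bang bmap d"
    and D1: "A \<in> Obj C \<Longrightarrow> d A ;; e A = zero (bang A \<odot> A) \<I>"
    and D2: "A \<in> Obj C \<Longrightarrow>
          d A ;; \<Delta> A = (\<Delta> A \<otimes> \<one> A) ;;
            (((\<one> (bang A) \<otimes> \<sigma> (bang A) A) ;; (d A \<otimes> \<one> (bang A))) \<oplus> (\<one> (bang A) \<otimes> d A))"
    and D3: "A \<in> Obj C \<Longrightarrow> d A ;; \<epsilon> A = e A \<otimes> \<one> A"
    and D4: "A \<in> Obj C \<Longrightarrow> d A ;; \<delta> A = (\<Delta> A \<otimes> \<one> A) ;; (\<delta> A \<otimes> d A) ;; d (bang A)"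
    and D5: "A \<in> Obj C \<Longrightarrow>
          (d A \<otimes> \<one> A) ;; d A = (\<one> (bang A) \<otimes> \<sigma> A A) ;; (d A \<otimes> \<one> A) ;; d A"

locale differential_linear_category =
  monoidal_differential_modality C add zero bang bmap \<delta> \<epsilon> \<Delta> e m mI d
  for C :: "('o, 'm) smc" (structure)
    and add zero bang bmap \<delta> \<epsilon> \<Delta> e m mI d


section \<open>The two constructions\<close>

text \<open>
  From sums and a deriving transformation:
  \<open>\<nabla> = (\<delta> \<otimes> \<delta>) ; m ; !(\<epsilon> \<otimes> e + e \<otimes> \<epsilon>)\<close>, \<open>u = m\<^sub>I ; !(0)\<close> and \<open>\<eta> = (u \<otimes> 1) ; d\<close>.
\<close>

definition codereliction_of ::
    "('o, 'm) smc \<Rightarrow> ('o \<Rightarrow> 'o) \<Rightarrow> ('m \<Rightarrow> 'm) \<Rightarrow> ('o \<Rightarrow> 'm) \<Rightarrow> ('o \<Rightarrow> 'm) \<Rightarrow> ('o \<Rightarrow> 'm) \<Rightarrow> ('o \<Rightarrow> 'o \<Rightarrow> 'm) \<Rightarrow> 'm \<Rightarrow>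
     ('m \<Rightarrow> 'm \<Rightarrow> 'm) \<times> ('o \<Rightarrow> 'o \<Rightarrow> 'm) \<times> ('o \<Rightarrow> 'm) \<Rightarrow> ('o \<Rightarrow> 'm) \<times> ('o \<Rightarrow> 'm) \<times> ('o \<Rightarrow> 'm)"
  where
  "codereliction_of C bang bmap \<delta> \<epsilon> e m mI = (\<lambda>(add, zero, d).
    ((\<lambda>A\<in>Obj C. (\<delta> A \<otimes>\<^bsub>C\<^esub> \<delta> A) ;;\<^bsub>C\<^esub> m (bang A) (bang A) ;;\<^bsub>C\<^esub>
        bmap (add (\<epsilon> A \<otimes>\<^bsub>C\<^esub> e A) (e A \<otimes>\<^bsub>C\<^esub> \<epsilon> A))),
     (\<lambda>A\<in>Obj C. mI ;;\<^bsub>C\<^esub> bmap (zero \<I>\<^bsub>C\<^esub> A)),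
     (\<lambda>A\<in>Obj C. ((mI ;;\<^bsub>C\<^esub> bmap (zero \<I>\<^bsub>C\<^esub> A)) \<otimes>\<^bsub>C\<^esub> \<one>\<^bsub>C\<^esub> A) ;;\<^bsub>C\<^esub> d A)))"

text \<open>
  From a monoidal bialgebra modality with codereliction:
  \<open>f + g = \<eta> ; \<Delta> ; (!f \<otimes> !g) ; \<nabla> ; \<epsilon>\<close>, \<open>0 = \<eta> ; e ; u ; \<epsilon>\<close> and \<open>d = (1 \<otimes> \<eta>) ; \<nabla>\<close>.
\<close>

definition differential_of ::
    "('o, 'm) smc \<Rightarrow> ('o \<Rightarrow> 'o) \<Rightarrow> ('m \<Rightarrow> 'm) \<Rightarrow> ('o \<Rightarrow> 'm) \<Rightarrow> ('o \<Rightarrow> 'm) \<Rightarrow> ('o \<Rightarrow> 'm) \<Rightarrow>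
     ('o \<Rightarrow> 'm) \<times> ('o \<Rightarrow> 'm) \<times> ('o \<Rightarrow> 'm) \<Rightarrow> ('m \<Rightarrow> 'm \<Rightarrow> 'm) \<times> ('o \<Rightarrow> 'o \<Rightarrow> 'm) \<times> ('o \<Rightarrow> 'm)"
  where
  "differential_of C bang bmap \<epsilon> \<Delta> e = (\<lambda>(nab, u, \<eta>).
    ((\<lambda>f\<in>Arr C. \<lambda>g\<in>Hom\<^bsub>C\<^esub> (Dom C f) (Cod C f).
        \<eta> (Dom C f) ;;\<^bsub>C\<^esub> \<Delta> (Dom C f) ;;\<^bsub>C\<^esub> (bmap f \<otimes>\<^bsub>C\<^esub> bmap g) ;;\<^bsub>C\<^esub> nab (Cod C f) ;;\<^bsub>C\<^esub> \<epsilon> (Cod C f)),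
     (\<lambda>A\<in>Obj C. \<lambda>B\<in>Obj C. \<eta> A ;;\<^bsub>C\<^esub> e A ;;\<^bsub>C\<^esub> u B ;;\<^bsub>C\<^esub> \<epsilon> B),
     (\<lambda>A\<in>Obj C. (\<one>\<^bsub>C\<^esub> (bang A) \<otimes>\<^bsub>C\<^esub> \<eta> A) ;;\<^bsub>C\<^esub> nab A)))"

end

theory Submission
  imports Defs
begin

text \<open>
  Coalgebras of the comonad \<open>!\<close> carry the whole argument.  A monoidal coalgebra modality makes the
  tensor product of two coalgebras a coalgebra, and a coalgebra morphism into a cofree coalgebra
  \<open>! A\<close> is determined by its composite with \<open>\<epsilon>\<close> (\<open>coalg_hom_eqI\<close>).

  \<^bold>\<open>From sums and \<open>d\<close> to a codereliction.\<close>  With sums on the homsets, \<open>\<nabla>\<close> is the coalgebra morphism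
  with \<open>\<nabla> ; \<epsilon> = \<epsilon> \<otimes> e + e \<otimes> \<epsilon>\<close> and \<open>u\<close> the one with \<open>u ; \<epsilon> = 0\<close>.  Most laws of a monoidal bialgebra
  modality equate two coalgebra morphisms into some \<open>! A\<close>, so they only have to be compared after
  \<open>\<epsilon>\<close>.  In the same way \<open>! (f + g) = \<Delta> ; (! f \<otimes> ! g) ; \<nabla>\<close>.

  The laws for \<open>\<eta> = (u \<otimes> 1) ; d\<close> are usually proved with biproducts.  In their place the object
  \<open>P = ! A \<otimes> ! B\<close> contains \<open>A\<close> and \<open>B\<close> as orthogonal retracts: the injections \<open>i\<^sub>1 = \<eta> \<otimes> u\<close> and
  \<open>i\<^sub>2 = u \<otimes> \<eta>\<close> and the projections \<open>p\<^sub>1 = \<epsilon> \<otimes> e\<close> and \<open>p\<^sub>2 = e \<otimes> \<epsilon>\<close> satisfy \<open>i\<^sub>j ; p\<^sub>j = 1\<close>, and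
  \<open>i\<^sub>j ; p\<^sub>k = 0\<close> for \<open>j \<noteq> k\<close>.
  The Leibniz rule at \<open>P\<close> gives
  \<open>(! i\<^sub>1 \<otimes> i\<^sub>2) ; d ; \<Delta> ; (! p\<^sub>1 \<otimes> ! p\<^sub>2) = 1 \<otimes> \<eta>\<close> (\<open>split_along_retracts\<close>).  Composing with \<open>\<nabla>\<close> turns this
  into \<open>d = (1 \<otimes> \<eta>) ; \<nabla>\<close>; composing with \<open>m\<close> and expanding the left side by the chain rule for \<open>d\<close> gives
  \<open>(1 \<otimes> \<eta>) ; m = (\<epsilon> \<otimes> 1) ; \<eta>\<close>.

  \<^bold>\<open>From a codereliction to sums and \<open>d\<close>.\<close>  The point is that \<open>! (f + g) = \<Delta> ; (! f \<otimes> ! g) ; \<nabla>\<close>, where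
  now the sum is the one defined from \<open>\<eta>\<close>.  Since \<open>\<epsilon> ; \<eta> = (1 \<otimes> \<eta>\<^sub>I) ; m\<close>, every arrow \<open>F : ! A \<rightarrow> ! B\<close> that
  commutes with tensoring by \<open>! I\<close> satisfies \<open>\<epsilon> ; \<eta> ; F ; \<epsilon> = F ; \<epsilon>\<close> (\<open>linear_factor\<close>), and if it is a
  coalgebra morphism as well then \<open>F = ! (\<eta> ; F ; \<epsilon>)\<close> (\<open>linear_eq_bmap\<close>).  The compatibility of \<open>\<nabla>\<close>
  and \<open>u\<close> with \<open>m\<close> says that \<open>\<Delta> ; (! f \<otimes> ! g) ; \<nabla>\<close> and \<open>e ; u\<close> are such arrows.  The laws of an additive
  symmetric monoidal category follow, and so does \<open>\<nabla> ; \<epsilon> = \<epsilon> \<otimes> e + e \<otimes> \<epsilon>\<close>.  The Leibniz rule reduces to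
  \<open>\<eta> ; \<Delta> = \<eta> \<otimes> u + u \<otimes> \<eta>\<close>, which is naturality of \<open>\<eta>\<close> at the sum of the two injections into
  \<open>! A \<otimes> ! A\<close>; the chain rule for \<open>d\<close> is the one for \<open>\<eta>\<close>, transported along \<open>\<nabla>\<close>.
\<close>

section \<open>Calculus in strict symmetric monoidal categories\<close>

context category
begin

lemma Hom_iff: "f \<in> Hom A B \<longleftrightarrow> f \<in> Arr C \<and> Dom C f = A \<and> Cod C f = B"
  by (auto simp: Hom_def)

lemma in_own_Hom: "f \<in> Arr C \<Longrightarrow> f \<in> Hom (Dom C f) (Cod C f)"
  by (simp add: Hom_iff)

declare Dom_Obj [simp] Cod_Obj [simp]

text \<open>
  Typing by \<open>Arr\<close>, \<open>Dom\<close> and \<open>Cod\<close> instead of by \<open>Hom\<close> leaves no variables in the side conditions of the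
  equations below that the equation itself does not bind, so the simplifier can discharge them.
  Composites and tensor products are normalised by associating to the right.
\<close>

lemma Idt_arr [simp]:
  assumes "A \<in> Obj C"
  shows "\<one> A \<in> Arr C" "Dom C (\<one> A) = A" "Cod C (\<one> A) = A"
  using Idt_Hom[OF assms] by (auto simp: Hom_iff)

lemma Comp_arr [simp]:
  assumes "f \<in> Arr C" "g \<in> Arr C" "Cod C f = Dom C g"
  shows "f ;; g \<in> Arr C" "Dom C (f ;; g) = Dom C f" "Cod C (f ;; g) = Cod C g"
  using Comp_Hom[of f "Dom C f" "Cod C f" g "Cod C g"] assms by (auto simp: Hom_iff)

lemma Idt_left' [simp]: "f \<in> Arr C \<Longrightarrow> Dom C f = A \<Longrightarrow> \<one> A ;; f = f"
  using Idt_left by (auto simp: Hom_iff)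

lemma Idt_right' [simp]: "f \<in> Arr C \<Longrightarrow> Cod C f = A \<Longrightarrow> f ;; \<one> A = f"
  using Idt_right by (auto simp: Hom_iff)

lemma Comp_assoc_right [simp]:
  "f \<in> Arr C \<Longrightarrow> g \<in> Arr C \<Longrightarrow> h \<in> Arr C \<Longrightarrow> Cod C f = Dom C g \<Longrightarrow> Cod C g = Dom C h \<Longrightarrow>
     (f ;; g) ;; h = f ;; (g ;; h)"
  using Comp_assoc[of f "Dom C f" "Cod C f" g "Cod C g" h "Cod C h"] by (auto simp: Hom_iff)

text \<open>
  With composites associated to the right, a redex \<open>a ;; b\<close> inside a longer composite appears as
  \<open>a ;; (b ;; x)\<close>; this rule adapts an equation to that position.
\<close>

lemma whisker:
  assumes "a ;; b = c" "a \<in> Arr C" "b \<in> Arr C" "x \<in> Arr C" "Cod C a = Dom C b" "Cod C b = Dom C x"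
  shows "a ;; (b ;; x) = c ;; x"
  using assms by (metis Comp_assoc_right)

end

context symmetric_monoidal_category
begin

declare Unit_Obj [simp] TenO_Obj [simp] TenO_assoc [simp] TenO_Unit_left [simp] TenO_Unit_right [simp]
  TenA_assoc [simp] TenA_Unit_left [simp] TenA_Unit_right [simp]

lemma TenA_arr [simp]:
  assumes "f \<in> Arr C" "g \<in> Arr C"
  shows "f \<otimes> g \<in> Arr C" "Dom C (f \<otimes> g) = Dom C f \<odot> Dom C g" "Cod C (f \<otimes> g) = Cod C f \<odot> Cod C g"
  using TenA_Hom[OF in_own_Hom in_own_Hom, OF assms] by (auto simp: Hom_iff)

lemma Symm_arr [simp]:
  assumes "A \<in> Obj C" "B \<in> Obj C"
  shows "\<sigma> A B \<in> Arr C" "Dom C (\<sigma> A B) = A \<odot> B" "Cod C (\<sigma> A B) = B \<odot> A"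
  using Symm_Hom[OF assms] by (auto simp: Hom_iff)

lemma Idt_TenO [simp]: "A \<in> Obj C \<Longrightarrow> B \<in> Obj C \<Longrightarrow> \<one> (A \<odot> B) = \<one> A \<otimes> \<one> B"
  by (simp add: TenA_Idt)

lemma Idt2_left [simp]:
  "A \<in> Obj C \<Longrightarrow> B \<in> Obj C \<Longrightarrow> f \<in> Arr C \<Longrightarrow> Dom C f = A \<odot> B \<Longrightarrow> (\<one> A \<otimes> \<one> B) ;; f = f"
  by (simp add: TenA_Idt del: Idt_TenO)

lemma Idt2_right [simp]:
  "A \<in> Obj C \<Longrightarrow> B \<in> Obj C \<Longrightarrow> f \<in> Arr C \<Longrightarrow> Cod C f = A \<odot> B \<Longrightarrow> f ;; (\<one> A \<otimes> \<one> B) = f"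
  by (simp add: TenA_Idt del: Idt_TenO)

text \<open>
  Interchange is used to compose inside the tensor factors.  The variants with index 21 and 12 regroup
  three factors when one side has a factor whose domain or codomain is a tensor product.
\<close>

lemma interchange [simp]:
  assumes "f \<in> Arr C" "g \<in> Arr C" "f' \<in> Arr C" "g' \<in> Arr C" "Cod C f = Dom C g" "Cod C f' = Dom C g'"
  shows "(f \<otimes> f') ;; (g \<otimes> g') = (f ;; g) \<otimes> (f' ;; g')"
  using assms TenA_Comp[of f "Dom C f" "Cod C f" g "Cod C g" f' "Dom C f'" "Cod C f'" g' "Cod C g'"]
  by (auto simp: Hom_iff)

lemma interchange_whisker [simp]:
  assumes "f \<in> Arr C" "g \<in> Arr C" "f' \<in> Arr C" "g' \<in> Arr C" "Cod C f = Dom C g" "Cod C f' = Dom C g'"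
    "x \<in> Arr C" "Dom C x = Cod C g \<odot> Cod C g'"
  shows "(f \<otimes> f') ;; ((g \<otimes> g') ;; x) = ((f ;; g) \<otimes> (f' ;; g')) ;; x"
  by (rule whisker[OF interchange]) (use assms in simp_all)

lemma interchange21 [simp]:
  assumes "a \<in> Arr C" "b \<in> Arr C" "c \<in> Arr C" "x \<in> Arr C" "y \<in> Arr C"
    "Cod C a \<odot> Cod C b = Dom C x" "Cod C c = Dom C y"
  shows "(a \<otimes> (b \<otimes> c)) ;; (x \<otimes> y) = ((a \<otimes> b) ;; x) \<otimes> (c ;; y)"
  using assms interchange[of "a \<otimes> b" x c y] by simp

lemma interchange12 [simp]:
  assumes "a \<in> Arr C" "b \<in> Arr C" "c \<in> Arr C" "x \<in> Arr C" "y \<in> Arr C"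
    "Cod C x = Dom C a \<odot> Dom C b" "Cod C y = Dom C c"
  shows "(x \<otimes> y) ;; (a \<otimes> (b \<otimes> c)) = (x ;; (a \<otimes> b)) \<otimes> (y ;; c)"
  using assms interchange[of x "a \<otimes> b" y c] by simp

lemma interchange21_whisker [simp]:
  assumes "a \<in> Arr C" "b \<in> Arr C" "c \<in> Arr C" "x \<in> Arr C" "y \<in> Arr C"
    "Cod C a \<odot> Cod C b = Dom C x" "Cod C c = Dom C y" "z \<in> Arr C" "Dom C z = Cod C x \<odot> Cod C y"
  shows "(a \<otimes> (b \<otimes> c)) ;; ((x \<otimes> y) ;; z) = (((a \<otimes> b) ;; x) \<otimes> (c ;; y)) ;; z"
  using assms interchange_whisker[of "a \<otimes> b" x c y z] by simp

lemma interchange12_whisker [simp]: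
  assumes "a \<in> Arr C" "b \<in> Arr C" "c \<in> Arr C" "x \<in> Arr C" "y \<in> Arr C"
    "Cod C x = Dom C a \<odot> Dom C b" "Cod C y = Dom C c" "z \<in> Arr C" "Dom C z = Cod C a \<odot> (Cod C b \<odot> Cod C c)"
  shows "(x \<otimes> y) ;; ((a \<otimes> (b \<otimes> c)) ;; z) = ((x ;; (a \<otimes> b)) \<otimes> (y ;; c)) ;; z"
  by (rule whisker[OF interchange12]) (use assms in simp_all)

text \<open>
  The degenerate cases of interchange in which one factor starts or ends at the unit, so that its
  partner identity arrow is invisible in a strict category.
\<close>

lemma Comp_scalar_right:
  assumes "f \<in> Arr C" "g \<in> Arr C" "h \<in> Arr C" "Cod C f = Dom C h" "Cod C g = \<I>"
  shows "(f \<otimes> g) ;; h = (f ;; h) \<otimes> g"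
  using assms interchange[of f h g "\<one> \<I>"] by (simp del: interchange)

lemma Comp_scalar_left:
  assumes "f \<in> Arr C" "g \<in> Arr C" "h \<in> Arr C" "Cod C g = Dom C h" "Cod C f = \<I>"
  shows "(f \<otimes> g) ;; h = f \<otimes> (g ;; h)"
  using assms interchange[of f "\<one> \<I>" g h] by (simp del: interchange)

lemma scalar_Comp_right:
  assumes "f \<in> Arr C" "g \<in> Arr C" "h \<in> Arr C" "Cod C h = Dom C f" "Dom C g = \<I>"
  shows "h ;; (f \<otimes> g) = (h ;; f) \<otimes> g"
  using assms interchange[of h f "\<one> \<I>" g] by (simp del: interchange)

lemma scalar_Comp_left:
  assumes "f \<in> Arr C" "g \<in> Arr C" "h \<in> Arr C" "Cod C h = Dom C g" "Dom C f = \<I>"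
  shows "h ;; (f \<otimes> g) = f \<otimes> (h ;; g)"
  using assms interchange[of "\<one> \<I>" f h g] by (simp del: interchange)

lemmas Comp_scalar = Comp_scalar_right Comp_scalar_left

lemma Symm_nat:
  "f \<in> Arr C \<Longrightarrow> g \<in> Arr C \<Longrightarrow> Cod C f = A \<Longrightarrow> Cod C g = B \<Longrightarrow>
    (f \<otimes> g) ;; \<sigma> A B = \<sigma> (Dom C f) (Dom C g) ;; (g \<otimes> f)"
  using Symm_natural by (auto simp: Hom_iff)

lemma Symm_nat_rev:
  "f \<in> Arr C \<Longrightarrow> g \<in> Arr C \<Longrightarrow> Dom C f = A \<Longrightarrow> Dom C g = B \<Longrightarrow>
    \<sigma> A B ;; (g \<otimes> f) = (f \<otimes> g) ;; \<sigma> (Cod C f) (Cod C g)"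
  by (simp add: Symm_nat)

lemma Symm_Unit_right [simp]: "A \<in> Obj C \<Longrightarrow> \<sigma> A \<I> = \<one> A"
  by (rule Symm_Unit)

lemma Symm_Unit_left [simp]: "A \<in> Obj C \<Longrightarrow> \<sigma> \<I> A = \<one> A"
  using Symm_Symm[of A \<I>] by simp

text \<open>The middle-four exchange.\<close>

definition mid :: "'o \<Rightarrow> 'o \<Rightarrow> 'o \<Rightarrow> 'o \<Rightarrow> 'm"
  where "mid W X Y Z = \<one> W \<otimes> (\<sigma> X Y \<otimes> \<one> Z)"

lemma mid_arr [simp]:
  assumes "W \<in> Obj C" "X \<in> Obj C" "Y \<in> Obj C" "Z \<in> Obj C"
  shows "mid W X Y Z \<in> Arr C" "Dom C (mid W X Y Z) = W \<odot> (X \<odot> (Y \<odot> Z))"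
    "Cod C (mid W X Y Z) = W \<odot> (Y \<odot> (X \<odot> Z))"
  using assms by (simp_all add: mid_def)

lemma mid_nat:
  assumes "a \<in> Arr C" "b \<in> Arr C" "c \<in> Arr C" "d \<in> Arr C"
    "Cod C a = W" "Cod C b = X" "Cod C c = Y" "Cod C d = Z"
  shows "(a \<otimes> (b \<otimes> (c \<otimes> d))) ;; mid W X Y Z
       = mid (Dom C a) (Dom C b) (Dom C c) (Dom C d) ;; (a \<otimes> (c \<otimes> (b \<otimes> d)))"
proof -
  have "(a \<otimes> (b \<otimes> (c \<otimes> d))) ;; mid W X Y Z = a \<otimes> (((b \<otimes> c) ;; \<sigma> X Y) \<otimes> d)"
    using assms by (auto simp: mid_def simp del: interchange12)
  also have "\<dots> = a \<otimes> ((\<sigma> (Dom C b) (Dom C c) ;; (c \<otimes> b)) \<otimes> d)"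
    using assms by (subst Symm_nat) auto
  also have "\<dots> = mid (Dom C a) (Dom C b) (Dom C c) (Dom C d) ;; (a \<otimes> (c \<otimes> (b \<otimes> d)))"
    using assms by (auto simp: mid_def)
  finally show ?thesis .
qed

lemma mid_nat_rev:
  assumes "a \<in> Arr C" "b \<in> Arr C" "c \<in> Arr C" "d \<in> Arr C"
    "Dom C a = W" "Dom C b = X" "Dom C c = Y" "Dom C d = Z"
  shows "mid W X Y Z ;; (a \<otimes> (c \<otimes> (b \<otimes> d)))
       = (a \<otimes> (b \<otimes> (c \<otimes> d))) ;; mid (Cod C a) (Cod C b) (Cod C c) (Cod C d)"
  using assms mid_nat[of a b c d] by auto

lemma mid_Unit [simp]:
  assumes "W \<in> Obj C" "X \<in> Obj C" "Z \<in> Obj C"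
  shows "mid W \<I> X Z = \<one> W \<otimes> (\<one> X \<otimes> \<one> Z)" "mid W X \<I> Z = \<one> W \<otimes> (\<one> X \<otimes> \<one> Z)"
  using assms by (simp_all add: mid_def)

end

section \<open>Coalgebras of a monoidal coalgebra modality\<close>

lemma (in category) endofunctorD:
  assumes "endofunctor Fo Fa"
  shows "A \<in> Obj C \<Longrightarrow> Fo A \<in> Obj C"
    and "f \<in> Arr C \<Longrightarrow> Fa f \<in> Arr C"
    and "f \<in> Arr C \<Longrightarrow> Dom C (Fa f) = Fo (Dom C f)"
    and "f \<in> Arr C \<Longrightarrow> Cod C (Fa f) = Fo (Cod C f)"
    and "A \<in> Obj C \<Longrightarrow> Fa (\<one> A) = \<one> (Fo A)"
    and "f \<in> Arr C \<Longrightarrow> g \<in> Arr C \<Longrightarrow> Cod C f = Dom C g \<Longrightarrow> Fa (f ;; g) = Fa f ;; Fa g"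
proof -
  have "Fa f \<in> Hom (Fo (Dom C f)) (Fo (Cod C f))" if "f \<in> Arr C" for f
    using assms that in_own_Hom[OF that] unfolding endofunctor_def
    by (simp add: Pi_iff)
  then show "f \<in> Arr C \<Longrightarrow> Fa f \<in> Arr C"
    "f \<in> Arr C \<Longrightarrow> Dom C (Fa f) = Fo (Dom C f)" "f \<in> Arr C \<Longrightarrow> Cod C (Fa f) = Fo (Cod C f)"
    by (auto simp: Hom_iff)
qed (use assms in \<open>auto simp: endofunctor_def\<close>)

lemma (in category) naturalD:
  assumes "natural Fo Fa Go Ga \<tau>"
  shows "A \<in> Obj C \<Longrightarrow> \<tau> A \<in> Arr C"
    and "A \<in> Obj C \<Longrightarrow> Dom C (\<tau> A) = Fo A"
    and "A \<in> Obj C \<Longrightarrow> Cod C (\<tau> A) = Go A"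
    and "f \<in> Arr C \<Longrightarrow> Cod C f = B \<Longrightarrow> Fa f ;; \<tau> B = \<tau> (Dom C f) ;; Ga f"
proof -
  have "\<tau> A \<in> Hom (Fo A) (Go A)" if "A \<in> Obj C" for A
    using assms that PiE_mem by (fastforce simp: natural_def)
  then show "A \<in> Obj C \<Longrightarrow> \<tau> A \<in> Arr C"
    "A \<in> Obj C \<Longrightarrow> Dom C (\<tau> A) = Fo A" "A \<in> Obj C \<Longrightarrow> Cod C (\<tau> A) = Go A"
    by (auto simp: Hom_iff)
qed (use assms in \<open>auto simp: natural_def\<close>)

context coalgebra_modality
begin

lemmas bang_Obj [simp] = endofunctorD(1)[OF bang_functor]
lemmas bmap_arr [simp] = endofunctorD(2-4)[OF bang_functor]
lemmas bmap_Idt [simp] = endofunctorD(5)[OF bang_functor]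
lemmas bmap_Comp [simp] = endofunctorD(6)[OF bang_functor]

lemma bmap_Idt2 [simp]: "A \<in> Obj C \<Longrightarrow> B \<in> Obj C \<Longrightarrow> bmap (\<one> A \<otimes> \<one> B) = \<one> (bang (A \<odot> B))"
  using bmap_Idt[of "A \<odot> B"] by simp

lemmas \<delta>_arr [simp] = naturalD(1-3)[OF \<delta>_natural]
lemmas \<epsilon>_arr [simp] = naturalD(1-3)[OF \<epsilon>_natural]
lemmas \<Delta>_arr [simp] = naturalD(1-3)[OF \<Delta>_natural]
lemmas e_arr [simp] = naturalD(1-3)[OF e_natural]

lemmas \<delta>_nat [simp] = naturalD(4)[OF \<delta>_natural]
lemmas \<epsilon>_nat [simp] = naturalD(4)[OF \<epsilon>_natural]
lemmas \<Delta>_nat [simp] = naturalD(4)[OF \<Delta>_natural]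

lemma e_nat [simp]: "f \<in> Arr C \<Longrightarrow> Cod C f = B \<Longrightarrow> bmap f ;; e B = e (Dom C f)"
  using naturalD(4)[OF e_natural] by simp

lemmas \<delta>_nat_whisker [simp] = whisker[OF \<delta>_nat]
lemmas \<epsilon>_nat_whisker [simp] = whisker[OF \<epsilon>_nat]
lemmas \<Delta>_nat_whisker [simp] = whisker[OF \<Delta>_nat]
lemmas e_nat_whisker [simp] = whisker[OF e_nat]

lemmas \<delta>_counit [simp] = \<delta>_\<epsilon>_bang \<delta>_bmap_\<epsilon>
lemmas \<delta>_counit_whisker [simp] = \<delta>_\<epsilon>_bang[THEN whisker] \<delta>_bmap_\<epsilon>[THEN whisker]

lemma \<Delta>_coassoc: "A \<in> Obj C \<Longrightarrow> \<Delta> A ;; (\<Delta> A \<otimes> \<one> (bang A)) = \<Delta> A ;; (\<one> (bang A) \<otimes> \<Delta> A)"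
  and \<Delta>_counit_left [simp]: "A \<in> Obj C \<Longrightarrow> \<Delta> A ;; (e A \<otimes> \<one> (bang A)) = \<one> (bang A)"
  and \<Delta>_counit_right [simp]: "A \<in> Obj C \<Longrightarrow> \<Delta> A ;; (\<one> (bang A) \<otimes> e A) = \<one> (bang A)"
  and \<Delta>_cocommute: "A \<in> Obj C \<Longrightarrow> \<Delta> A ;; \<sigma> (bang A) (bang A) = \<Delta> A"
  using bang_comonoid by (auto simp: cocommutative_comonoid_def)

lemma \<delta>_\<Delta>: "A \<in> Obj C \<Longrightarrow> \<delta> A ;; \<Delta> (bang A) = \<Delta> A ;; (\<delta> A \<otimes> \<delta> A)"
  and \<delta>_e [simp]: "A \<in> Obj C \<Longrightarrow> \<delta> A ;; e (bang A) = e A"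
  using \<delta>_comonoid_morphism by (auto simp: comonoid_morphism_def)

lemma \<Delta>_discard_left [simp]:
  assumes "A \<in> Obj C" "y \<in> Arr C" "Dom C y = bang A" "x \<in> Arr C" "Dom C x = \<I>"
  shows "\<Delta> A ;; ((e A ;; x) \<otimes> y) = x \<otimes> y"
proof -
  have "\<Delta> A ;; ((e A ;; x) \<otimes> y) = \<Delta> A ;; ((e A \<otimes> \<one> (bang A)) ;; (x \<otimes> y))"
    using assms by simp
  also have "\<dots> = x \<otimes> y"
    using assms by (subst whisker[OF \<Delta>_counit_left]) auto
  finally show ?thesis .
qed

lemma \<Delta>_discard_left' [simp]:
  "A \<in> Obj C \<Longrightarrow> y \<in> Arr C \<Longrightarrow> Dom C y = bang A \<Longrightarrow> \<Delta> A ;; (e A \<otimes> y) = y"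
  using \<Delta>_discard_left[of A y "\<one> \<I>"] by simp

lemma \<Delta>_discard_right [simp]:
  assumes "A \<in> Obj C" "y \<in> Arr C" "Dom C y = bang A" "x \<in> Arr C" "Dom C x = \<I>"
  shows "\<Delta> A ;; (y \<otimes> (e A ;; x)) = y \<otimes> x"
proof -
  have "\<Delta> A ;; (y \<otimes> (e A ;; x)) = \<Delta> A ;; ((\<one> (bang A) \<otimes> e A) ;; (y \<otimes> x))"
    using assms by simp
  also have "\<dots> = y \<otimes> x"
    using assms by (subst whisker[OF \<Delta>_counit_right]) auto
  finally show ?thesis .
qed

lemma \<Delta>_discard_right' [simp]:
  "A \<in> Obj C \<Longrightarrow> y \<in> Arr C \<Longrightarrow> Dom C y = bang A \<Longrightarrow> \<Delta> A ;; (y \<otimes> e A) = y"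
  using \<Delta>_discard_right[of A y "\<one> \<I>"] by simp

lemmas \<Delta>_discard_whisker [simp] =
  \<Delta>_discard_left[THEN whisker] \<Delta>_discard_left'[THEN whisker]
  \<Delta>_discard_right[THEN whisker] \<Delta>_discard_right'[THEN whisker]

end

context monoidal_coalgebra_modality
begin

lemma m_arr [simp]:
  assumes "A \<in> Obj C" "B \<in> Obj C"
  shows "m A B \<in> Arr C" "Dom C (m A B) = bang A \<odot> bang B" "Cod C (m A B) = bang (A \<odot> B)"
  using PiE_mem[OF PiE_mem[OF m_Hom assms(1)] assms(2)] by (auto simp: Hom_iff)

lemma mI_arr [simp]: "mI \<in> Arr C" "Dom C mI = \<I>" "Cod C mI = bang \<I>"
  using mI_Hom by (auto simp: Hom_iff)

lemma m_nat:
  "f \<in> Arr C \<Longrightarrow> g \<in> Arr C \<Longrightarrow> Cod C f = A' \<Longrightarrow> Cod C g = B' \<Longrightarrow>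
     (bmap f \<otimes> bmap g) ;; m A' B' = m (Dom C f) (Dom C g) ;; bmap (f \<otimes> g)"
  using m_natural by (auto simp: Hom_iff)

lemma m_\<Delta>_mid:
  "A \<in> Obj C \<Longrightarrow> B \<in> Obj C \<Longrightarrow> m A B ;; \<Delta> (A \<odot> B) =
     (\<Delta> A \<otimes> \<Delta> B) ;; (mid (bang A) (bang A) (bang B) (bang B) ;; (m A B \<otimes> m A B))"
  by (simp add: m_\<Delta> mid_def)

text \<open>
  A coalgebra is identified with its structure map; the underlying object is the domain.
\<close>

definition coalg :: "'m \<Rightarrow> bool"
  where "coalg \<chi> \<longleftrightarrow> \<chi> \<in> Arr C \<and> Cod C \<chi> = bang (Dom C \<chi>) \<and>
    \<chi> ;; \<epsilon> (Dom C \<chi>) = \<one> (Dom C \<chi>) \<and> \<chi> ;; \<delta> (Dom C \<chi>) = \<chi> ;; bmap \<chi>"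

definition coalg_hom :: "'m \<Rightarrow> 'm \<Rightarrow> 'm \<Rightarrow> bool"
  where "coalg_hom \<chi> \<psi> f \<longleftrightarrow> f \<in> Arr C \<and> Dom C f = Dom C \<chi> \<and> Cod C f = Dom C \<psi> \<and>
    f ;; \<psi> = \<chi> ;; bmap f"

text \<open>
  This is the cartesian product of coalgebras: every coalgebra inherits a cocommutative comonoid
  structure from the cofree one, and every coalgebra morphism preserves it.
\<close>

definition coalg_tensor :: "'m \<Rightarrow> 'm \<Rightarrow> 'm"
  where "coalg_tensor \<chi> \<psi> = (\<chi> \<otimes> \<psi>) ;; m (Dom C \<chi>) (Dom C \<psi>)"

lemma coalg_arr [simp]:
  "coalg \<chi> \<Longrightarrow> \<chi> \<in> Arr C" "coalg \<chi> \<Longrightarrow> Cod C \<chi> = bang (Dom C \<chi>)"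
  unfolding coalg_def by blast+

lemma coalg_counit: "coalg \<chi> \<Longrightarrow> \<chi> ;; \<epsilon> (Dom C \<chi>) = \<one> (Dom C \<chi>)"
  and coalg_coassoc: "coalg \<chi> \<Longrightarrow> \<chi> ;; \<delta> (Dom C \<chi>) = \<chi> ;; bmap \<chi>"
  unfolding coalg_def by blast+

lemma coalg_tensor_arr [simp]:
  assumes "coalg \<chi>" "coalg \<psi>"
  shows "coalg_tensor \<chi> \<psi> \<in> Arr C" "Dom C (coalg_tensor \<chi> \<psi>) = Dom C \<chi> \<odot> Dom C \<psi>"
    "Cod C (coalg_tensor \<chi> \<psi>) = bang (Dom C \<chi> \<odot> Dom C \<psi>)"
  using assms by (auto simp: coalg_tensor_def)

lemma coalg_\<delta> [simp]: "A \<in> Obj C \<Longrightarrow> coalg (\<delta> A)"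
  unfolding coalg_def by (simp add: \<delta>_coassoc)

lemma coalg_mI [simp]: "coalg mI"
  unfolding coalg_def by (simp add: mI_\<epsilon> mI_\<delta>)

lemma coalg_coalg_tensor [simp]:
  assumes "coalg \<chi>" "coalg \<psi>"
  shows "coalg (coalg_tensor \<chi> \<psi>)"
proof -
  let ?X = "Dom C \<chi>" and ?Y = "Dom C \<psi>"
  have "coalg_tensor \<chi> \<psi> ;; \<delta> (?X \<odot> ?Y) = (\<chi> \<otimes> \<psi>) ;; ((\<delta> ?X \<otimes> \<delta> ?Y) ;; (m (bang ?X) (bang ?Y) ;; bmap (m ?X ?Y)))"
    using assms by (simp add: coalg_tensor_def m_\<delta>)
  also have "\<dots> = (\<chi> \<otimes> \<psi>) ;; ((bmap \<chi> \<otimes> bmap \<psi>) ;; (m (bang ?X) (bang ?Y) ;; bmap (m ?X ?Y)))"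
    using assms by (simp add: coalg_coassoc)
  also have "\<dots> = (\<chi> \<otimes> \<psi>) ;; (m ?X ?Y ;; (bmap (\<chi> \<otimes> \<psi>) ;; bmap (m ?X ?Y)))"
    using assms by (subst whisker[OF m_nat]) auto
  also have "\<dots> = coalg_tensor \<chi> \<psi> ;; bmap (coalg_tensor \<chi> \<psi>)"
    using assms by (simp add: coalg_tensor_def)
  finally have "coalg_tensor \<chi> \<psi> ;; \<delta> (?X \<odot> ?Y) = coalg_tensor \<chi> \<psi> ;; bmap (coalg_tensor \<chi> \<psi>)" .
  moreover have "coalg_tensor \<chi> \<psi> ;; \<epsilon> (?X \<odot> ?Y) = \<one> (?X \<odot> ?Y)"
    using assms by (simp add: coalg_tensor_def m_\<epsilon> coalg_counit)
  ultimately show ?thesis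
    using assms unfolding coalg_def[of "coalg_tensor \<chi> \<psi>"] by simp
qed

text \<open>
  Strictness of the base makes the category of coalgebras strict monoidal with unit \<open>mI\<close>, which lets
  coalgebra morphisms be regrouped by rewriting.
\<close>

lemma coalg_tensor_assoc [simp]:
  assumes "coalg \<chi>" "coalg \<psi>" "coalg \<theta>"
  shows "coalg_tensor (coalg_tensor \<chi> \<psi>) \<theta> = coalg_tensor \<chi> (coalg_tensor \<psi> \<theta>)"
proof -
  let ?X = "Dom C \<chi>" and ?Y = "Dom C \<psi>" and ?Z = "Dom C \<theta>"
  have "coalg_tensor (coalg_tensor \<chi> \<psi>) \<theta> = (\<chi> \<otimes> (\<psi> \<otimes> \<theta>)) ;; ((m ?X ?Y \<otimes> \<one> (bang ?Z)) ;; m (?X \<odot> ?Y) ?Z)"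
    using assms by (simp add: coalg_tensor_def)
  also have "\<dots> = (\<chi> \<otimes> (\<psi> \<otimes> \<theta>)) ;; ((\<one> (bang ?X) \<otimes> m ?Y ?Z) ;; m ?X (?Y \<odot> ?Z))"
    using assms by (simp only: m_assoc Dom_Obj coalg_arr)
  also have "\<dots> = coalg_tensor \<chi> (coalg_tensor \<psi> \<theta>)"
    using assms by (simp add: coalg_tensor_def)
  finally show ?thesis .
qed

lemma coalg_tensor_mI_left [simp]:
  assumes "coalg \<chi>" shows "coalg_tensor mI \<chi> = \<chi>"
proof -
  have "coalg_tensor mI \<chi> = (\<one> \<I> \<otimes> \<chi>) ;; ((mI \<otimes> \<one> (bang (Dom C \<chi>))) ;; m \<I> (Dom C \<chi>))"
    using assms by (simp add: coalg_tensor_def del: TenA_Unit_left)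
  also have "\<dots> = \<chi>"
    using assms by (subst m_unit_left) auto
  finally show ?thesis .
qed

lemma coalg_tensor_mI_right [simp]:
  assumes "coalg \<chi>" shows "coalg_tensor \<chi> mI = \<chi>"
proof -
  have "coalg_tensor \<chi> mI = (\<chi> \<otimes> \<one> \<I>) ;; ((\<one> (bang (Dom C \<chi>)) \<otimes> mI) ;; m (Dom C \<chi>) \<I>)"
    using assms by (simp add: coalg_tensor_def del: TenA_Unit_right)
  also have "\<dots> = \<chi>"
    using assms by (subst m_unit_right) auto
  finally show ?thesis .
qed

lemma coalg_hom_arr:
  "coalg_hom \<chi> \<psi> f \<Longrightarrow> f \<in> Arr C" "coalg_hom \<chi> \<psi> f \<Longrightarrow> Dom C f = Dom C \<chi>" "coalg_hom \<chi> \<psi> f \<Longrightarrow> Cod C f = Dom C \<psi>"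
  "coalg_hom \<chi> \<psi> f \<Longrightarrow> f ;; \<psi> = \<chi> ;; bmap f"
  by (auto simp: coalg_hom_def)

lemma coalg_hom_Comp:
  assumes "coalg \<chi>" "coalg \<psi>" "coalg \<theta>" "coalg_hom \<chi> \<psi> f" "coalg_hom \<psi> \<theta> g"
  shows "coalg_hom \<chi> \<theta> (f ;; g)"
proof -
  note [simp] = coalg_hom_arr(1-3)[OF assms(4)] coalg_hom_arr(1-3)[OF assms(5)]
  have "(f ;; g) ;; \<theta> = f ;; (\<psi> ;; bmap g)"
    using assms by (simp add: coalg_hom_arr(4)[OF assms(5)])
  also have "\<dots> = \<chi> ;; bmap (f ;; g)"
    using assms by (subst whisker[OF coalg_hom_arr(4)[OF assms(4)]]) auto
  finally show ?thesis by (simp add: coalg_hom_def)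
qed

lemma coalg_hom_Idt [simp]: "coalg \<chi> \<Longrightarrow> Dom C \<chi> = A \<Longrightarrow> coalg_hom \<chi> \<chi> (\<one> A)"
  by (auto simp: coalg_hom_def)

lemma coalg_hom_TenA:
  assumes "coalg \<chi>" "coalg \<psi>" "coalg \<chi>'" "coalg \<psi>'" "coalg_hom \<chi> \<psi> f" "coalg_hom \<chi>' \<psi>' g"
  shows "coalg_hom (coalg_tensor \<chi> \<chi>') (coalg_tensor \<psi> \<psi>') (f \<otimes> g)"
proof -
  note [simp] = coalg_hom_arr(1-3)[OF assms(5)] coalg_hom_arr(1-3)[OF assms(6)]
  have "(f \<otimes> g) ;; coalg_tensor \<psi> \<psi>' = (\<chi> \<otimes> \<chi>') ;; ((bmap f \<otimes> bmap g) ;; m (Dom C \<psi>) (Dom C \<psi>'))"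
    using assms by (simp add: coalg_tensor_def coalg_hom_arr(4)[OF assms(5)] coalg_hom_arr(4)[OF assms(6)])
  also have "\<dots> = coalg_tensor \<chi> \<chi>' ;; bmap (f \<otimes> g)"
    using assms by (subst m_nat) (auto simp: coalg_tensor_def)
  finally show ?thesis using assms by (simp add: coalg_hom_def)
qed

lemma coalg_hom_bmap: "f \<in> Arr C \<Longrightarrow> Dom C f = A \<Longrightarrow> Cod C f = B \<Longrightarrow> coalg_hom (\<delta> A) (\<delta> B) (bmap f)"
  by (auto simp: coalg_hom_def)

lemma coalg_hom_structure: "coalg \<chi> \<Longrightarrow> Dom C \<chi> = A \<Longrightarrow> coalg_hom \<chi> (\<delta> A) \<chi>"
  by (auto simp: coalg_hom_def coalg_coassoc)

text \<open>
  The structure of the modality consists of coalgebra morphisms: for \<open>\<Delta>\<close>, \<open>e\<close>, \<open>m\<close> and the symmetry this is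
  one compatibility axiom of a monoidal coalgebra modality each.
\<close>

lemma coalg_hom_\<Delta>: "A \<in> Obj C \<Longrightarrow> coalg_hom (\<delta> A) (coalg_tensor (\<delta> A) (\<delta> A)) (\<Delta> A)"
  by (simp add: coalg_hom_def coalg_tensor_def \<delta>_bmap_\<Delta>)

lemma coalg_hom_e: "A \<in> Obj C \<Longrightarrow> coalg_hom (\<delta> A) mI (e A)"
  by (simp add: coalg_hom_def \<delta>_bmap_e)

lemma coalg_hom_m: "A \<in> Obj C \<Longrightarrow> B \<in> Obj C \<Longrightarrow> coalg_hom (coalg_tensor (\<delta> A) (\<delta> B)) (\<delta> (A \<odot> B)) (m A B)"
  by (simp add: coalg_hom_def coalg_tensor_def m_\<delta>)

lemma coalg_hom_\<sigma>:
  assumes "coalg \<chi>" "coalg \<psi>"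
  shows "coalg_hom (coalg_tensor \<chi> \<psi>) (coalg_tensor \<psi> \<chi>) (\<sigma> (Dom C \<chi>) (Dom C \<psi>))"
proof -
  let ?X = "Dom C \<chi>" and ?Y = "Dom C \<psi>"
  have "\<sigma> ?X ?Y ;; coalg_tensor \<psi> \<chi> = (\<sigma> ?X ?Y ;; (\<psi> \<otimes> \<chi>)) ;; m ?Y ?X"
    using assms by (simp add: coalg_tensor_def)
  also have "\<dots> = ((\<chi> \<otimes> \<psi>) ;; \<sigma> (bang ?X) (bang ?Y)) ;; m ?Y ?X"
    using assms by (subst Symm_nat) auto
  also have "\<dots> = (\<chi> \<otimes> \<psi>) ;; (\<sigma> (bang ?X) (bang ?Y) ;; m ?Y ?X)"
    using assms by simp
  also have "\<dots> = coalg_tensor \<chi> \<psi> ;; bmap (\<sigma> ?X ?Y)"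
    using assms by (simp add: coalg_tensor_def m_symmetric[symmetric])
  finally show ?thesis using assms by (simp add: coalg_hom_def)
qed

lemma coalg_hom_mid:
  assumes "coalg \<chi>1" "coalg \<chi>2" "coalg \<chi>3" "coalg \<chi>4"
  shows "coalg_hom (coalg_tensor \<chi>1 (coalg_tensor \<chi>2 (coalg_tensor \<chi>3 \<chi>4))) (coalg_tensor \<chi>1 (coalg_tensor \<chi>3 (coalg_tensor \<chi>2 \<chi>4)))
           (mid (Dom C \<chi>1) (Dom C \<chi>2) (Dom C \<chi>3) (Dom C \<chi>4))"
proof -
  have "coalg_hom (coalg_tensor (coalg_tensor \<chi>2 \<chi>3) \<chi>4) (coalg_tensor (coalg_tensor \<chi>3 \<chi>2) \<chi>4) (\<sigma> (Dom C \<chi>2) (Dom C \<chi>3) \<otimes> \<one> (Dom C \<chi>4))"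
    using assms by (intro coalg_hom_TenA coalg_hom_\<sigma>) auto
  then have "coalg_hom (coalg_tensor \<chi>2 (coalg_tensor \<chi>3 \<chi>4)) (coalg_tensor \<chi>3 (coalg_tensor \<chi>2 \<chi>4)) (\<sigma> (Dom C \<chi>2) (Dom C \<chi>3) \<otimes> \<one> (Dom C \<chi>4))"
    using assms by simp
  then show ?thesis
    unfolding mid_def using assms by (intro coalg_hom_TenA[OF _ _ _ _ coalg_hom_Idt]) auto
qed

text \<open>
  Cofreeness of \<open>\<delta> A\<close>: a coalgebra morphism \<open>h\<close> into it satisfies
  \<open>h = h ; \<delta> ; !\<epsilon> = \<chi> ; !(h ; \<epsilon>)\<close>.
\<close>

lemma coalg_hom_eqI:
  assumes "coalg \<chi>" "A \<in> Obj C" "coalg_hom \<chi> (\<delta> A) f" "coalg_hom \<chi> (\<delta> A) g" "f ;; \<epsilon> A = g ;; \<epsilon> A"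
  shows "f = g"
proof -
  have *: "h = \<chi> ;; bmap (h ;; \<epsilon> A)" if "coalg_hom \<chi> (\<delta> A) h" for h
  proof -
    note [simp] = coalg_hom_arr(1-3)[OF that]
    have "h = h ;; (\<delta> A ;; bmap (\<epsilon> A))" using assms by simp
    also have "\<dots> = \<chi> ;; bmap (h ;; \<epsilon> A)"
      using assms by (subst whisker[OF coalg_hom_arr(4)[OF that]]) auto
    finally show ?thesis .
  qed
  show ?thesis using *[OF assms(3)] *[OF assms(4)] assms(5) by metis
qed

lemma coalg_hom_lift:
  assumes "coalg \<chi>" "h \<in> Arr C" "Dom C h = Dom C \<chi>" "Cod C h = A"
  shows "coalg_hom \<chi> (\<delta> A) (\<chi> ;; bmap h)"
  using assms by (intro coalg_hom_Comp[OF _ _ _ coalg_hom_structure coalg_hom_bmap]) auto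

lemma lift_\<epsilon>:
  assumes "coalg \<chi>" "h \<in> Arr C" "Dom C h = Dom C \<chi>" "Cod C h = A"
  shows "(\<chi> ;; bmap h) ;; \<epsilon> A = h"
  using assms by (auto simp: whisker[OF coalg_counit])

end

section \<open>Sums make the modality a monoidal bialgebra modality\<close>

context additive_category
begin

lemma add_arr [simp]:
  assumes "f \<in> Arr C" "g \<in> Arr C" "Dom C f = Dom C g" "Cod C f = Cod C g"
  shows "f \<oplus> g \<in> Arr C" "Dom C (f \<oplus> g) = Dom C g" "Cod C (f \<oplus> g) = Cod C g"
  using PiE_mem[OF PiE_mem[OF add_Hom assms(1)], of g] assms by (auto simp: Hom_iff)

lemma zero_arr [simp]:
  assumes "A \<in> Obj C" "B \<in> Obj C"
  shows "zero A B \<in> Arr C" "Dom C (zero A B) = A" "Cod C (zero A B) = B"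
  using PiE_mem[OF PiE_mem[OF zero_Hom assms(1)] assms(2)] by (auto simp: Hom_iff)

lemma add_zero_right [simp]: "f \<in> Arr C \<Longrightarrow> Dom C f = A \<Longrightarrow> Cod C f = B \<Longrightarrow> f \<oplus> zero A B = f"
  using add_zero by (auto simp: Hom_iff)

lemma add_comm: "f \<in> Arr C \<Longrightarrow> g \<in> Arr C \<Longrightarrow> Dom C f = Dom C g \<Longrightarrow> Cod C f = Cod C g \<Longrightarrow> f \<oplus> g = g \<oplus> f"
  using add_commute by (auto simp: Hom_iff)

lemma add_zero_left [simp]: "f \<in> Arr C \<Longrightarrow> Dom C f = A \<Longrightarrow> Cod C f = B \<Longrightarrow> zero A B \<oplus> f = f"
  using add_comm[of "zero A B" f] by auto

lemma add_assoc' [simp]: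
  "f \<in> Arr C \<Longrightarrow> g \<in> Arr C \<Longrightarrow> h \<in> Arr C \<Longrightarrow> Dom C f = Dom C g \<Longrightarrow> Cod C f = Cod C g \<Longrightarrow>
     Dom C g = Dom C h \<Longrightarrow> Cod C g = Cod C h \<Longrightarrow> (f \<oplus> g) \<oplus> h = f \<oplus> (g \<oplus> h)"
  using add_assoc by (auto simp: Hom_iff)

lemma Comp_add' [simp]:
  "f \<in> Arr C \<Longrightarrow> g \<in> Arr C \<Longrightarrow> h \<in> Arr C \<Longrightarrow> Cod C f = Dom C g \<Longrightarrow> Dom C g = Dom C h \<Longrightarrow>
     Cod C g = Cod C h \<Longrightarrow> f ;; (g \<oplus> h) = (f ;; g) \<oplus> (f ;; h)"
  using Comp_add by (auto simp: Hom_iff)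

lemma add_Comp' [simp]:
  "k \<in> Arr C \<Longrightarrow> g \<in> Arr C \<Longrightarrow> h \<in> Arr C \<Longrightarrow> Dom C g = Dom C h \<Longrightarrow>
     Cod C g = Cod C h \<Longrightarrow> Cod C h = Dom C k \<Longrightarrow> (g \<oplus> h) ;; k = (g ;; k) \<oplus> (h ;; k)"
  using add_Comp by (auto simp: Hom_iff)

lemma Comp_Comp_add:
  "f \<in> Arr C \<Longrightarrow> g \<in> Arr C \<Longrightarrow> h \<in> Arr C \<Longrightarrow> k \<in> Arr C \<Longrightarrow> Cod C f = Dom C g \<Longrightarrow> Cod C g = Dom C h \<Longrightarrow>
     Dom C h = Dom C k \<Longrightarrow> Cod C h = Cod C k \<Longrightarrow> (f ;; g) ;; (h \<oplus> k) = f ;; ((g ;; h) \<oplus> (g ;; k))"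
  by simp

lemma Comp_zero' [simp]:
  "f \<in> Arr C \<Longrightarrow> Cod C f = B \<Longrightarrow> D \<in> Obj C \<Longrightarrow> f ;; zero B D = zero (Dom C f) D"
  using Comp_zero by (auto simp: Hom_iff)

lemma zero_Comp' [simp]:
  "A \<in> Obj C \<Longrightarrow> k \<in> Arr C \<Longrightarrow> Dom C k = B \<Longrightarrow> zero A B ;; k = zero A (Cod C k)"
  using zero_Comp by (auto simp: Hom_iff)

end

context additive_symmetric_monoidal_category
begin

lemma TenA_add' [simp]:
  "f \<in> Arr C \<Longrightarrow> g \<in> Arr C \<Longrightarrow> h \<in> Arr C \<Longrightarrow> Dom C g = Dom C h \<Longrightarrow> Cod C g = Cod C h \<Longrightarrow>
     f \<otimes> (g \<oplus> h) = (f \<otimes> g) \<oplus> (f \<otimes> h)"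
  using TenA_add by (auto simp: Hom_iff)

lemma add_TenA' [simp]:
  "k \<in> Arr C \<Longrightarrow> g \<in> Arr C \<Longrightarrow> h \<in> Arr C \<Longrightarrow> Dom C g = Dom C h \<Longrightarrow> Cod C g = Cod C h \<Longrightarrow>
     (g \<oplus> h) \<otimes> k = (g \<otimes> k) \<oplus> (h \<otimes> k)"
  using add_TenA by (auto simp: Hom_iff)

lemma TenA_zero' [simp]:
  "f \<in> Arr C \<Longrightarrow> A \<in> Obj C \<Longrightarrow> B \<in> Obj C \<Longrightarrow> f \<otimes> zero A B = zero (Dom C f \<odot> A) (Cod C f \<odot> B)"
  using TenA_zero by (auto simp: Hom_iff)

lemma zero_TenA' [simp]:
  "f \<in> Arr C \<Longrightarrow> A \<in> Obj C \<Longrightarrow> B \<in> Obj C \<Longrightarrow> zero A B \<otimes> f = zero (A \<odot> Dom C f) (B \<odot> Cod C f)"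
  using zero_TenA by (auto simp: Hom_iff)

end

text \<open>
  A monoidal coalgebra modality with sums but as yet without differentiation; this already determines
  \<open>\<nabla>\<close> and \<open>u\<close>.
\<close>

locale additive_monoidal_modality =
  additive_symmetric_monoidal_category C add zero +
  monoidal_coalgebra_modality C bang bmap \<delta> \<epsilon> \<Delta> e m mI
  for C :: "('o, 'm) smc" (structure)
    and add  (infixl "\<oplus>" 55)
    and zero bang bmap \<delta> \<epsilon> \<Delta> e m mI
begin

definition nab :: "'o \<Rightarrow> 'm"
  where "nab = (\<lambda>A\<in>Obj C. (\<delta> A \<otimes> \<delta> A) ;; m (bang A) (bang A) ;; bmap ((\<epsilon> A \<otimes> e A) \<oplus> (e A \<otimes> \<epsilon> A)))"

definition u :: "'o \<Rightarrow> 'm"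
  where "u = (\<lambda>A\<in>Obj C. mI ;; bmap (zero \<I> A))"

lemma nab_eq: "A \<in> Obj C \<Longrightarrow> nab A = coalg_tensor (\<delta> A) (\<delta> A) ;; bmap ((\<epsilon> A \<otimes> e A) \<oplus> (e A \<otimes> \<epsilon> A))"
  by (simp add: nab_def coalg_tensor_def)

lemma u_eq: "A \<in> Obj C \<Longrightarrow> u A = mI ;; bmap (zero \<I> A)"
  by (simp add: u_def)

lemma nab_arr [simp]:
  "A \<in> Obj C \<Longrightarrow> nab A \<in> Arr C" "A \<in> Obj C \<Longrightarrow> Dom C (nab A) = bang A \<odot> bang A"
  "A \<in> Obj C \<Longrightarrow> Cod C (nab A) = bang A"
  by (simp_all add: nab_eq)

lemma u_arr [simp]:
  "A \<in> Obj C \<Longrightarrow> u A \<in> Arr C" "A \<in> Obj C \<Longrightarrow> Dom C (u A) = \<I>" "A \<in> Obj C \<Longrightarrow> Cod C (u A) = bang A"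
  by (simp_all add: u_eq)

lemma coalg_hom_nab: "A \<in> Obj C \<Longrightarrow> coalg_hom (coalg_tensor (\<delta> A) (\<delta> A)) (\<delta> A) (nab A)"
  by (simp add: nab_eq coalg_hom_lift)

lemma coalg_hom_u: "A \<in> Obj C \<Longrightarrow> coalg_hom mI (\<delta> A) (u A)"
  by (simp add: u_eq coalg_hom_lift)

lemma nab_\<epsilon> [simp]: "A \<in> Obj C \<Longrightarrow> nab A ;; \<epsilon> A = (\<epsilon> A \<otimes> e A) \<oplus> (e A \<otimes> \<epsilon> A)"
  unfolding nab_eq by (rule lift_\<epsilon>) auto

lemma u_\<epsilon> [simp]: "A \<in> Obj C \<Longrightarrow> u A ;; \<epsilon> A = zero \<I> A"
  unfolding u_eq by (rule lift_\<epsilon>) auto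

lemmas nab_\<epsilon>_whisker [simp] = nab_\<epsilon>[THEN whisker]
lemmas u_\<epsilon>_whisker [simp] = u_\<epsilon>[THEN whisker]

lemma nab_e [simp]: "A \<in> Obj C \<Longrightarrow> nab A ;; e A = e A \<otimes> e A"
  by (simp add: nab_eq coalg_tensor_def m_e)

lemma u_e [simp]: "A \<in> Obj C \<Longrightarrow> u A ;; e A = \<one> \<I>"
  by (simp add: u_eq mI_e)

lemma bmap_zero: "A \<in> Obj C \<Longrightarrow> B \<in> Obj C \<Longrightarrow> bmap (zero A B) = e A ;; u B"
  by (rule coalg_hom_eqI[of "\<delta> A" B])
    (auto intro!: coalg_hom_bmap coalg_hom_Comp[OF _ _ _ coalg_hom_e coalg_hom_u])

text \<open>
  The functor \<open>!\<close> takes sums to convolution: both sides are coalgebra morphisms, and after \<open>\<epsilon>\<close> both are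
  \<open>\<epsilon> ; f + \<epsilon> ; g\<close>.
\<close>

lemma \<Delta>_bmap_nab:
  assumes "f \<in> Arr C" "g \<in> Arr C" "Dom C f = A" "Dom C g = A" "Cod C f = B" "Cod C g = B"
  shows "\<Delta> A ;; ((bmap f \<otimes> bmap g) ;; nab B) = bmap (f \<oplus> g)"
proof (rule coalg_hom_eqI[of "\<delta> A" B])
  have [simp]: "A \<in> Obj C" "B \<in> Obj C" using assms by auto
  have "coalg_hom (coalg_tensor (\<delta> A) (\<delta> A)) (coalg_tensor (\<delta> B) (\<delta> B)) (bmap f \<otimes> bmap g)"
    using assms by (intro coalg_hom_TenA coalg_hom_bmap) auto
  then show "coalg_hom (\<delta> A) (\<delta> B) (\<Delta> A ;; ((bmap f \<otimes> bmap g) ;; nab B))"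
    by (intro coalg_hom_Comp[OF _ _ _ coalg_hom_\<Delta>] coalg_hom_Comp[OF _ _ _ _ coalg_hom_nab]) auto
qed (use assms in \<open>auto intro!: coalg_hom_bmap\<close>)

text \<open>
  From here to the compatibility with \<open>m\<close>, each law except those for \<open>\<nabla> ; \<Delta>\<close> and \<open>u ; \<Delta>\<close> is an
  instance of \<open>coalg_hom_eqI\<close>: the two sides are coalgebra morphisms because they are built from such,
  and their composites with \<open>\<epsilon>\<close> agree because \<open>\<nabla>\<close> and \<open>u\<close> become \<open>\<epsilon> \<otimes> e + e \<otimes> \<epsilon>\<close> and \<open>0\<close>.
\<close>

lemma nab_nat:
  assumes "f \<in> Arr C" "Cod C f = B"
  shows "(bmap f \<otimes> bmap f) ;; nab B = nab (Dom C f) ;; bmap f"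
proof (rule coalg_hom_eqI[of "coalg_tensor (\<delta> (Dom C f)) (\<delta> (Dom C f))" B])
  show "coalg_hom (coalg_tensor (\<delta> (Dom C f)) (\<delta> (Dom C f))) (\<delta> B) ((bmap f \<otimes> bmap f) ;; nab B)"
    using assms by (intro coalg_hom_Comp[OF _ _ _ coalg_hom_TenA[OF _ _ _ _ coalg_hom_bmap coalg_hom_bmap] coalg_hom_nab]) auto
  show "coalg_hom (coalg_tensor (\<delta> (Dom C f)) (\<delta> (Dom C f))) (\<delta> B) (nab (Dom C f) ;; bmap f)"
    using assms by (intro coalg_hom_Comp[OF _ _ _ coalg_hom_nab coalg_hom_bmap]) auto
qed (use assms in \<open>auto simp: Comp_scalar\<close>)

lemma u_nat: "f \<in> Arr C \<Longrightarrow> u (Dom C f) ;; bmap f = u (Cod C f)"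
  by (rule coalg_hom_eqI[of mI "Cod C f"])
     (auto intro!: coalg_hom_u coalg_hom_Comp[OF _ _ _ coalg_hom_u coalg_hom_bmap])

lemma nab_assoc:
  assumes [simp]: "A \<in> Obj C"
  shows "(nab A \<otimes> \<one> (bang A)) ;; nab A = (\<one> (bang A) \<otimes> nab A) ;; nab A"
proof (rule coalg_hom_eqI[of "coalg_tensor (\<delta> A) (coalg_tensor (\<delta> A) (\<delta> A))" A])
  have "coalg_hom (coalg_tensor (coalg_tensor (\<delta> A) (\<delta> A)) (\<delta> A)) (\<delta> A) ((nab A \<otimes> \<one> (bang A)) ;; nab A)"
    by (intro coalg_hom_Comp[OF _ _ _ coalg_hom_TenA[OF _ _ _ _ coalg_hom_nab coalg_hom_Idt] coalg_hom_nab]) auto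
  then show "coalg_hom (coalg_tensor (\<delta> A) (coalg_tensor (\<delta> A) (\<delta> A))) (\<delta> A) ((nab A \<otimes> \<one> (bang A)) ;; nab A)"
    by simp
  show "coalg_hom (coalg_tensor (\<delta> A) (coalg_tensor (\<delta> A) (\<delta> A))) (\<delta> A) ((\<one> (bang A) \<otimes> nab A) ;; nab A)"
    by (intro coalg_hom_Comp[OF _ _ _ coalg_hom_TenA[OF _ _ _ _ coalg_hom_Idt coalg_hom_nab] coalg_hom_nab]) auto
qed auto

lemma nab_unit_left:
  assumes [simp]: "A \<in> Obj C"
  shows "(u A \<otimes> \<one> (bang A)) ;; nab A = \<one> (bang A)"
proof (rule coalg_hom_eqI[of "coalg_tensor mI (\<delta> A)" A])
  show "coalg_hom (coalg_tensor mI (\<delta> A)) (\<delta> A) ((u A \<otimes> \<one> (bang A)) ;; nab A)"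
    by (intro coalg_hom_Comp[OF _ _ _ coalg_hom_TenA[OF _ _ _ _ coalg_hom_u coalg_hom_Idt] coalg_hom_nab]) auto
qed auto

lemma nab_commute:
  assumes [simp]: "A \<in> Obj C"
  shows "\<sigma> (bang A) (bang A) ;; nab A = nab A"
proof (rule coalg_hom_eqI[of "coalg_tensor (\<delta> A) (\<delta> A)" A])
  show "coalg_hom (coalg_tensor (\<delta> A) (\<delta> A)) (\<delta> A) (\<sigma> (bang A) (bang A) ;; nab A)"
    using coalg_hom_\<sigma>[of "\<delta> A" "\<delta> A"] by (intro coalg_hom_Comp[OF _ _ _ _ coalg_hom_nab]) auto
  show "(\<sigma> (bang A) (bang A) ;; nab A) ;; \<epsilon> A = nab A ;; \<epsilon> A"
    by (simp add: Symm_nat_rev add_comm[of "\<epsilon> A \<otimes> e A"])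
qed (auto intro: coalg_hom_nab)

lemma nab_unit_right:
  assumes [simp]: "A \<in> Obj C"
  shows "(\<one> (bang A) \<otimes> u A) ;; nab A = \<one> (bang A)"
proof (rule coalg_hom_eqI[of "coalg_tensor (\<delta> A) mI" A])
  show "coalg_hom (coalg_tensor (\<delta> A) mI) (\<delta> A) ((\<one> (bang A) \<otimes> u A) ;; nab A)"
    by (intro coalg_hom_Comp[OF _ _ _ coalg_hom_TenA[OF _ _ _ _ coalg_hom_Idt coalg_hom_u] coalg_hom_nab]) auto
qed auto

lemma nab_\<Delta>:
  assumes [simp]: "A \<in> Obj C"
  shows "nab A ;; \<Delta> A = (\<Delta> A \<otimes> \<Delta> A) ;; (mid (bang A) (bang A) (bang A) (bang A) ;; (nab A \<otimes> nab A))"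
proof -
  let ?h = "bmap ((\<epsilon> A \<otimes> e A) \<oplus> (e A \<otimes> \<epsilon> A))" and ?B = "bang A"
  have "nab A ;; \<Delta> A = (\<delta> A \<otimes> \<delta> A) ;; (m ?B ?B ;; (\<Delta> (?B \<odot> ?B) ;; (?h \<otimes> ?h)))"
    by (simp add: nab_eq coalg_tensor_def)
  also have "\<dots> = ((\<delta> A ;; \<Delta> ?B) \<otimes> (\<delta> A ;; \<Delta> ?B)) ;;
      (mid (bang ?B) (bang ?B) (bang ?B) (bang ?B) ;; ((m ?B ?B ;; ?h) \<otimes> (m ?B ?B ;; ?h)))"
    by (subst whisker[OF m_\<Delta>_mid]) auto
  also have "\<dots> = (\<Delta> A \<otimes> \<Delta> A) ;; (((\<delta> A \<otimes> (\<delta> A \<otimes> (\<delta> A \<otimes> \<delta> A))) ;; mid (bang ?B) (bang ?B) (bang ?B) (bang ?B)) ;;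
      ((m ?B ?B ;; ?h) \<otimes> (m ?B ?B ;; ?h)))"
    by (simp add: \<delta>_\<Delta>)
  also have "\<dots> = (\<Delta> A \<otimes> \<Delta> A) ;; (mid ?B ?B ?B ?B ;; (nab A \<otimes> nab A))"
    by (subst mid_nat) (auto simp: nab_eq coalg_tensor_def)
  finally show ?thesis .
qed

lemma u_\<Delta>: "A \<in> Obj C \<Longrightarrow> u A ;; \<Delta> A = u A \<otimes> u A"
  by (simp add: u_eq whisker[OF mI_\<Delta>])

lemma u_left_m:
  assumes [simp]: "A \<in> Obj C" "B \<in> Obj C"
  shows "(u A \<otimes> \<one> (bang B)) ;; m A B = e B ;; u (A \<odot> B)"
proof (rule coalg_hom_eqI[of "coalg_tensor mI (\<delta> B)" "A \<odot> B"])
  show "coalg_hom (coalg_tensor mI (\<delta> B)) (\<delta> (A \<odot> B)) ((u A \<otimes> \<one> (bang B)) ;; m A B)"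
    by (intro coalg_hom_Comp[OF _ _ _ coalg_hom_TenA[OF _ _ _ _ coalg_hom_u coalg_hom_Idt] coalg_hom_m]) auto
  show "coalg_hom (coalg_tensor mI (\<delta> B)) (\<delta> (A \<odot> B)) (e B ;; u (A \<odot> B))"
    using coalg_hom_Comp[OF _ _ _ coalg_hom_e coalg_hom_u] by simp
qed (auto simp: m_\<epsilon>)

lemma u_right_m:
  assumes [simp]: "A \<in> Obj C" "B \<in> Obj C"
  shows "(\<one> (bang A) \<otimes> u B) ;; m A B = e A ;; u (A \<odot> B)"
proof (rule coalg_hom_eqI[of "coalg_tensor (\<delta> A) mI" "A \<odot> B"])
  show "coalg_hom (coalg_tensor (\<delta> A) mI) (\<delta> (A \<odot> B)) ((\<one> (bang A) \<otimes> u B) ;; m A B)"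
    by (intro coalg_hom_Comp[OF _ _ _ coalg_hom_TenA[OF _ _ _ _ coalg_hom_Idt coalg_hom_u] coalg_hom_m]) auto
  show "coalg_hom (coalg_tensor (\<delta> A) mI) (\<delta> (A \<odot> B)) (e A ;; u (A \<odot> B))"
    using coalg_hom_Comp[OF _ _ _ coalg_hom_e coalg_hom_u] by simp
qed (auto simp: m_\<epsilon>)

lemma nab_right_m:
  assumes [simp]: "A \<in> Obj C" "B \<in> Obj C"
  shows "(\<one> (bang A) \<otimes> nab B) ;; m A B =
    (\<Delta> A \<otimes> (\<one> (bang B) \<otimes> \<one> (bang B))) ;; (mid (bang A) (bang A) (bang B) (bang B) ;;
      ((m A B \<otimes> m A B) ;; nab (A \<odot> B)))" (is "?l = ?r")
proof (rule coalg_hom_eqI[of "coalg_tensor (\<delta> A) (coalg_tensor (\<delta> B) (\<delta> B))" "A \<odot> B"])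
  show "coalg_hom (coalg_tensor (\<delta> A) (coalg_tensor (\<delta> B) (\<delta> B))) (\<delta> (A \<odot> B)) ?l"
    by (intro coalg_hom_Comp[OF _ _ _ coalg_hom_TenA[OF _ _ _ _ coalg_hom_Idt coalg_hom_nab] coalg_hom_m]) auto
  have "coalg_hom (coalg_tensor (coalg_tensor (\<delta> A) (\<delta> B)) (coalg_tensor (\<delta> A) (\<delta> B))) (\<delta> (A \<odot> B)) ((m A B \<otimes> m A B) ;; nab (A \<odot> B))"
    by (intro coalg_hom_Comp[OF _ _ _ coalg_hom_TenA[OF _ _ _ _ coalg_hom_m coalg_hom_m] coalg_hom_nab]) auto
  then have 1: "coalg_hom (coalg_tensor (\<delta> A) (coalg_tensor (\<delta> B) (coalg_tensor (\<delta> A) (\<delta> B)))) (\<delta> (A \<odot> B)) ((m A B \<otimes> m A B) ;; nab (A \<odot> B))"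
    by simp
  have 2: "coalg_hom (coalg_tensor (\<delta> A) (coalg_tensor (\<delta> A) (coalg_tensor (\<delta> B) (\<delta> B)))) (coalg_tensor (\<delta> A) (coalg_tensor (\<delta> B) (coalg_tensor (\<delta> A) (\<delta> B))))
      (mid (bang A) (bang A) (bang B) (bang B))"
    using coalg_hom_mid[of "\<delta> A" "\<delta> A" "\<delta> B" "\<delta> B"] by simp
  have "coalg_hom (coalg_tensor (\<delta> A) (coalg_tensor (\<delta> B) (\<delta> B))) (coalg_tensor (coalg_tensor (\<delta> A) (\<delta> A)) (coalg_tensor (\<delta> B) (\<delta> B))) (\<Delta> A \<otimes> \<one> (bang B \<odot> bang B))"
    by (intro coalg_hom_TenA[OF _ _ _ _ coalg_hom_\<Delta> coalg_hom_Idt]) auto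
  then have 3: "coalg_hom (coalg_tensor (\<delta> A) (coalg_tensor (\<delta> B) (\<delta> B))) (coalg_tensor (\<delta> A) (coalg_tensor (\<delta> A) (coalg_tensor (\<delta> B) (\<delta> B)))) (\<Delta> A \<otimes> (\<one> (bang B) \<otimes> \<one> (bang B)))"
    by simp
  show "coalg_hom (coalg_tensor (\<delta> A) (coalg_tensor (\<delta> B) (\<delta> B))) (\<delta> (A \<odot> B)) ?r"
    by (rule coalg_hom_Comp[OF _ _ _ 3 coalg_hom_Comp[OF _ _ _ 2 1]]) auto
  have "?r ;; \<epsilon> (A \<odot> B) = (\<Delta> A \<otimes> (\<one> (bang B) \<otimes> \<one> (bang B))) ;; (mid (bang A) (bang A) (bang B) (bang B) ;;
      ((\<epsilon> A \<otimes> (\<epsilon> B \<otimes> (e A \<otimes> e B))) \<oplus> (e A \<otimes> (e B \<otimes> (\<epsilon> A \<otimes> \<epsilon> B)))))"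
    by (simp add: m_\<epsilon> m_e)
  also have "\<dots> = (\<Delta> A \<otimes> (\<one> (bang B) \<otimes> \<one> (bang B))) ;;
      ((\<epsilon> A \<otimes> (e A \<otimes> (\<epsilon> B \<otimes> e B))) \<oplus> (e A \<otimes> (\<epsilon> A \<otimes> (e B \<otimes> \<epsilon> B))))"
    by (simp add: mid_nat_rev)
  also have "\<dots> = ?l ;; \<epsilon> (A \<odot> B)"
    by (simp add: m_\<epsilon>)
  finally show "?l ;; \<epsilon> (A \<odot> B) = ?r ;; \<epsilon> (A \<odot> B)" ..
qed auto

lemma nab_left_m:
  assumes [simp]: "A \<in> Obj C" "B \<in> Obj C"
  shows "(nab A \<otimes> \<one> (bang B)) ;; m A B =
    (\<one> (bang A) \<otimes> (\<one> (bang A) \<otimes> \<Delta> B)) ;; (mid (bang A) (bang A) (bang B) (bang B) ;;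
      ((m A B \<otimes> m A B) ;; nab (A \<odot> B)))" (is "?l = ?r")
proof (rule coalg_hom_eqI[of "coalg_tensor (\<delta> A) (coalg_tensor (\<delta> A) (\<delta> B))" "A \<odot> B"])
  have "coalg_hom (coalg_tensor (coalg_tensor (\<delta> A) (\<delta> A)) (\<delta> B)) (\<delta> (A \<odot> B)) ?l"
    by (intro coalg_hom_Comp[OF _ _ _ coalg_hom_TenA[OF _ _ _ _ coalg_hom_nab coalg_hom_Idt] coalg_hom_m]) auto
  then show "coalg_hom (coalg_tensor (\<delta> A) (coalg_tensor (\<delta> A) (\<delta> B))) (\<delta> (A \<odot> B)) ?l"
    by simp
  have "coalg_hom (coalg_tensor (coalg_tensor (\<delta> A) (\<delta> B)) (coalg_tensor (\<delta> A) (\<delta> B))) (\<delta> (A \<odot> B)) ((m A B \<otimes> m A B) ;; nab (A \<odot> B))"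
    by (intro coalg_hom_Comp[OF _ _ _ coalg_hom_TenA[OF _ _ _ _ coalg_hom_m coalg_hom_m] coalg_hom_nab]) auto
  then have 1: "coalg_hom (coalg_tensor (\<delta> A) (coalg_tensor (\<delta> B) (coalg_tensor (\<delta> A) (\<delta> B)))) (\<delta> (A \<odot> B)) ((m A B \<otimes> m A B) ;; nab (A \<odot> B))"
    by simp
  have 2: "coalg_hom (coalg_tensor (\<delta> A) (coalg_tensor (\<delta> A) (coalg_tensor (\<delta> B) (\<delta> B)))) (coalg_tensor (\<delta> A) (coalg_tensor (\<delta> B) (coalg_tensor (\<delta> A) (\<delta> B))))
      (mid (bang A) (bang A) (bang B) (bang B))"
    using coalg_hom_mid[of "\<delta> A" "\<delta> A" "\<delta> B" "\<delta> B"] by simp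
  have 3: "coalg_hom (coalg_tensor (\<delta> A) (coalg_tensor (\<delta> A) (\<delta> B))) (coalg_tensor (\<delta> A) (coalg_tensor (\<delta> A) (coalg_tensor (\<delta> B) (\<delta> B)))) (\<one> (bang A) \<otimes> (\<one> (bang A) \<otimes> \<Delta> B))"
    by (intro coalg_hom_TenA[OF _ _ _ _ coalg_hom_Idt] coalg_hom_\<Delta>) auto
  show "coalg_hom (coalg_tensor (\<delta> A) (coalg_tensor (\<delta> A) (\<delta> B))) (\<delta> (A \<odot> B)) ?r"
    by (rule coalg_hom_Comp[OF _ _ _ 3 coalg_hom_Comp[OF _ _ _ 2 1]]) auto
  have "?r ;; \<epsilon> (A \<odot> B) = (\<one> (bang A) \<otimes> (\<one> (bang A) \<otimes> \<Delta> B)) ;; (mid (bang A) (bang A) (bang B) (bang B) ;;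
      ((\<epsilon> A \<otimes> (\<epsilon> B \<otimes> (e A \<otimes> e B))) \<oplus> (e A \<otimes> (e B \<otimes> (\<epsilon> A \<otimes> \<epsilon> B)))))"
    by (simp add: m_\<epsilon> m_e)
  also have "\<dots> = (\<one> (bang A) \<otimes> (\<one> (bang A) \<otimes> \<Delta> B)) ;;
      ((\<epsilon> A \<otimes> (e A \<otimes> (\<epsilon> B \<otimes> e B))) \<oplus> (e A \<otimes> (\<epsilon> A \<otimes> (e B \<otimes> \<epsilon> B))))"
    by (simp add: mid_nat_rev)
  also have "\<dots> = ?l ;; \<epsilon> (A \<odot> B)"
    by (simp add: m_\<epsilon>)
  finally show "?l ;; \<epsilon> (A \<odot> B) = ?r ;; \<epsilon> (A \<odot> B)" ..
qed auto

end

context additive_monoidal_modality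
begin

lemma monoidal_bialgebra_modality: "monoidal_bialgebra_modality C bang bmap \<delta> \<epsilon> \<Delta> e m mI nab u"
proof -
  have nab_ext: "nab \<in> extensional (Obj C)" and u_ext: "u \<in> extensional (Obj C)"
    by (simp_all add: nab_def u_def)
  have mon: "commutative_monoid (bang A) (nab A) (u A)" if "A \<in> Obj C" for A
    using that nab_assoc nab_unit_left nab_unit_right nab_commute
    by (simp add: commutative_monoid_def Hom_iff)
  have bim: "bimonoid (bang A) (nab A) (u A) (\<Delta> A) (e A)" if "A \<in> Obj C" for A
    using that mon bang_comonoid nab_\<Delta>[of A] u_\<Delta>[of A]
    by (simp add: bimonoid_def mid_def)
  have nat1: "natural (\<lambda>A. bang A \<odot> bang A) (\<lambda>f. bmap f \<otimes> bmap f) bang bmap nab"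
    unfolding natural_def by (auto simp: Hom_iff nab_nat PiE_iff nab_ext)
  have nat2: "natural (\<lambda>_. \<I>) (\<lambda>_. \<one> \<I>) bang bmap u"
    unfolding natural_def by (auto simp: Hom_iff u_nat PiE_iff u_ext)
  show ?thesis
  proof unfold_locales
    fix A B assume [simp]: "A \<in> Obj C" "B \<in> Obj C"
    show "(\<one> (bang A) \<otimes> nab B) ;; m A B =
            (\<Delta> A \<otimes> \<one> (bang B) \<otimes> \<one> (bang B)) ;;
            (\<one> (bang A) \<otimes> \<sigma> (bang A) (bang B) \<otimes> \<one> (bang B)) ;; (m A B \<otimes> m A B) ;; nab (A \<odot> B)"
      using nab_right_m[of A B] by (simp add: mid_def)
    show "(nab A \<otimes> \<one> (bang B)) ;; m A B =
            (\<one> (bang A) \<otimes> \<one> (bang A) \<otimes> \<Delta> B) ;;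
            (\<one> (bang A) \<otimes> \<sigma> (bang A) (bang B) \<otimes> \<one> (bang B)) ;; (m A B \<otimes> m A B) ;; nab (A \<odot> B)"
      using nab_left_m[of A B] by (simp add: mid_def)
  next
    fix A assume [simp]: "A \<in> Obj C"
    show "nab A ;; \<delta> A = (\<delta> A \<otimes> \<delta> A) ;; m (bang A) (bang A) ;; bmap (nab A)"
      using coalg_hom_arr(4)[OF coalg_hom_nab] by (simp add: coalg_tensor_def)
    show "u A ;; \<delta> A = mI ;; bmap (u A)"
      using coalg_hom_arr(4)[OF coalg_hom_u] by simp
  qed (use mon bim nat1 nat2 u_left_m u_right_m in auto)
qed

end

section \<open>From a deriving transformation to a codereliction\<close>

sublocale monoidal_differential_modality \<subseteq> additive_monoidal_modality
  by unfold_locales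

context monoidal_differential_modality
begin

lemmas d_arr [simp] = naturalD(1-3)[OF d_natural]
lemmas d_nat = naturalD(4)[OF d_natural]

lemma d_nat_rev: "f \<in> Arr C \<Longrightarrow> Dom C f = A \<Longrightarrow> d A ;; bmap f = (bmap f \<otimes> f) ;; d (Cod C f)"
  by (simp add: d_nat)

definition \<eta> :: "'o \<Rightarrow> 'm"
  where "\<eta> = (\<lambda>A\<in>Obj C. (u A \<otimes> \<one> A) ;; d A)"

lemma \<eta>_eq: "A \<in> Obj C \<Longrightarrow> \<eta> A = (u A \<otimes> \<one> A) ;; d A"
  by (simp add: \<eta>_def)

lemma \<eta>_arr [simp]:
  "A \<in> Obj C \<Longrightarrow> \<eta> A \<in> Arr C" "A \<in> Obj C \<Longrightarrow> Dom C (\<eta> A) = A" "A \<in> Obj C \<Longrightarrow> Cod C (\<eta> A) = bang A"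
  by (simp_all add: \<eta>_eq)

lemma \<eta>_nat:
  assumes "f \<in> Arr C" "Cod C f = B"
  shows "f ;; \<eta> B = \<eta> (Dom C f) ;; bmap f"
proof -
  have "\<eta> (Dom C f) ;; bmap f = (u (Dom C f) \<otimes> \<one> (Dom C f)) ;; ((bmap f \<otimes> f) ;; d B)"
    using assms by (auto simp: \<eta>_eq d_nat simp del: interchange_whisker)
  also have "\<dots> = (u B \<otimes> f) ;; d B"
    using assms by (auto simp: u_nat)
  also have "\<dots> = (f ;; (u B \<otimes> \<one> B)) ;; d B"
    using assms by (subst scalar_Comp_left) auto
  also have "\<dots> = f ;; \<eta> B"
    using assms by (auto simp: \<eta>_eq)
  finally show ?thesis ..
qed

lemma \<eta>_e [simp]: "A \<in> Obj C \<Longrightarrow> \<eta> A ;; e A = zero A \<I>"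
  by (simp add: \<eta>_eq D1)

lemma \<eta>_\<epsilon> [simp]: "A \<in> Obj C \<Longrightarrow> \<eta> A ;; \<epsilon> A = \<one> A"
  by (simp add: \<eta>_eq D3)

text \<open>
  The arrow \<open>!f \<otimes> g\<close> carries a point of \<open>!A\<close> and a tangent vector; only the point is copied.
\<close>

lemma copy_tangent:
  assumes "f \<in> Arr C" "Dom C f = A" "Cod C f = P" "g \<in> Arr C" "Dom C g = B" "Cod C g = Q"
  shows "(bmap f \<otimes> g) ;; (\<Delta> P \<otimes> \<one> Q) = (\<Delta> A \<otimes> \<one> B) ;; (bmap f \<otimes> (bmap f \<otimes> g))"
  using assms by auto

text \<open>
  \<open>P\<close> plays the role of the biproduct of \<open>A\<close> and \<open>B\<close>, and the left side differentiates at \<open>P\<close> in the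
  direction of \<open>B\<close> and then splits \<open>!P\<close> into its components.  In the Leibniz rule, the summand that
  differentiates the first component contains \<open>i2 ;; p1\<close>, which is zero.  In the other summand the second
  component is differentiated at \<open>i1 ;; p2\<close>, again zero, and differentiation at zero is \<open>\<eta>\<close>.
\<close>

lemma split_along_retracts:
  assumes [simp]: "A \<in> Obj C" "B \<in> Obj C" "P \<in> Obj C"
    and [simp]: "i1 \<in> Arr C" "Dom C i1 = A" "Cod C i1 = P" "i2 \<in> Arr C" "Dom C i2 = B" "Cod C i2 = P"
    and [simp]: "p1 \<in> Arr C" "Dom C p1 = P" "Cod C p1 = A" "p2 \<in> Arr C" "Dom C p2 = P" "Cod C p2 = B"
    and retract: "i1 ;; p1 = \<one> A" "i2 ;; p2 = \<one> B" "i1 ;; p2 = zero A B" "i2 ;; p1 = zero B A"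
  shows "(bmap i1 \<otimes> i2) ;; (d P ;; (\<Delta> P ;; (bmap p1 \<otimes> bmap p2))) = \<one> (bang A) \<otimes> \<eta> B"
proof -
  have 1: "((\<one> (bang P) \<otimes> \<sigma> (bang P) P) ;; (d P \<otimes> \<one> (bang P))) ;; (bmap p1 \<otimes> bmap p2)
      = (\<one> (bang P) \<otimes> \<sigma> (bang P) P) ;; ((bmap p1 \<otimes> (p1 \<otimes> bmap p2)) ;; (d A \<otimes> \<one> (bang B)))"
    by (simp add: d_nat_rev)
  have 2: "(\<one> (bang P) \<otimes> d P) ;; (bmap p1 \<otimes> bmap p2) = (bmap p1 \<otimes> (bmap p2 \<otimes> p2)) ;; (\<one> (bang A) \<otimes> d B)"
    by (simp add: d_nat_rev)
  have bretract: "bmap i1 ;; bmap p1 = \<one> (bang A)" "bmap i1 ;; bmap p2 = e A ;; u B"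
    using retract by (simp_all add: bmap_Comp[symmetric] bmap_zero del: bmap_Comp)
  have 3: "(bmap i1 \<otimes> (bmap i1 \<otimes> i2)) ;; ((\<one> (bang P) \<otimes> \<sigma> (bang P) P) ;; ((bmap p1 \<otimes> (p1 \<otimes> bmap p2)) ;; (d A \<otimes> \<one> (bang B))))
      = zero (bang A \<odot> (bang A \<odot> B)) (bang A \<odot> bang B)"
    by (simp add: Symm_nat whisker[OF Symm_nat] retract bretract del: interchange21)
  have 4: "(bmap i1 \<otimes> (bmap i1 \<otimes> i2)) ;; ((bmap p1 \<otimes> (bmap p2 \<otimes> p2)) ;; (\<one> (bang A) \<otimes> d B))
      = (\<one> (bang A) \<otimes> ((e A ;; u B) \<otimes> \<one> B)) ;; (\<one> (bang A) \<otimes> d B)"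
    by (simp add: retract bretract)
  have 5: "(bmap i1 \<otimes> i2) ;; (\<Delta> P \<otimes> \<one> P) = (\<Delta> A \<otimes> \<one> B) ;; (bmap i1 \<otimes> (bmap i1 \<otimes> i2))"
    by (rule copy_tangent) auto
  have "(bmap i1 \<otimes> i2) ;; (d P ;; (\<Delta> P ;; (bmap p1 \<otimes> bmap p2)))
      = ((bmap i1 \<otimes> i2) ;; (\<Delta> P \<otimes> \<one> P)) ;; ((((\<one> (bang P) \<otimes> \<sigma> (bang P) P) ;; (d P \<otimes> \<one> (bang P))) ;; (bmap p1 \<otimes> bmap p2))
        \<oplus> ((\<one> (bang P) \<otimes> d P) ;; (bmap p1 \<otimes> bmap p2)))"
    by (subst whisker[OF D2]) auto
  also have "\<dots> = (\<Delta> A \<otimes> \<one> B) ;;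
        (((bmap i1 \<otimes> (bmap i1 \<otimes> i2)) ;; ((\<one> (bang P) \<otimes> \<sigma> (bang P) P) ;; ((bmap p1 \<otimes> (p1 \<otimes> bmap p2)) ;; (d A \<otimes> \<one> (bang B)))))
        \<oplus> ((bmap i1 \<otimes> (bmap i1 \<otimes> i2)) ;; ((bmap p1 \<otimes> (bmap p2 \<otimes> p2)) ;; (\<one> (bang A) \<otimes> d B))))"
    unfolding 1 2 5 by (rule Comp_Comp_add) auto
  also have "\<dots> = (\<Delta> A \<otimes> \<one> B) ;; ((\<one> (bang A) \<otimes> ((e A ;; u B) \<otimes> \<one> B)) ;; (\<one> (bang A) \<otimes> d B))"
    unfolding 3 4 by simp
  also have "\<dots> = (\<one> (bang A) \<otimes> (u B \<otimes> \<one> B)) ;; (\<one> (bang A) \<otimes> d B)"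
    by (subst whisker[OF interchange12]) auto
  also have "\<dots> = \<one> (bang A) \<otimes> \<eta> B"
    by (simp add: \<eta>_eq)
  finally show ?thesis .
qed

text \<open>
  The other way of reading a map out of \<open>!P\<close>: since \<open>\<Delta>\<close> is a coalgebra morphism, splitting \<open>!P\<close> and then
  multiplying with \<open>m\<close> is the lift of a plain arrow, to which the chain rule for \<open>d\<close> applies.
\<close>

lemma merge_retracts:
  assumes [simp]: "A \<in> Obj C" "B \<in> Obj C" "P \<in> Obj C"
    and [simp]: "p1 \<in> Arr C" "Dom C p1 = P" "Cod C p1 = A" "p2 \<in> Arr C" "Dom C p2 = P" "Cod C p2 = B"
  shows "\<Delta> P ;; ((bmap p1 \<otimes> bmap p2) ;; m A B) = \<delta> P ;; bmap (\<Delta> P ;; ((\<epsilon> P ;; p1) \<otimes> (\<epsilon> P ;; p2)))"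
proof -
  have "\<delta> P ;; bmap (\<Delta> P ;; ((\<epsilon> P ;; p1) \<otimes> (\<epsilon> P ;; p2)))
      = (\<delta> P ;; bmap (\<Delta> P)) ;; bmap ((\<epsilon> P ;; p1) \<otimes> (\<epsilon> P ;; p2))"
    by simp
  also have "\<dots> = \<Delta> P ;; ((\<delta> P \<otimes> \<delta> P) ;; ((bmap (\<epsilon> P ;; p1) \<otimes> bmap (\<epsilon> P ;; p2)) ;; m A B))"
    by (subst \<delta>_bmap_\<Delta>, simp, subst m_nat) (auto simp del: bmap_Comp)
  also have "\<dots> = \<Delta> P ;; ((bmap p1 \<otimes> bmap p2) ;; m A B)"
    by simp
  finally show ?thesis ..
qed

text \<open>
  With \<open>A\<close> embedded twice into \<open>P\<close>, composing the equation of \<open>split_along_retracts\<close> with \<open>\<nabla>\<close> adds the two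
  projections.  Their sum \<open>q\<close> retracts both injections, so naturality of \<open>d\<close> along \<open>q\<close> leaves \<open>d A\<close>.
\<close>

lemma d_eq_\<eta>_nab:
  assumes [simp]: "A \<in> Obj C"
  shows "(\<one> (bang A) \<otimes> \<eta> A) ;; nab A = d A"
proof -
  let ?P = "bang A \<odot> bang A" and ?i1 = "\<eta> A \<otimes> u A" and ?i2 = "u A \<otimes> \<eta> A"
    and ?p1 = "\<epsilon> A \<otimes> e A" and ?p2 = "e A \<otimes> \<epsilon> A"
  define q where "q = ?p1 \<oplus> ?p2"
  have [simp]: "q \<in> Arr C" "Dom C q = ?P" "Cod C q = A"
    by (simp_all add: q_def)
  have "(\<one> (bang A) \<otimes> \<eta> A) ;; nab A
      = (bmap ?i1 \<otimes> ?i2) ;; (d ?P ;; (\<Delta> ?P ;; ((bmap ?p1 \<otimes> bmap ?p2) ;; nab A)))"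
    by (subst split_along_retracts[of A A ?P ?i1 ?i2 ?p1 ?p2, symmetric]) auto
  also have "\<dots> = (bmap ?i1 \<otimes> ?i2) ;; (d ?P ;; bmap q)"
    unfolding q_def by (subst \<Delta>_bmap_nab) auto
  also have "\<dots> = (bmap (?i1 ;; q) \<otimes> (?i2 ;; q)) ;; d A"
    by (simp add: d_nat_rev)
  also have "\<dots> = d A"
    by (simp add: q_def)
  finally show ?thesis .
qed

text \<open>
  The same arrow is computed twice.  By \<open>split_along_retracts\<close> the left side is \<open>d\<close> at \<open>P\<close> followed by
  \<open>\<Delta> ; (!p1 \<otimes> !p2) ; m\<close>.  By \<open>merge_retracts\<close> that tail is \<open>\<delta> ; !M\<close>, so the chain rule applies: the base
  point becomes \<open>e ; u\<close>, because along \<open>i1\<close> the second component of \<open>M\<close> vanishes, and the tangent part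
  is computed with \<open>split_along_retracts\<close> again.
\<close>

lemma \<eta>_right_m:
  assumes [simp]: "A \<in> Obj C" "B \<in> Obj C"
  shows "(\<one> (bang A) \<otimes> \<eta> B) ;; m A B = (\<epsilon> A \<otimes> \<one> B) ;; \<eta> (A \<odot> B)"
proof -
  let ?P = "bang A \<odot> bang B" and ?i1 = "\<eta> A \<otimes> u B" and ?i2 = "u A \<otimes> \<eta> B"
    and ?p1 = "\<epsilon> A \<otimes> e B" and ?p2 = "e A \<otimes> \<epsilon> B"
  define M where "M = \<Delta> ?P ;; ((\<epsilon> ?P ;; ?p1) \<otimes> (\<epsilon> ?P ;; ?p2))"
  have [simp]: "M \<in> Arr C" "Dom C M = bang ?P" "Cod C M = A \<odot> B"
    by (simp_all add: M_def)
  note split = split_along_retracts[of A B ?P ?i1 ?i2 ?p1 ?p2]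
  have \<delta>M: "\<delta> ?P ;; bmap M = \<Delta> ?P ;; ((bmap ?p1 \<otimes> bmap ?p2) ;; m A B)"
    unfolding M_def by (rule merge_retracts[symmetric]) auto
  have 1: "bmap ?i1 ;; (\<delta> ?P ;; bmap M) = e A ;; u (A \<odot> B)"
  proof -
    have "bmap ?i1 ;; bmap ?p1 = \<one> (bang A)" "bmap ?i1 ;; bmap ?p2 = e A ;; u B"
      by (simp_all add: bmap_Comp[symmetric] bmap_zero del: bmap_Comp)
    then have "bmap ?i1 ;; (\<delta> ?P ;; bmap M) = (\<one> (bang A) \<otimes> u B) ;; m A B"
      unfolding \<delta>M by simp
    then show ?thesis by (simp add: u_right_m)
  qed
  have 2: "(bmap ?i1 \<otimes> ?i2) ;; (d ?P ;; M) = \<epsilon> A \<otimes> \<one> B"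
  proof -
    have "(bmap ?i1 \<otimes> ?i2) ;; (d ?P ;; M)
        = ((bmap ?i1 \<otimes> ?i2) ;; (d ?P ;; (\<Delta> ?P ;; (bmap ?p1 \<otimes> bmap ?p2)))) ;; (\<epsilon> A \<otimes> \<epsilon> B)"
      by (simp add: M_def)
    also have "\<dots> = \<epsilon> A \<otimes> \<one> B"
      by (subst split) auto
    finally show ?thesis .
  qed
  have "(\<one> (bang A) \<otimes> \<eta> B) ;; m A B
      = (bmap ?i1 \<otimes> ?i2) ;; (d ?P ;; (\<Delta> ?P ;; ((bmap ?p1 \<otimes> bmap ?p2) ;; m A B)))"
    by (subst split[symmetric]) auto
  also have "\<dots> = (bmap ?i1 \<otimes> ?i2) ;; (d ?P ;; (\<delta> ?P ;; bmap M))"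
    by (simp add: \<delta>M)
  also have "\<dots> = (\<Delta> A \<otimes> \<one> B) ;; (((bmap ?i1 ;; (\<delta> ?P ;; bmap M)) \<otimes> ((bmap ?i1 \<otimes> ?i2) ;; (d ?P ;; M))) ;; d (A \<odot> B))"
  proof -
    have "(bmap ?i1 \<otimes> ?i2) ;; (d ?P ;; (\<delta> ?P ;; bmap M))
        = ((bmap ?i1 \<otimes> ?i2) ;; (\<Delta> ?P \<otimes> \<one> ?P)) ;; (((\<delta> ?P ;; bmap M) \<otimes> (d ?P ;; M)) ;; d (A \<odot> B))"
      by (subst whisker[OF D4]) (auto simp: d_nat_rev)
    also have "(bmap ?i1 \<otimes> ?i2) ;; (\<Delta> ?P \<otimes> \<one> ?P) = (\<Delta> A \<otimes> \<one> B) ;; (bmap ?i1 \<otimes> (bmap ?i1 \<otimes> ?i2))"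
      by (rule copy_tangent) auto
    also have "((\<Delta> A \<otimes> \<one> B) ;; (bmap ?i1 \<otimes> (bmap ?i1 \<otimes> ?i2))) ;; (((\<delta> ?P ;; bmap M) \<otimes> (d ?P ;; M)) ;; d (A \<odot> B))
        = (\<Delta> A \<otimes> \<one> B) ;; ((bmap ?i1 \<otimes> (bmap ?i1 \<otimes> ?i2)) ;; (((\<delta> ?P ;; bmap M) \<otimes> (d ?P ;; M)) ;; d (A \<odot> B)))"
      by (rule Comp_assoc_right) auto
    also have "(bmap ?i1 \<otimes> (bmap ?i1 \<otimes> ?i2)) ;; (((\<delta> ?P ;; bmap M) \<otimes> (d ?P ;; M)) ;; d (A \<odot> B))
        = ((bmap ?i1 ;; (\<delta> ?P ;; bmap M)) \<otimes> ((bmap ?i1 \<otimes> ?i2) ;; (d ?P ;; M))) ;; d (A \<odot> B)"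
      by (rule interchange_whisker) auto
    finally show ?thesis .
  qed
  also have "\<dots> = (u (A \<odot> B) \<otimes> (\<epsilon> A \<otimes> \<one> B)) ;; d (A \<odot> B)"
    unfolding 1 2 by simp
  also have "\<dots> = ((\<epsilon> A \<otimes> \<one> B) ;; (u (A \<odot> B) \<otimes> \<one> (A \<odot> B))) ;; d (A \<odot> B)"
    by (subst scalar_Comp_left) auto
  also have "\<dots> = (\<epsilon> A \<otimes> \<one> B) ;; \<eta> (A \<odot> B)"
    by (simp add: \<eta>_eq)
  finally show ?thesis .
qed

text \<open>
  The mirror image of \<open>\<eta>_right_m\<close> under the symmetry, because \<open>m\<close> is symmetric.
\<close>

lemma \<eta>_left_m:
  assumes [simp]: "A \<in> Obj C" "B \<in> Obj C"
  shows "(\<eta> A \<otimes> \<one> (bang B)) ;; m A B = (\<one> A \<otimes> \<epsilon> B) ;; \<eta> (A \<odot> B)"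
proof -
  have "(\<eta> A \<otimes> \<one> (bang B)) ;; m A B = (\<eta> A \<otimes> \<one> (bang B)) ;; (m A B ;; (bmap (\<sigma> A B) ;; bmap (\<sigma> B A)))"
    by (simp add: bmap_Comp[symmetric] Symm_Symm del: bmap_Comp)
  also have "\<dots> = ((\<eta> A \<otimes> \<one> (bang B)) ;; \<sigma> (bang A) (bang B)) ;; (m B A ;; bmap (\<sigma> B A))"
    by (simp add: whisker[OF m_symmetric])
  also have "\<dots> = \<sigma> A (bang B) ;; (((\<one> (bang B) \<otimes> \<eta> A) ;; m B A) ;; bmap (\<sigma> B A))"
    by (simp add: Symm_nat)
  also have "\<dots> = \<sigma> A (bang B) ;; ((\<epsilon> B \<otimes> \<one> A) ;; (\<sigma> B A ;; \<eta> (A \<odot> B)))"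
    by (simp add: \<eta>_right_m \<eta>_nat[of "\<sigma> B A"])
  also have "\<dots> = (\<sigma> A (bang B) ;; \<sigma> (bang B) A) ;; ((\<one> A \<otimes> \<epsilon> B) ;; \<eta> (A \<odot> B))"
    by (simp add: whisker[OF Symm_nat])
  also have "\<dots> = (\<one> A \<otimes> \<epsilon> B) ;; \<eta> (A \<odot> B)"
    by (simp add: Symm_Symm)
  finally show ?thesis .
qed

lemma codereliction: "codereliction C bang bmap \<delta> \<epsilon> \<Delta> e m mI nab u \<eta>"
proof -
  interpret monoidal_bialgebra_modality C bang bmap \<delta> \<epsilon> \<Delta> e m mI nab u
    by (rule monoidal_bialgebra_modality)
  have nat: "natural (\<lambda>A. A) (\<lambda>f. f) bang bmap \<eta>"
    unfolding natural_def by (auto simp: Hom_iff \<eta>_nat PiE_iff) (simp add: \<eta>_def)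
  have chain: "\<eta> A ;; \<delta> A = (u A \<otimes> \<eta> A) ;; (\<delta> A \<otimes> \<eta> (bang A)) ;; nab (bang A)" if [simp]: "A \<in> Obj C" for A
  proof -
    have "\<eta> A ;; \<delta> A = (u A \<otimes> \<one> A) ;; ((\<Delta> A \<otimes> \<one> A) ;; ((\<delta> A \<otimes> d A) ;; d (bang A)))"
      by (simp add: \<eta>_eq D4)
    also have "\<dots> = ((u A ;; \<delta> A) \<otimes> \<eta> A) ;; d (bang A)"
      by (simp add: u_\<Delta> \<eta>_eq)
    also have "\<dots> = ((u A ;; \<delta> A) \<otimes> \<eta> A) ;; ((\<one> (bang (bang A)) \<otimes> \<eta> (bang A)) ;; nab (bang A))"
      by (simp add: d_eq_\<eta>_nab)
    finally show ?thesis by simp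
  qed
  show ?thesis
    by unfold_locales (use nat chain \<eta>_left_m \<eta>_right_m in auto)
qed

lemma differential_of_codereliction_of:
  "differential_of C bang bmap \<epsilon> \<Delta> e (nab, u, \<eta>) = (add, zero, d)"
proof -
  have "(\<lambda>f\<in>Arr C. \<lambda>g\<in>Hom (Dom C f) (Cod C f).
        \<eta> (Dom C f) ;; \<Delta> (Dom C f) ;; (bmap f \<otimes> bmap g) ;; nab (Cod C f) ;; \<epsilon> (Cod C f)) = add"
    (is "?add = _")
  proof (rule PiE_ext[OF _ add_Hom])
    show "?add \<in> (\<Pi>\<^sub>E f\<in>Arr C. Hom (Dom C f) (Cod C f) \<rightarrow>\<^sub>E Hom (Dom C f) (Cod C f))"
      by (auto simp: PiE_iff Hom_iff)
    fix f assume f: "f \<in> Arr C"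
    show "?add f = add f"
    proof (rule PiE_ext[OF _ PiE_mem[OF add_Hom f]])
      show "?add f \<in> Hom (Dom C f) (Cod C f) \<rightarrow>\<^sub>E Hom (Dom C f) (Cod C f)"
        using f by (auto simp: PiE_iff Hom_iff)
    qed (use f in \<open>simp add: Hom_iff whisker[OF \<eta>_\<epsilon>]\<close>)
  qed
  moreover have "(\<lambda>A\<in>Obj C. \<lambda>B\<in>Obj C. \<eta> A ;; e A ;; u B ;; \<epsilon> B) = zero" (is "?zero = _")
  proof (rule PiE_ext[OF _ zero_Hom])
    show "?zero \<in> (\<Pi>\<^sub>E A\<in>Obj C. \<Pi>\<^sub>E B\<in>Obj C. Hom A B)"
      by (auto simp: PiE_iff Hom_iff)
    fix A assume A: "A \<in> Obj C"
    show "?zero A = zero A"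
    proof (rule PiE_ext[OF _ PiE_mem[OF zero_Hom A]])
      show "?zero A \<in> (\<Pi>\<^sub>E B\<in>Obj C. Hom A B)"
        using A by (auto simp: PiE_iff Hom_iff)
    qed (use A in simp)
  qed
  moreover have "(\<lambda>A\<in>Obj C. (\<one> (bang A) \<otimes> \<eta> A) ;; nab A) = d"
    using d_natural by (intro extensionalityI[of _ "Obj C"]) (auto simp: natural_def PiE_iff d_eq_\<eta>_nab)
  ultimately show ?thesis
    by (simp add: differential_of_def)
qed

end

section \<open>Monoidal bialgebra modalities and pre-coderelictions\<close>

context bialgebra_modality
begin

lemmas nab_arr [simp] = naturalD(1-3)[OF nab_natural]
lemmas u_arr [simp] = naturalD(1-3)[OF u_natural]
lemmas nab_nat = naturalD(4)[OF nab_natural]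

lemma nab_nat_rev:
  "f \<in> Arr C \<Longrightarrow> Dom C f = A \<Longrightarrow> nab A ;; bmap f = (bmap f \<otimes> bmap f) ;; nab (Cod C f)"
  by (simp add: nab_nat)

lemma u_nat [simp]: "f \<in> Arr C \<Longrightarrow> Dom C f = A \<Longrightarrow> u A ;; bmap f = u (Cod C f)"
  using naturalD(4)[OF u_natural, of f] by auto

lemmas u_nat_whisker [simp] = whisker[OF u_nat]

lemma nab_assoc: "A \<in> Obj C \<Longrightarrow> (nab A \<otimes> \<one> (bang A)) ;; nab A = (\<one> (bang A) \<otimes> nab A) ;; nab A"
  and nab_unit_left: "A \<in> Obj C \<Longrightarrow> (u A \<otimes> \<one> (bang A)) ;; nab A = \<one> (bang A)"
  and nab_unit_right: "A \<in> Obj C \<Longrightarrow> (\<one> (bang A) \<otimes> u A) ;; nab A = \<one> (bang A)"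
  and nab_commute: "A \<in> Obj C \<Longrightarrow> \<sigma> (bang A) (bang A) ;; nab A = nab A"
  using bang_monoid by (auto simp: commutative_monoid_def)

lemma nab_\<Delta>: "A \<in> Obj C \<Longrightarrow>
    nab A ;; \<Delta> A = (\<Delta> A \<otimes> \<Delta> A) ;; (mid (bang A) (bang A) (bang A) (bang A) ;; (nab A \<otimes> nab A))"
  and nab_e [simp]: "A \<in> Obj C \<Longrightarrow> nab A ;; e A = e A \<otimes> e A"
  and u_\<Delta>: "A \<in> Obj C \<Longrightarrow> u A ;; \<Delta> A = u A \<otimes> u A"
  and u_e [simp]: "A \<in> Obj C \<Longrightarrow> u A ;; e A = \<one> \<I>"
  using bang_bimonoid by (auto simp: bimonoid_def mid_def)

lemma nab_unit_right' [simp]: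
  assumes "A \<in> Obj C" "f \<in> Arr C" "Cod C f = bang A"
  shows "(f \<otimes> u A) ;; nab A = f"
proof -
  have "(f \<otimes> u A) ;; nab A = (f ;; (\<one> (bang A) \<otimes> u A)) ;; nab A"
    using assms by (subst scalar_Comp_right) auto
  also have "\<dots> = f" using assms by (simp add: nab_unit_right)
  finally show ?thesis .
qed

lemma nab_unit_left' [simp]:
  assumes "A \<in> Obj C" "f \<in> Arr C" "Cod C f = bang A"
  shows "(u A \<otimes> f) ;; nab A = f"
proof -
  have "(u A \<otimes> f) ;; nab A = (f ;; (u A \<otimes> \<one> (bang A))) ;; nab A"
    using assms by (subst scalar_Comp_left) auto
  also have "\<dots> = f" using assms by (simp add: nab_unit_left)
  finally show ?thesis .
qed

lemmas nab_unit_whisker [simp] = whisker[OF nab_unit_right'] whisker[OF nab_unit_left']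

end

context monoidal_bialgebra_modality
begin

lemma coalg_hom_nab: "A \<in> Obj C \<Longrightarrow> coalg_hom (coalg_tensor (\<delta> A) (\<delta> A)) (\<delta> A) (nab A)"
  using nab_\<delta>[of A] by (simp add: coalg_hom_def coalg_tensor_def)

lemma coalg_hom_u: "A \<in> Obj C \<Longrightarrow> coalg_hom mI (\<delta> A) (u A)"
  by (simp add: coalg_hom_def u_\<delta>)

lemma coalg_hom_\<Delta>_nab:
  assumes "f \<in> Arr C" "g \<in> Arr C" "Dom C f = A" "Dom C g = A" "Cod C f = B" "Cod C g = B"
  shows "coalg_hom (\<delta> A) (\<delta> B) (\<Delta> A ;; ((bmap f \<otimes> bmap g) ;; nab B))"
proof -
  have [simp]: "A \<in> Obj C" "B \<in> Obj C" using assms by auto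
  have "coalg_hom (coalg_tensor (\<delta> A) (\<delta> A)) (coalg_tensor (\<delta> B) (\<delta> B)) (bmap f \<otimes> bmap g)"
    using assms by (intro coalg_hom_TenA coalg_hom_bmap) auto
  then show ?thesis
    by (intro coalg_hom_Comp[OF _ _ _ coalg_hom_\<Delta>] coalg_hom_Comp[OF _ _ _ _ coalg_hom_nab]) auto
qed

lemma nab_left_m_mid:
  "A \<in> Obj C \<Longrightarrow> B \<in> Obj C \<Longrightarrow> (nab A \<otimes> \<one> (bang B)) ;; m A B =
    (\<one> (bang A) \<otimes> (\<one> (bang A) \<otimes> \<Delta> B)) ;; (mid (bang A) (bang A) (bang B) (bang B) ;;
      ((m A B \<otimes> m A B) ;; nab (A \<odot> B)))"
  using nab_left_m[of A B] by (simp add: mid_def)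

lemma nab_right_m_mid:
  "A \<in> Obj C \<Longrightarrow> B \<in> Obj C \<Longrightarrow> (\<one> (bang A) \<otimes> nab B) ;; m A B =
    (\<Delta> A \<otimes> (\<one> (bang B) \<otimes> \<one> (bang B))) ;; (mid (bang A) (bang A) (bang B) (bang B) ;;
      ((m A B \<otimes> m A B) ;; nab (A \<odot> B)))"
  using nab_right_m[of A B] by (simp add: mid_def)

text \<open>
  The arrow \<open>\<Delta> ; (!f \<otimes> !g) ; \<nabla>\<close> is the convolution of \<open>!f\<close> and \<open>!g\<close>.  This moves \<open>m\<close> past a convolution
  of tensor products; the two corollaries then use the compatibility of \<open>\<nabla>\<close> with \<open>m\<close>, and say that \<open>m\<close>
  is linear for convolution in either argument.
\<close>

lemma m_\<Delta>_nab:
  assumes [simp]: "f \<in> Arr C" "g \<in> Arr C" "h \<in> Arr C" "k \<in> Arr C"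
    "Dom C f = A" "Dom C g = A" "Dom C h = B" "Dom C k = B"
    "Cod C f = A'" "Cod C g = A'" "Cod C h = B'" "Cod C k = B'"
    and [simp]: "A \<in> Obj C" "A' \<in> Obj C" "B \<in> Obj C" "B' \<in> Obj C"
  shows "m A B ;; (\<Delta> (A \<odot> B) ;; ((bmap (f \<otimes> h) \<otimes> bmap (g \<otimes> k)) ;; nab (A' \<odot> B')))
    = ((\<Delta> A ;; (bmap f \<otimes> bmap g)) \<otimes> (\<Delta> B ;; (bmap h \<otimes> bmap k))) ;;
      (mid (bang A') (bang A') (bang B') (bang B') ;; ((m A' B' \<otimes> m A' B') ;; nab (A' \<odot> B')))"
proof -
  have "m A B ;; (\<Delta> (A \<odot> B) ;; ((bmap (f \<otimes> h) \<otimes> bmap (g \<otimes> k)) ;; nab (A' \<odot> B')))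
    = (\<Delta> A \<otimes> \<Delta> B) ;; (mid (bang A) (bang A) (bang B) (bang B) ;;
       (((m A B ;; bmap (f \<otimes> h)) \<otimes> (m A B ;; bmap (g \<otimes> k))) ;; nab (A' \<odot> B')))"
    by (subst whisker[OF m_\<Delta>_mid]) auto
  also have "\<dots> = (\<Delta> A \<otimes> \<Delta> B) ;; (mid (bang A) (bang A) (bang B) (bang B) ;;
       ((((bmap f \<otimes> bmap h) ;; m A' B') \<otimes> ((bmap g \<otimes> bmap k) ;; m A' B')) ;; nab (A' \<odot> B')))"
    by (simp add: m_nat)
  also have "\<dots> = (\<Delta> A \<otimes> \<Delta> B) ;; ((mid (bang A) (bang A) (bang B) (bang B) ;;
       (bmap f \<otimes> (bmap h \<otimes> (bmap g \<otimes> bmap k)))) ;; ((m A' B' \<otimes> m A' B') ;; nab (A' \<odot> B')))"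
    by simp
  also have "\<dots> = (\<Delta> A \<otimes> \<Delta> B) ;; (((bmap f \<otimes> (bmap g \<otimes> (bmap h \<otimes> bmap k))) ;;
        mid (bang A') (bang A') (bang B') (bang B')) ;; ((m A' B' \<otimes> m A' B') ;; nab (A' \<odot> B')))"
    by (subst mid_nat_rev) auto
  also have "\<dots> = ((\<Delta> A ;; (bmap f \<otimes> bmap g)) \<otimes> (\<Delta> B ;; (bmap h \<otimes> bmap k))) ;;
      (mid (bang A') (bang A') (bang B') (bang B') ;; ((m A' B' \<otimes> m A' B') ;; nab (A' \<odot> B')))"
    by simp
  finally show ?thesis .
qed

lemma m_\<Delta>_nab_left:
  assumes [simp]: "f \<in> Arr C" "g \<in> Arr C" "h \<in> Arr C"
    "Dom C f = A" "Dom C g = A" "Dom C h = B" "Cod C f = A'" "Cod C g = A'" "Cod C h = B'"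
  shows "m A B ;; (\<Delta> (A \<odot> B) ;; ((bmap (f \<otimes> h) \<otimes> bmap (g \<otimes> h)) ;; nab (A' \<odot> B')))
    = ((\<Delta> A ;; ((bmap f \<otimes> bmap g) ;; nab A')) \<otimes> bmap h) ;; m A' B'"
proof -
  have [simp]: "A \<in> Obj C" "A' \<in> Obj C" "B \<in> Obj C" "B' \<in> Obj C"
    using Dom_Obj[of f] Cod_Obj[of f] Dom_Obj[of h] Cod_Obj[of h] by simp_all
  have "m A B ;; (\<Delta> (A \<odot> B) ;; ((bmap (f \<otimes> h) \<otimes> bmap (g \<otimes> h)) ;; nab (A' \<odot> B')))
      = ((\<Delta> A ;; (bmap f \<otimes> bmap g)) \<otimes> (bmap h ;; \<Delta> B')) ;;
      (mid (bang A') (bang A') (bang B') (bang B') ;; ((m A' B' \<otimes> m A' B') ;; nab (A' \<odot> B')))"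
    by (subst m_\<Delta>_nab) auto
  also have "\<dots> = ((\<Delta> A ;; (bmap f \<otimes> bmap g)) \<otimes> bmap h) ;; ((nab A' \<otimes> \<one> (bang B')) ;; m A' B')"
    by (subst nab_left_m_mid) auto
  also have "\<dots> = ((\<Delta> A ;; ((bmap f \<otimes> bmap g) ;; nab A')) \<otimes> bmap h) ;; m A' B'"
    by simp
  finally show ?thesis .
qed

lemma m_\<Delta>_nab_right:
  assumes [simp]: "f \<in> Arr C" "g \<in> Arr C" "h \<in> Arr C"
    "Dom C f = A" "Dom C g = B" "Dom C h = B" "Cod C f = A'" "Cod C g = B'" "Cod C h = B'"
  shows "m A B ;; (\<Delta> (A \<odot> B) ;; ((bmap (f \<otimes> g) \<otimes> bmap (f \<otimes> h)) ;; nab (A' \<odot> B')))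
    = (bmap f \<otimes> (\<Delta> B ;; ((bmap g \<otimes> bmap h) ;; nab B'))) ;; m A' B'"
proof -
  have [simp]: "A \<in> Obj C" "A' \<in> Obj C" "B \<in> Obj C" "B' \<in> Obj C"
    using Dom_Obj[of f] Cod_Obj[of f] Dom_Obj[of h] Cod_Obj[of h] by simp_all
  have "m A B ;; (\<Delta> (A \<odot> B) ;; ((bmap (f \<otimes> g) \<otimes> bmap (f \<otimes> h)) ;; nab (A' \<odot> B')))
      = ((bmap f ;; \<Delta> A') \<otimes> (\<Delta> B ;; (bmap g \<otimes> bmap h))) ;;
      (mid (bang A') (bang A') (bang B') (bang B') ;; ((m A' B' \<otimes> m A' B') ;; nab (A' \<odot> B')))"
    by (subst m_\<Delta>_nab) auto
  also have "\<dots> = (bmap f \<otimes> (\<Delta> B ;; (bmap g \<otimes> bmap h))) ;; ((\<one> (bang A') \<otimes> nab B') ;; m A' B')"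
    by (subst nab_right_m_mid) auto
  also have "\<dots> = (bmap f \<otimes> (\<Delta> B ;; ((bmap g \<otimes> bmap h) ;; nab B'))) ;; m A' B'"
    by simp
  finally show ?thesis .
qed

end

context pre_codereliction
begin

lemmas \<eta>_arr [simp] = naturalD(1-3)[OF \<eta>_natural]
lemmas \<eta>_nat = naturalD(4)[OF \<eta>_natural]

lemma \<eta>_nat_rev: "f \<in> Arr C \<Longrightarrow> Dom C f = A \<Longrightarrow> \<eta> A ;; bmap f = f ;; \<eta> (Cod C f)"
  by (simp add: \<eta>_nat)

lemma \<eta>_\<epsilon>_whisker [simp]: "A \<in> Obj C \<Longrightarrow> x \<in> Arr C \<Longrightarrow> Dom C x = A \<Longrightarrow> \<eta> A ;; (\<epsilon> A ;; x) = x"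
  using whisker[OF \<eta>_\<epsilon>[of A], of x] by simp

declare \<eta>_\<epsilon> [simp]

lemma \<eta>_m: "A \<in> Obj C \<Longrightarrow> B \<in> Obj C \<Longrightarrow> (\<eta> A \<otimes> \<eta> B) ;; m A B = \<eta> (A \<odot> B)"
proof -
  assume [simp]: "A \<in> Obj C" "B \<in> Obj C"
  have "(\<eta> A \<otimes> \<eta> B) ;; m A B = (\<eta> A \<otimes> \<one> B) ;; ((\<one> (bang A) \<otimes> \<eta> B) ;; m A B)"
    by simp
  also have "\<dots> = \<eta> (A \<odot> B)"
    by (subst \<eta>_right_m) auto
  finally show ?thesis .
qed

text \<open>
  Because \<open>\<epsilon> A ;; \<eta> A = (\<one> (bang A) \<otimes> \<eta> \<I>) ;; m A \<I>\<close>, an arrow that can be moved past \<open>m A \<I>\<close> also absorbs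
  \<open>\<epsilon> A ;; \<eta> A\<close> in front, up to a final \<open>\<epsilon>\<close>.
\<close>

lemma linear_factor:
  assumes [simp]: "A \<in> Obj C" "B \<in> Obj C" "F \<in> Arr C" "Dom C F = bang A" "Cod C F = bang B"
    and lin: "m A \<I> ;; F = (F \<otimes> \<one> (bang \<I>)) ;; m B \<I>"
  shows "\<epsilon> A ;; (\<eta> A ;; (F ;; \<epsilon> B)) = F ;; \<epsilon> B"
proof -
  have "\<epsilon> A ;; (\<eta> A ;; (F ;; \<epsilon> B)) = ((\<one> (bang A) \<otimes> \<eta> \<I>) ;; m A \<I>) ;; (F ;; \<epsilon> B)"
    by (subst \<eta>_right_m) auto
  also have "\<dots> = (\<one> (bang A) \<otimes> \<eta> \<I>) ;; ((F \<otimes> \<one> (bang \<I>)) ;; (m B \<I> ;; \<epsilon> B))"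
    using whisker[OF lin, of "\<epsilon> B"] by simp
  also have "\<dots> = F ;; \<epsilon> B"
    using m_\<epsilon>[of B \<I>] by simp
  finally show ?thesis .
qed

lemma linear_eq_bmap:
  assumes [simp]: "A \<in> Obj C" "B \<in> Obj C" and F: "coalg_hom (\<delta> A) (\<delta> B) F"
    and lin: "m A \<I> ;; F = (F \<otimes> \<one> (bang \<I>)) ;; m B \<I>"
  shows "bmap (\<eta> A ;; (F ;; \<epsilon> B)) = F"
proof (rule coalg_hom_eqI[of "\<delta> A" B])
  have [simp]: "F \<in> Arr C" "Dom C F = bang A" "Cod C F = bang B"
    using coalg_hom_arr[OF F] by auto
  show "coalg_hom (\<delta> A) (\<delta> B) (bmap (\<eta> A ;; (F ;; \<epsilon> B)))"
    by (intro coalg_hom_bmap) auto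
  have "bmap (\<eta> A ;; (F ;; \<epsilon> B)) ;; \<epsilon> B = \<epsilon> A ;; (\<eta> A ;; (F ;; \<epsilon> B))"
    by (simp del: bmap_Comp)
  then show "bmap (\<eta> A ;; (F ;; \<epsilon> B)) ;; \<epsilon> B = F ;; \<epsilon> B"
    using linear_factor[OF _ _ _ _ _ lin] by simp
qed (use F in auto)

end

section \<open>The sum defined by a codereliction\<close>

context codereliction
begin

definition add :: "'m \<Rightarrow> 'm \<Rightarrow> 'm"  (infixl "\<oplus>" 55)
  where "add = (\<lambda>f\<in>Arr C. \<lambda>g\<in>Hom (Dom C f) (Cod C f).
        \<eta> (Dom C f) ;; \<Delta> (Dom C f) ;; (bmap f \<otimes> bmap g) ;; nab (Cod C f) ;; \<epsilon> (Cod C f))"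

definition zero :: "'o \<Rightarrow> 'o \<Rightarrow> 'm"
  where "zero = (\<lambda>A\<in>Obj C. \<lambda>B\<in>Obj C. \<eta> A ;; e A ;; u B ;; \<epsilon> B)"

definition d :: "'o \<Rightarrow> 'm"
  where "d = (\<lambda>A\<in>Obj C. (\<one> (bang A) \<otimes> \<eta> A) ;; nab A)"

lemma add_eq:
  assumes "f \<in> Arr C" "g \<in> Arr C" "Dom C f = A" "Dom C g = A" "Cod C f = B" "Cod C g = B"
  shows "f \<oplus> g = \<eta> A ;; (\<Delta> A ;; ((bmap f \<otimes> bmap g) ;; (nab B ;; \<epsilon> B)))"
  using assms by (auto simp: add_def Hom_iff)

lemma zero_eq: "A \<in> Obj C \<Longrightarrow> B \<in> Obj C \<Longrightarrow> zero A B = \<eta> A ;; (e A ;; (u B ;; \<epsilon> B))"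
  by (simp add: zero_def)

text \<open>
  Convolution of \<open>!f\<close> and \<open>!g\<close> is a coalgebra morphism, and it can be moved past \<open>m\<close> by linearity of \<open>m\<close>,
  so \<open>linear_eq_bmap\<close> applies.  Associativity and units of the sum are thereby inherited from \<open>\<nabla>\<close>.
\<close>

lemma bmap_add:
  assumes [simp]: "f \<in> Arr C" "g \<in> Arr C" "Dom C f = A" "Dom C g = A" "Cod C f = B" "Cod C g = B"
  shows "bmap (f \<oplus> g) = \<Delta> A ;; ((bmap f \<otimes> bmap g) ;; nab B)"
proof -
  have [simp]: "A \<in> Obj C" "B \<in> Obj C" using Dom_Obj[of f] Cod_Obj[of f] by simp_all
  have "bmap (\<eta> A ;; ((\<Delta> A ;; ((bmap f \<otimes> bmap g) ;; nab B)) ;; \<epsilon> B)) = \<Delta> A ;; ((bmap f \<otimes> bmap g) ;; nab B)"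
  proof (rule linear_eq_bmap)
    show "coalg_hom (\<delta> A) (\<delta> B) (\<Delta> A ;; ((bmap f \<otimes> bmap g) ;; nab B))"
      by (rule coalg_hom_\<Delta>_nab) auto
    show "m A \<I> ;; (\<Delta> A ;; ((bmap f \<otimes> bmap g) ;; nab B)) =
        ((\<Delta> A ;; ((bmap f \<otimes> bmap g) ;; nab B)) \<otimes> \<one> (bang \<I>)) ;; m B \<I>"
      using m_\<Delta>_nab_left[of f g "\<one> \<I>" A \<I> B \<I>] by simp
  qed auto
  then show ?thesis by (simp add: add_eq[of f g A B] del: bmap_Comp)
qed

lemma bmap_zero:
  assumes [simp]: "A \<in> Obj C" "B \<in> Obj C"
  shows "bmap (zero A B) = e A ;; u B"
proof -
  have "bmap (\<eta> A ;; ((e A ;; u B) ;; \<epsilon> B)) = e A ;; u B"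
  proof (rule linear_eq_bmap)
    show "coalg_hom (\<delta> A) (\<delta> B) (e A ;; u B)"
      by (intro coalg_hom_Comp[OF _ _ _ coalg_hom_e coalg_hom_u]) auto
    have "((e A ;; u B) \<otimes> \<one> (bang \<I>)) ;; m B \<I> = (e A \<otimes> \<one> (bang \<I>)) ;; ((u B \<otimes> \<one> (bang \<I>)) ;; m B \<I>)"
      by simp
    also have "\<dots> = (e A \<otimes> e \<I>) ;; u B"
      by (simp add: u_left_m Comp_scalar_left del: interchange_whisker) 
    also have "\<dots> = m A \<I> ;; (e A ;; u B)"
      using whisker[OF m_e[of A \<I>], of "u B"] by simp
    finally show "m A \<I> ;; (e A ;; u B) = ((e A ;; u B) \<otimes> \<one> (bang \<I>)) ;; m B \<I>" ..
  qed auto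
  then show ?thesis by (simp add: zero_eq del: bmap_Comp)
qed

lemma add_typing:
  assumes "f \<in> Arr C" "g \<in> Arr C" "Dom C f = Dom C g" "Cod C f = Cod C g"
  shows "f \<oplus> g \<in> Arr C" "Dom C (f \<oplus> g) = Dom C g" "Cod C (f \<oplus> g) = Cod C g"
  using assms by (simp_all add: add_eq[of f g "Dom C g" "Cod C g"])

lemma \<Delta>_nab_assoc:
  assumes [simp]: "f \<in> Arr C" "g \<in> Arr C" "h \<in> Arr C" "A \<in> Obj C" "B \<in> Obj C"
    "Dom C f = bang A" "Dom C g = bang A" "Dom C h = bang A" "Cod C f = bang B" "Cod C g = bang B" "Cod C h = bang B"
  shows "\<Delta> A ;; (((\<Delta> A ;; ((f \<otimes> g) ;; nab B)) \<otimes> h) ;; nab B)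
       = \<Delta> A ;; ((f \<otimes> (\<Delta> A ;; ((g \<otimes> h) ;; nab B))) ;; nab B)"
proof -
  have "\<Delta> A ;; (((\<Delta> A ;; ((f \<otimes> g) ;; nab B)) \<otimes> h) ;; nab B)
      = (\<Delta> A ;; (\<Delta> A \<otimes> \<one> (bang A))) ;; ((f \<otimes> (g \<otimes> h)) ;; ((nab B \<otimes> \<one> (bang B)) ;; nab B))"
    by simp
  also have "\<dots> = (\<Delta> A ;; (\<one> (bang A) \<otimes> \<Delta> A)) ;; ((f \<otimes> (g \<otimes> h)) ;; ((\<one> (bang B) \<otimes> nab B) ;; nab B))"
    by (simp only: \<Delta>_coassoc nab_assoc assms)
  also have "\<dots> = \<Delta> A ;; ((f \<otimes> (\<Delta> A ;; ((g \<otimes> h) ;; nab B))) ;; nab B)"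
    by simp
  finally show ?thesis .
qed

lemma \<Delta>_nab_commute:
  assumes [simp]: "f \<in> Arr C" "g \<in> Arr C" "A \<in> Obj C" "B \<in> Obj C"
    "Dom C f = bang A" "Dom C g = bang A" "Cod C f = bang B" "Cod C g = bang B"
  shows "\<Delta> A ;; ((f \<otimes> g) ;; nab B) = \<Delta> A ;; ((g \<otimes> f) ;; nab B)"
proof -
  have "\<Delta> A ;; ((f \<otimes> g) ;; nab B) = \<Delta> A ;; ((f \<otimes> g) ;; (\<sigma> (bang B) (bang B) ;; nab B))"
    by (simp add: nab_commute)
  also have "\<dots> = (\<Delta> A ;; \<sigma> (bang A) (bang A)) ;; ((g \<otimes> f) ;; nab B)"
    by (simp add: whisker[OF Symm_nat])
  also have "\<dots> = \<Delta> A ;; ((g \<otimes> f) ;; nab B)"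
    by (simp only: \<Delta>_cocommute assms)
  finally show ?thesis .
qed

sublocale additive_symmetric_monoidal_category C add zero
proof unfold_locales
  show "add \<in> (\<Pi>\<^sub>E f\<in>Arr C. Hom (Dom C f) (Cod C f) \<rightarrow>\<^sub>E Hom (Dom C f) (Cod C f))"
    unfolding add_def by (auto simp: PiE_iff Hom_iff)
  show "zero \<in> (\<Pi>\<^sub>E A\<in>Obj C. \<Pi>\<^sub>E B\<in>Obj C. Hom A B)"
    unfolding zero_def by (auto simp: PiE_iff Hom_iff)
next
  fix f g h A B assume "f \<in> Hom A B" "g \<in> Hom A B" "h \<in> Hom A B"
  then have [simp]: "f \<in> Arr C" "Dom C f = A" "Cod C f = B" "g \<in> Arr C" "Dom C g = A" "Cod C g = B"
    "h \<in> Arr C" "Dom C h = A" "Cod C h = B"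
    by (auto simp: Hom_iff)
  have [simp]: "A \<in> Obj C" "B \<in> Obj C" using Dom_Obj[of f] Cod_Obj[of f] by simp_all
  have [simp]: "f \<oplus> g \<in> Arr C" "Dom C (f \<oplus> g) = A" "Cod C (f \<oplus> g) = B"
    "g \<oplus> h \<in> Arr C" "Dom C (g \<oplus> h) = A" "Cod C (g \<oplus> h) = B"
    by (simp_all add: add_typing)
  have "f \<oplus> g \<oplus> h = \<eta> A ;; ((\<Delta> A ;; ((bmap (f \<oplus> g) \<otimes> bmap h) ;; nab B)) ;; \<epsilon> B)"
    by (subst add_eq[of "f \<oplus> g" h A B]) auto
  also have "\<Delta> A ;; ((bmap (f \<oplus> g) \<otimes> bmap h) ;; nab B) = \<Delta> A ;; ((bmap f \<otimes> bmap (g \<oplus> h)) ;; nab B)"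
    by (simp only: bmap_add[of f g A B] bmap_add[of g h A B] \<open>f \<in> Arr C\<close> \<open>g \<in> Arr C\<close> \<open>h \<in> Arr C\<close>
        \<open>Dom C f = A\<close> \<open>Dom C g = A\<close> \<open>Dom C h = A\<close> \<open>Cod C f = B\<close> \<open>Cod C g = B\<close> \<open>Cod C h = B\<close>)
      (rule \<Delta>_nab_assoc, auto)
  also have "\<eta> A ;; ((\<Delta> A ;; ((bmap f \<otimes> bmap (g \<oplus> h)) ;; nab B)) ;; \<epsilon> B) = f \<oplus> (g \<oplus> h)"
    by (subst add_eq[of f "g \<oplus> h" A B]) auto
  finally show "f \<oplus> g \<oplus> h = f \<oplus> (g \<oplus> h)" .
next
  fix f g A B assume "f \<in> Hom A B" "g \<in> Hom A B"
  then have [simp]: "f \<in> Arr C" "Dom C f = A" "Cod C f = B" "g \<in> Arr C" "Dom C g = A" "Cod C g = B"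
    by (auto simp: Hom_iff)
  have [simp]: "A \<in> Obj C" "B \<in> Obj C" using Dom_Obj[of f] Cod_Obj[of f] by simp_all
  show "f \<oplus> g = g \<oplus> f"
    using whisker[OF \<Delta>_nab_commute[of "bmap f" "bmap g" A B], of "\<epsilon> B"]
    by (simp add: add_eq[of f g A B] add_eq[of g f A B])
next
  fix f A B assume "f \<in> Hom A B"
  then have [simp]: "f \<in> Arr C" "Dom C f = A" "Cod C f = B"
    by (auto simp: Hom_iff)
  have [simp]: "A \<in> Obj C" "B \<in> Obj C" using Dom_Obj[of f] Cod_Obj[of f] by simp_all
  have "zero A B \<in> Arr C" "Dom C (zero A B) = A" "Cod C (zero A B) = B"
    by (simp_all add: zero_eq)
  then show "f \<oplus> zero A B = f"
    by (simp add: add_eq[of f "zero A B" A B] bmap_zero)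
next
  fix f g h A B D assume "f \<in> Hom A B" "g \<in> Hom B D" "h \<in> Hom B D"
  then have [simp]: "f \<in> Arr C" "Dom C f = A" "Cod C f = B" "g \<in> Arr C" "Dom C g = B" "Cod C g = D"
    "h \<in> Arr C" "Dom C h = B" "Cod C h = D"
    by (auto simp: Hom_iff)
  have [simp]: "A \<in> Obj C" "B \<in> Obj C" "D \<in> Obj C" using Dom_Obj[of f] Cod_Obj[of f] Cod_Obj[of g] by simp_all
  show "f ;; (g \<oplus> h) = (f ;; g) \<oplus> (f ;; h)"
    by (simp add: add_eq[of g h B D] add_eq[of "f ;; g" "f ;; h" A D] whisker[OF \<eta>_nat])
next
  fix f A B D assume "f \<in> Hom A B" "D \<in> Obj C"
  then have [simp]: "f \<in> Arr C" "Dom C f = A" "Cod C f = B" "D \<in> Obj C"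
    by (auto simp: Hom_iff)
  have [simp]: "A \<in> Obj C" "B \<in> Obj C" using Dom_Obj[of f] Cod_Obj[of f] by simp_all
  show "f ;; zero B D = zero A D"
    by (simp add: zero_eq whisker[OF \<eta>_nat])
next
  fix g h k A B D assume "g \<in> Hom A B" "h \<in> Hom A B" "k \<in> Hom B D"
  then have [simp]: "g \<in> Arr C" "Dom C g = A" "Cod C g = B" "h \<in> Arr C" "Dom C h = A" "Cod C h = B"
    "k \<in> Arr C" "Dom C k = B" "Cod C k = D"
    by (auto simp: Hom_iff)
  have [simp]: "A \<in> Obj C" "B \<in> Obj C" "D \<in> Obj C" using Dom_Obj[of g] Cod_Obj[of g] Cod_Obj[of k] by simp_all
  have "(g \<oplus> h) ;; k = \<eta> A ;; (\<Delta> A ;; ((bmap g \<otimes> bmap h) ;; ((nab B ;; bmap k) ;; \<epsilon> D)))"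
    by (simp add: add_eq[of g h A B])
  also have "\<dots> = (g ;; k) \<oplus> (h ;; k)"
    by (subst nab_nat_rev) (auto simp: add_eq[of "g ;; k" "h ;; k" A D])
  finally show "(g \<oplus> h) ;; k = (g ;; k) \<oplus> (h ;; k)" .
next
  fix k A B D assume "A \<in> Obj C" "k \<in> Hom B D"
  then have [simp]: "A \<in> Obj C" "k \<in> Arr C" "Dom C k = B" "Cod C k = D"
    by (auto simp: Hom_iff)
  have [simp]: "D \<in> Obj C" "B \<in> Obj C" using Dom_Obj[of k] Cod_Obj[of k] by simp_all
  have "zero A B ;; k = \<eta> A ;; (e A ;; (u B ;; (bmap k ;; \<epsilon> D)))"
    by (simp add: zero_eq del: u_nat_whisker)
  then show "zero A B ;; k = zero A D"
    by (simp add: zero_eq del: \<epsilon>_nat)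
next
  fix f g h A B A' B' assume "f \<in> Hom A B" "g \<in> Hom A' B'" "h \<in> Hom A' B'"
  then have [simp]: "f \<in> Arr C" "Dom C f = A" "Cod C f = B" "g \<in> Arr C" "Dom C g = A'" "Cod C g = B'"
    "h \<in> Arr C" "Dom C h = A'" "Cod C h = B'"
    by (auto simp: Hom_iff)
  have [simp]: "A \<in> Obj C" "B \<in> Obj C" "A' \<in> Obj C" "B' \<in> Obj C"
    using Dom_Obj[of f] Cod_Obj[of f] Dom_Obj[of g] Cod_Obj[of g] by simp_all
  have "(f \<otimes> g) \<oplus> (f \<otimes> h) = (\<eta> A \<otimes> \<eta> A') ;; ((m A A' ;; (\<Delta> (A \<odot> A') ;;
          ((bmap (f \<otimes> g) \<otimes> bmap (f \<otimes> h)) ;; nab (B \<odot> B')))) ;; \<epsilon> (B \<odot> B'))"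
    by (simp add: add_eq[of "f \<otimes> g" "f \<otimes> h" "A \<odot> A'" "B \<odot> B'"] \<eta>_m[symmetric])
  also have "\<dots> = f \<otimes> (g \<oplus> h)"
    by (subst m_\<Delta>_nab_right) (auto simp: m_\<epsilon> add_eq[of g h A' B'])
  finally show "f \<otimes> (g \<oplus> h) = (f \<otimes> g) \<oplus> (f \<otimes> h)" ..
next
  fix f g h A B A' B' assume "g \<in> Hom A B" "h \<in> Hom A B" "f \<in> Hom A' B'"
  then have [simp]: "f \<in> Arr C" "Dom C f = A'" "Cod C f = B'" "g \<in> Arr C" "Dom C g = A" "Cod C g = B"
    "h \<in> Arr C" "Dom C h = A" "Cod C h = B"
    by (auto simp: Hom_iff)
  have [simp]: "A \<in> Obj C" "B \<in> Obj C" "A' \<in> Obj C" "B' \<in> Obj C"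
    using Dom_Obj[of f] Cod_Obj[of f] Dom_Obj[of g] Cod_Obj[of g] by simp_all
  have "(g \<otimes> f) \<oplus> (h \<otimes> f) = (\<eta> A \<otimes> \<eta> A') ;; ((m A A' ;; (\<Delta> (A \<odot> A') ;;
          ((bmap (g \<otimes> f) \<otimes> bmap (h \<otimes> f)) ;; nab (B \<odot> B')))) ;; \<epsilon> (B \<odot> B'))"
    by (simp add: add_eq[of "g \<otimes> f" "h \<otimes> f" "A \<odot> A'" "B \<odot> B'"] \<eta>_m[symmetric])
  also have "\<dots> = (g \<oplus> h) \<otimes> f"
    by (subst m_\<Delta>_nab_left) (auto simp: m_\<epsilon> add_eq[of g h A B])
  finally show "(g \<oplus> h) \<otimes> f = (g \<otimes> f) \<oplus> (h \<otimes> f)" ..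
next
  fix f A B A' B' assume "f \<in> Hom A B" "A' \<in> Obj C" "B' \<in> Obj C"
  then have [simp]: "f \<in> Arr C" "Dom C f = A" "Cod C f = B" "A' \<in> Obj C" "B' \<in> Obj C"
    by (auto simp: Hom_iff)
  have [simp]: "A \<in> Obj C" "B \<in> Obj C"
    using Dom_Obj[of f] Cod_Obj[of f] by simp_all
  have "f \<otimes> zero A' B' = ((\<eta> A ;; bmap f) \<otimes> (\<eta> A' ;; e A')) ;; (((\<one> (bang B) \<otimes> u B') ;; m B B') ;; \<epsilon> (B \<odot> B'))"
    by (simp add: zero_eq m_\<epsilon>)
  also have "\<dots> = (((\<eta> A ;; bmap f) \<otimes> (\<eta> A' ;; e A')) ;; e B) ;; (u (B \<odot> B') ;; \<epsilon> (B \<odot> B'))"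
    by (simp add: u_right_m)
  also have "((\<eta> A ;; bmap f) \<otimes> (\<eta> A' ;; e A')) ;; e B = ((\<eta> A \<otimes> \<eta> A') ;; m A A') ;; e (A \<odot> A')"
    by (subst Comp_scalar_right) (auto simp: m_e)
  also have "(((\<eta> A \<otimes> \<eta> A') ;; m A A') ;; e (A \<odot> A')) ;; (u (B \<odot> B') ;; \<epsilon> (B \<odot> B')) = zero (A \<odot> A') (B \<odot> B')"
    by (simp add: zero_eq \<eta>_m del: Comp_assoc_right) simp
  finally show "f \<otimes> zero A' B' = zero (A \<odot> A') (B \<odot> B')" .
next
  fix f A B A' B' assume "A \<in> Obj C" "B \<in> Obj C" "f \<in> Hom A' B'"
  then have [simp]: "f \<in> Arr C" "Dom C f = A'" "Cod C f = B'" "A \<in> Obj C" "B \<in> Obj C"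
    by (auto simp: Hom_iff)
  have [simp]: "A' \<in> Obj C" "B' \<in> Obj C"
    using Dom_Obj[of f] Cod_Obj[of f] by simp_all
  have "zero A B \<otimes> f = ((\<eta> A ;; e A) \<otimes> (\<eta> A' ;; bmap f)) ;; (((u B \<otimes> \<one> (bang B')) ;; m B B') ;; \<epsilon> (B \<odot> B'))"
    by (simp add: zero_eq m_\<epsilon>)
  also have "\<dots> = (((\<eta> A ;; e A) \<otimes> (\<eta> A' ;; bmap f)) ;; e B') ;; (u (B \<odot> B') ;; \<epsilon> (B \<odot> B'))"
    by (simp add: u_left_m)
  also have "((\<eta> A ;; e A) \<otimes> (\<eta> A' ;; bmap f)) ;; e B' = ((\<eta> A \<otimes> \<eta> A') ;; m A A') ;; e (A \<odot> A')"
    by (subst Comp_scalar_left) (auto simp: m_e)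
  also have "(((\<eta> A \<otimes> \<eta> A') ;; m A A') ;; e (A \<odot> A')) ;; (u (B \<odot> B') ;; \<epsilon> (B \<odot> B')) = zero (A \<odot> A') (B \<odot> B')"
    by (simp add: zero_eq \<eta>_m del: Comp_assoc_right) simp
  finally show "zero A B \<otimes> f = zero (A \<odot> A') (B \<odot> B')" .
qed

end

section \<open>From a codereliction to a deriving transformation\<close>

context codereliction
begin

lemma d_eq: "A \<in> Obj C \<Longrightarrow> d A = (\<one> (bang A) \<otimes> \<eta> A) ;; nab A"
  by (simp add: d_def)

lemma d_arr [simp]:
  "A \<in> Obj C \<Longrightarrow> d A \<in> Arr C" "A \<in> Obj C \<Longrightarrow> Dom C (d A) = bang A \<odot> A" "A \<in> Obj C \<Longrightarrow> Cod C (d A) = bang A"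
  by (simp_all add: d_eq)

lemma u_eq: "A \<in> Obj C \<Longrightarrow> mI ;; bmap (zero \<I> A) = u A"
  using whisker[OF mI_e, of "u A"] by (simp add: bmap_zero)

lemma u_\<epsilon> [simp]: "A \<in> Obj C \<Longrightarrow> u A ;; \<epsilon> A = zero \<I> A"
  using lift_\<epsilon>[of mI "zero \<I> A" A] by (simp add: u_eq[symmetric])

text \<open>
  The lift of \<open>\<epsilon> \<otimes> e + e \<otimes> \<epsilon>\<close> is, by \<open>bmap_add\<close>, the convolution of the lifts of \<open>\<epsilon> \<otimes> e\<close> and \<open>e \<otimes> \<epsilon>\<close>.  These
  are the two projections \<open>\<one> \<otimes> e\<close> and \<open>e \<otimes> \<one>\<close>, which select one copy from each of the two duplicated
  arguments.
\<close>

lemma nab_eq: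
  assumes [simp]: "A \<in> Obj C"
  shows "coalg_tensor (\<delta> A) (\<delta> A) ;; bmap ((\<epsilon> A \<otimes> e A) \<oplus> (e A \<otimes> \<epsilon> A)) = nab A"
proof -
  let ?p1 = "\<epsilon> A \<otimes> e A" and ?p2 = "e A \<otimes> \<epsilon> A" and ?B = "bang A"
  have 1: "(\<delta> A \<otimes> \<delta> A) ;; (m ?B ?B ;; bmap ?p1) = \<one> ?B \<otimes> e A"
  proof -
    have "(\<delta> A \<otimes> \<delta> A) ;; (m ?B ?B ;; bmap ?p1) = (\<delta> A \<otimes> \<delta> A) ;; ((bmap (\<epsilon> A) \<otimes> bmap (e A)) ;; m A \<I>)"
      by (simp add: m_nat)
    also have "\<dots> = (\<one> ?B \<otimes> e A) ;; ((\<one> ?B \<otimes> mI) ;; m A \<I>)"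
      by (simp add: \<delta>_bmap_e)
    also have "\<dots> = \<one> ?B \<otimes> e A"
      by (simp only: m_unit_right assms) simp
    finally show ?thesis .
  qed
  have 2: "(\<delta> A \<otimes> \<delta> A) ;; (m ?B ?B ;; bmap ?p2) = e A \<otimes> \<one> ?B"
  proof -
    have "(\<delta> A \<otimes> \<delta> A) ;; (m ?B ?B ;; bmap ?p2) = (\<delta> A \<otimes> \<delta> A) ;; ((bmap (e A) \<otimes> bmap (\<epsilon> A)) ;; m \<I> A)"
      by (simp add: m_nat)
    also have "\<dots> = (e A \<otimes> \<one> ?B) ;; ((mI \<otimes> \<one> ?B) ;; m \<I> A)"
      by (simp add: \<delta>_bmap_e)
    also have "\<dots> = e A \<otimes> \<one> ?B"
      by (simp only: m_unit_left assms) simp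
    finally show ?thesis .
  qed
  have "coalg_tensor (\<delta> A) (\<delta> A) ;; bmap (?p1 \<oplus> ?p2)
      = (\<delta> A \<otimes> \<delta> A) ;; (m ?B ?B ;; (\<Delta> (?B \<odot> ?B) ;; ((bmap ?p1 \<otimes> bmap ?p2) ;; nab A)))"
    by (subst bmap_add) (auto simp: coalg_tensor_def)
  also have "\<dots> = ((\<delta> A ;; \<Delta> ?B) \<otimes> (\<delta> A ;; \<Delta> ?B)) ;; (mid (bang ?B) (bang ?B) (bang ?B) (bang ?B) ;;
      (((m ?B ?B ;; bmap ?p1) \<otimes> (m ?B ?B ;; bmap ?p2)) ;; nab A))"
    by (subst whisker[OF m_\<Delta>_mid]) auto
  also have "\<dots> = (\<Delta> A \<otimes> \<Delta> A) ;; (((\<delta> A \<otimes> (\<delta> A \<otimes> (\<delta> A \<otimes> \<delta> A))) ;; mid (bang ?B) (bang ?B) (bang ?B) (bang ?B)) ;;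
      (((m ?B ?B ;; bmap ?p1) \<otimes> (m ?B ?B ;; bmap ?p2)) ;; nab A))"
    by (simp add: \<delta>_\<Delta>)
  also have "\<dots> = (\<Delta> A \<otimes> \<Delta> A) ;; (mid ?B ?B ?B ?B ;; ((((\<delta> A \<otimes> \<delta> A) ;; (m ?B ?B ;; bmap ?p1)) \<otimes> ((\<delta> A \<otimes> \<delta> A) ;; (m ?B ?B ;; bmap ?p2))) ;; nab A))"
    by (subst mid_nat) auto
  also have "\<dots> = (\<Delta> A \<otimes> \<Delta> A) ;; ((mid ?B ?B ?B ?B ;; (\<one> ?B \<otimes> (e A \<otimes> (e A \<otimes> \<one> ?B)))) ;; nab A)"
    unfolding 1 2 by simp
  also have "\<dots> = nab A"
    by (subst mid_nat_rev) auto
  finally show ?thesis .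
qed

lemma nab_\<epsilon> [simp]: "A \<in> Obj C \<Longrightarrow> nab A ;; \<epsilon> A = (\<epsilon> A \<otimes> e A) \<oplus> (e A \<otimes> \<epsilon> A)"
  using lift_\<epsilon>[of "coalg_tensor (\<delta> A) (\<delta> A)" "(\<epsilon> A \<otimes> e A) \<oplus> (e A \<otimes> \<epsilon> A)" A] by (simp add: nab_eq)

text \<open>
  Insert the point \<open>u\<close> of \<open>! \<I>\<close> next to \<open>A\<close>.  Discarding it is harmless, but pulling \<open>\<eta>\<close> through \<open>m\<close>
  evaluates \<open>u\<close> by \<open>\<epsilon>\<close>, which is zero.
\<close>

lemma \<eta>_e [simp]:
  assumes [simp]: "A \<in> Obj C"
  shows "\<eta> A ;; e A = zero A \<I>"
proof -
  have "\<eta> A ;; e A = (\<one> A \<otimes> u \<I>) ;; (((\<eta> A \<otimes> \<one> (bang \<I>)) ;; m A \<I>) ;; e A)"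
    using m_e[of A \<I>] by simp
  also have "\<dots> = zero A \<I>"
    using \<eta>_left_m[of A \<I>] by simp
  finally show ?thesis .
qed

text \<open>
  \<open>\<eta>\<close> is natural and composition is bilinear, hence \<open>\<eta>\<close> behaves additively in the injection \<open>i\<close>: the
  diagonal injection of \<open>A\<close> into \<open>! A \<otimes> ! A\<close> is a sum, while \<open>\<Delta>\<close> is recovered from it by projecting to both
  components.  Each of the two summands has a vanishing component.
\<close>

lemma \<eta>_\<Delta>:
  assumes [simp]: "A \<in> Obj C"
  shows "\<eta> A ;; \<Delta> A = (\<eta> A \<otimes> u A) \<oplus> (u A \<otimes> \<eta> A)"
proof -
  let ?P = "bang A \<odot> bang A" and ?i1 = "\<eta> A \<otimes> u A" and ?i2 = "u A \<otimes> \<eta> A"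
    and ?p1 = "\<epsilon> A \<otimes> e A" and ?p2 = "e A \<otimes> \<epsilon> A"
  have \<eta>i: "i ;; (\<eta> ?P ;; (\<Delta> ?P ;; (bmap ?p1 \<otimes> bmap ?p2)))
      = \<eta> A ;; (\<Delta> A ;; (bmap (i ;; ?p1) \<otimes> bmap (i ;; ?p2)))"
    if "i \<in> Arr C" "Dom C i = A" "Cod C i = ?P" for i
    using that by (simp add: whisker[OF \<eta>_nat])
  define i where "i = ?i1 \<oplus> ?i2"
  have [simp]: "i \<in> Arr C" "Dom C i = A" "Cod C i = ?P" by (simp_all add: i_def)
  have "\<eta> A ;; \<Delta> A = \<eta> A ;; (\<Delta> A ;; (bmap (i ;; ?p1) \<otimes> bmap (i ;; ?p2)))"
    by (simp add: i_def)
  also have "\<dots> = i ;; (\<eta> ?P ;; (\<Delta> ?P ;; (bmap ?p1 \<otimes> bmap ?p2)))"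
    by (rule \<eta>i[symmetric]) auto
  also have "\<dots> = (?i1 ;; (\<eta> ?P ;; (\<Delta> ?P ;; (bmap ?p1 \<otimes> bmap ?p2)))) \<oplus> (?i2 ;; (\<eta> ?P ;; (\<Delta> ?P ;; (bmap ?p1 \<otimes> bmap ?p2))))"
    unfolding i_def by (rule add_Comp') auto
  also have "\<dots> = (\<eta> A ;; (\<Delta> A ;; (bmap (?i1 ;; ?p1) \<otimes> bmap (?i1 ;; ?p2)))) \<oplus> (\<eta> A ;; (\<Delta> A ;; (bmap (?i2 ;; ?p1) \<otimes> bmap (?i2 ;; ?p2))))"
    by (simp only: \<eta>i TenA_arr \<eta>_arr u_arr assms TenO_Unit_left TenO_Unit_right)
  also have "\<dots> = (\<eta> A ;; (\<one> (bang A) \<otimes> u A)) \<oplus> (\<eta> A ;; (u A \<otimes> \<one> (bang A)))"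
    by (simp add: bmap_zero)
  also have "\<dots> = ?i1 \<oplus> ?i2"
    by (simp add: scalar_Comp_right scalar_Comp_left)
  finally show ?thesis .
qed

lemma d_nat:
  assumes "f \<in> Arr C" "Cod C f = B"
  shows "(bmap f \<otimes> f) ;; d B = d (Dom C f) ;; bmap f"
  using assms by (auto simp: d_eq \<eta>_nat nab_nat_rev)

lemma d_e: "A \<in> Obj C \<Longrightarrow> d A ;; e A = zero (bang A \<odot> A) \<I>"
  by (simp add: d_eq)

lemma d_\<epsilon>: "A \<in> Obj C \<Longrightarrow> d A ;; \<epsilon> A = e A \<otimes> \<one> A"
  by (simp add: d_eq)

lemma d_\<Delta>:
  assumes [simp]: "A \<in> Obj C"
  shows "d A ;; \<Delta> A = (\<Delta> A \<otimes> \<one> A) ;;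
            (((\<one> (bang A) \<otimes> \<sigma> (bang A) A) ;; (d A \<otimes> \<one> (bang A))) \<oplus> (\<one> (bang A) \<otimes> d A))"
proof -
  let ?B = "bang A"
  have 1: "(\<one> ?B \<otimes> (\<one> ?B \<otimes> (\<eta> A \<otimes> u A))) ;; (mid ?B ?B ?B ?B ;; (nab A \<otimes> nab A))
      = (\<one> ?B \<otimes> \<sigma> ?B A) ;; (d A \<otimes> \<one> ?B)"
  proof -
    have "(\<one> ?B \<otimes> (\<one> ?B \<otimes> (\<eta> A \<otimes> u A))) ;; (mid ?B ?B ?B ?B ;; (nab A \<otimes> nab A))
      = (mid ?B ?B A \<I> ;; (\<one> ?B \<otimes> (\<eta> A \<otimes> (\<one> ?B \<otimes> u A)))) ;; (nab A \<otimes> nab A)"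
      by (subst whisker[OF mid_nat]) auto
    also have "\<dots> = mid ?B ?B A \<I> ;; ((\<one> ?B \<otimes> (\<eta> A \<otimes> (\<one> ?B \<otimes> u A))) ;; (nab A \<otimes> nab A))"
      by (rule Comp_assoc_right) auto
    also have "(\<one> ?B \<otimes> (\<eta> A \<otimes> (\<one> ?B \<otimes> u A))) ;; (nab A \<otimes> nab A) = d A \<otimes> \<one> ?B"
      by (simp add: d_eq)
    also have "mid ?B ?B A \<I> ;; (d A \<otimes> \<one> ?B) = (\<one> ?B \<otimes> \<sigma> ?B A) ;; (d A \<otimes> \<one> ?B)"
      by (simp add: mid_def)
    finally show ?thesis .
  qed
  have 2: "(\<one> ?B \<otimes> (\<one> ?B \<otimes> (u A \<otimes> \<eta> A))) ;; (mid ?B ?B ?B ?B ;; (nab A \<otimes> nab A)) = \<one> ?B \<otimes> d A"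
  proof -
    have "(\<one> ?B \<otimes> (\<one> ?B \<otimes> (u A \<otimes> \<eta> A))) ;; (mid ?B ?B ?B ?B ;; (nab A \<otimes> nab A))
      = (mid ?B ?B \<I> A ;; (\<one> ?B \<otimes> (u A \<otimes> (\<one> ?B \<otimes> \<eta> A)))) ;; (nab A \<otimes> nab A)"
      by (subst whisker[OF mid_nat]) auto
    also have "\<dots> = \<one> ?B \<otimes> d A"
      by (simp add: d_eq)
    finally show ?thesis .
  qed
  have "d A ;; \<Delta> A = (\<Delta> A \<otimes> (\<eta> A ;; \<Delta> A)) ;; (mid ?B ?B ?B ?B ;; (nab A \<otimes> nab A))"
    by (simp add: d_eq nab_\<Delta>)
  also have "\<dots> = (\<Delta> A \<otimes> \<one> A) ;; (((\<one> ?B \<otimes> (\<one> ?B \<otimes> (\<eta> A \<otimes> u A))) \<oplus> (\<one> ?B \<otimes> (\<one> ?B \<otimes> (u A \<otimes> \<eta> A)))) ;; (mid ?B ?B ?B ?B ;; (nab A \<otimes> nab A)))"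
    by (simp add: \<eta>_\<Delta>)
  also have "((\<one> ?B \<otimes> (\<one> ?B \<otimes> (\<eta> A \<otimes> u A))) \<oplus> (\<one> ?B \<otimes> (\<one> ?B \<otimes> (u A \<otimes> \<eta> A)))) ;; (mid ?B ?B ?B ?B ;; (nab A \<otimes> nab A))
      = ((\<one> ?B \<otimes> \<sigma> ?B A) ;; (d A \<otimes> \<one> ?B)) \<oplus> (\<one> ?B \<otimes> d A)"
    by (subst add_Comp') (auto simp: 1 2)
  finally show ?thesis .
qed

text \<open>
  Expanding \<open>\<nabla> ; \<delta>\<close> and the chain rule for \<open>\<eta>\<close> produces a product \<open>\<nabla>\<close> inside one argument of \<open>m\<close>.  The
  compatibility of \<open>\<nabla>\<close> with \<open>m\<close> duplicates the other argument, and the two resulting factors are, by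
  \<open>\<nabla> ; \<delta>\<close> read backwards and by the law for \<open>\<eta>\<close> and \<open>m\<close>, \<open>\<delta>\<close> and \<open>d ; \<eta>\<close>.
\<close>

lemma d_\<delta>:
  assumes [simp]: "A \<in> Obj C"
  shows "d A ;; \<delta> A = (\<Delta> A \<otimes> \<one> A) ;; (\<delta> A \<otimes> d A) ;; d (bang A)"
proof -
  let ?B = "bang A"
  have 1: "(\<delta> A \<otimes> (u A ;; \<delta> A)) ;; (m ?B ?B ;; bmap (nab A)) = \<delta> A"
  proof -
    have "(\<delta> A \<otimes> (u A ;; \<delta> A)) ;; (m ?B ?B ;; bmap (nab A)) = (\<one> ?B \<otimes> u A) ;; (nab A ;; \<delta> A)"
      by (simp add: nab_\<delta>)
    also have "\<dots> = \<delta> A" by simp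
    finally show ?thesis .
  qed
  have 2: "(\<delta> A \<otimes> (\<eta> A ;; \<eta> ?B)) ;; (m ?B ?B ;; bmap (nab A)) = d A ;; \<eta> ?B"
  proof -
    have "(\<delta> A \<otimes> (\<eta> A ;; \<eta> ?B)) ;; (m ?B ?B ;; bmap (nab A))
        = (\<delta> A \<otimes> \<eta> A) ;; (((\<one> (bang ?B) \<otimes> \<eta> ?B) ;; m ?B ?B) ;; bmap (nab A))"
      by simp
    also have "\<dots> = (\<delta> A \<otimes> \<eta> A) ;; ((\<epsilon> ?B \<otimes> \<one> ?B) ;; (\<eta> (?B \<odot> ?B) ;; bmap (nab A)))"
      by (simp add: \<eta>_right_m)
    also have "\<dots> = d A ;; \<eta> ?B"
      by (simp add: \<eta>_nat_rev d_eq)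
    finally show ?thesis .
  qed
  have "d A ;; \<delta> A = (\<delta> A \<otimes> (\<eta> A ;; \<delta> A)) ;; (m ?B ?B ;; bmap (nab A))"
    by (simp add: d_eq nab_\<delta>)
  also have "\<dots> = (\<delta> A \<otimes> ((u A ;; \<delta> A) \<otimes> (\<eta> A ;; \<eta> ?B))) ;; (((\<one> (bang ?B) \<otimes> nab ?B) ;; m ?B ?B) ;; bmap (nab A))"
    by (simp add: chain_rule)
  also have "\<dots> = ((\<delta> A ;; \<Delta> ?B) \<otimes> ((u A ;; \<delta> A) \<otimes> (\<eta> A ;; \<eta> ?B))) ;;
      (mid (bang ?B) (bang ?B) (bang ?B) (bang ?B) ;; ((m ?B ?B \<otimes> m ?B ?B) ;; (nab (?B \<odot> ?B) ;; bmap (nab A))))"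
    by (subst nab_right_m_mid) auto
  also have "\<dots> = (\<Delta> A \<otimes> \<one> A) ;; (((\<delta> A \<otimes> (\<delta> A \<otimes> ((u A ;; \<delta> A) \<otimes> (\<eta> A ;; \<eta> ?B)))) ;; mid (bang ?B) (bang ?B) (bang ?B) (bang ?B)) ;;
      (((m ?B ?B ;; bmap (nab A)) \<otimes> (m ?B ?B ;; bmap (nab A))) ;; nab ?B))"
    by (simp add: \<delta>_\<Delta> nab_nat_rev)
  also have "\<dots> = (\<Delta> A \<otimes> \<one> A) ;; ((((\<delta> A \<otimes> (u A ;; \<delta> A)) ;; (m ?B ?B ;; bmap (nab A))) \<otimes> ((\<delta> A \<otimes> (\<eta> A ;; \<eta> ?B)) ;; (m ?B ?B ;; bmap (nab A)))) ;; nab ?B)"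
    by (subst mid_nat) auto
  also have "\<dots> = (\<Delta> A \<otimes> \<one> A) ;; ((\<delta> A \<otimes> (d A ;; \<eta> ?B)) ;; nab ?B)"
    unfolding 1 2 ..
  also have "\<dots> = (\<Delta> A \<otimes> \<one> A) ;; ((\<delta> A \<otimes> d A) ;; d ?B)"
    by (simp add: d_eq[of ?B])
  also have "\<dots> = (\<Delta> A \<otimes> \<one> A) ;; (\<delta> A \<otimes> d A) ;; d (bang A)"
    by (rule Comp_assoc_right[symmetric]) auto
  finally show ?thesis .
qed

lemma d_d:
  assumes [simp]: "A \<in> Obj C"
  shows "(d A \<otimes> \<one> A) ;; d A = (\<one> (bang A) \<otimes> (\<eta> A \<otimes> \<eta> A)) ;; ((\<one> (bang A) \<otimes> nab A) ;; nab A)"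
proof -
  have "(d A \<otimes> \<one> A) ;; d A = (\<one> (bang A) \<otimes> (\<eta> A \<otimes> \<eta> A)) ;; ((nab A \<otimes> \<one> (bang A)) ;; nab A)"
    by (simp add: d_eq)
  then show ?thesis by (simp only: nab_assoc assms)
qed

lemma d_commute:
  assumes [simp]: "A \<in> Obj C"
  shows "(d A \<otimes> \<one> A) ;; d A = (\<one> (bang A) \<otimes> \<sigma> A A) ;; (d A \<otimes> \<one> A) ;; d A"
proof -
  have "(\<one> (bang A) \<otimes> \<sigma> A A) ;; (d A \<otimes> \<one> A) ;; d A = (\<one> (bang A) \<otimes> \<sigma> A A) ;; ((d A \<otimes> \<one> A) ;; d A)"
    by (rule Comp_assoc_right) auto
  also have "\<dots> = (\<one> (bang A) \<otimes> (\<sigma> A A ;; (\<eta> A \<otimes> \<eta> A))) ;; ((\<one> (bang A) \<otimes> nab A) ;; nab A)"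
    unfolding d_d[OF assms] by simp
  also have "\<dots> = (\<one> (bang A) \<otimes> (\<eta> A \<otimes> \<eta> A)) ;; ((\<one> (bang A) \<otimes> (\<sigma> (bang A) (bang A) ;; nab A)) ;; nab A)"
    by (simp add: Symm_nat_rev)
  also have "\<dots> = (d A \<otimes> \<one> A) ;; d A"
    unfolding d_d[OF assms] by (simp only: nab_commute assms)
  finally show ?thesis ..
qed

lemma differential_linear_category: "differential_linear_category C add zero bang bmap \<delta> \<epsilon> \<Delta> e m mI d"
proof -
  have "natural (\<lambda>A. bang A \<odot> A) (\<lambda>f. bmap f \<otimes> f) bang bmap d"
    unfolding natural_def by (auto simp: Hom_iff d_nat PiE_iff) (simp add: d_def)
  then show ?thesis
    by unfold_locales (use d_e d_\<Delta> d_\<epsilon> d_\<delta> d_commute in auto)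
qed

lemma codereliction_of_differential_of:
  "codereliction_of C bang bmap \<delta> \<epsilon> e m mI (add, zero, d) = (nab, u, \<eta>)"
proof -
  have "(\<lambda>A\<in>Obj C. (\<delta> A \<otimes> \<delta> A) ;; m (bang A) (bang A) ;; bmap ((\<epsilon> A \<otimes> e A) \<oplus> (e A \<otimes> \<epsilon> A))) = nab"
    using nab_natural nab_eq by (intro extensionalityI[of _ "Obj C"]) (auto simp: natural_def PiE_iff coalg_tensor_def)
  moreover have "(\<lambda>A\<in>Obj C. mI ;; bmap (zero \<I> A)) = u"
    using u_natural u_eq by (intro extensionalityI[of _ "Obj C"]) (auto simp: natural_def PiE_iff)
  moreover have "(\<lambda>A\<in>Obj C. ((mI ;; bmap (zero \<I> A)) \<otimes> \<one> A) ;; d A) = \<eta>"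
    using \<eta>_natural by (intro extensionalityI[of _ "Obj C"]) (auto simp: natural_def PiE_iff u_eq d_eq)
  ultimately show ?thesis
    by (simp add: codereliction_of_def)
qed

end

section \<open>The two constructions are mutually inverse\<close>

lemma (in monoidal_differential_modality) codereliction_of_eq:
  "codereliction_of C bang bmap \<delta> \<epsilon> e m mI (add, zero, d) = (nab, u, \<eta>)"
  unfolding codereliction_of_def by (simp add: nab_def u_def \<eta>_def cong: restrict_cong)

lemma (in codereliction) differential_of_eq:
  "differential_of C bang bmap \<epsilon> \<Delta> e (nab, u, \<eta>) = (add, zero, d)"
  unfolding differential_of_def add_def zero_def d_def by simp

theorem theorem8p1:
  fixes C :: "('o, 'm) smc"
    and bang :: "'o \<Rightarrow> 'o" and bmap :: "'m \<Rightarrow> 'm"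
    and \<delta> \<epsilon> \<Delta> e :: "'o \<Rightarrow> 'm"
    and m :: "'o \<Rightarrow> 'o \<Rightarrow> 'm" and mI :: 'm
  assumes "monoidal_coalgebra_modality C bang bmap \<delta> \<epsilon> \<Delta> e m mI"
  defines "DLC \<equiv> {(add, zero, d).
      differential_linear_category C add zero bang bmap \<delta> \<epsilon> \<Delta> e m mI d}"
    and "CoD \<equiv> {(nab, u, \<eta>). codereliction C bang bmap \<delta> \<epsilon> \<Delta> e m mI nab u \<eta>}"
    and "\<Phi> \<equiv> codereliction_of C bang bmap \<delta> \<epsilon> e m mI"
    and "\<Psi> \<equiv> differential_of C bang bmap \<epsilon> \<Delta> e"
  shows "bij_betw \<Phi> DLC CoD \<and> bij_betw \<Psi> CoD DLC \<and>
    (\<forall>x\<in>DLC. \<Psi> (\<Phi> x) = x) \<and> (\<forall>y\<in>CoD. \<Phi> (\<Psi> y) = y)"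
proof -
  have \<Phi>: "\<Phi> x \<in> CoD \<and> \<Psi> (\<Phi> x) = x" if "x \<in> DLC" for x
  proof -
    obtain add zero d where x: "x = (add, zero, d)"
      by (cases x)
    then interpret differential_linear_category C add zero bang bmap \<delta> \<epsilon> \<Delta> e m mI d
      using that by (simp add: DLC_def)
    show ?thesis
      unfolding x \<Phi>_def \<Psi>_def CoD_def
      by (simp add: codereliction_of_eq codereliction differential_of_codereliction_of)
  qed
  have \<Psi>: "\<Psi> y \<in> DLC \<and> \<Phi> (\<Psi> y) = y" if "y \<in> CoD" for y
  proof -
    obtain nab u \<eta> where y: "y = (nab, u, \<eta>)"
      by (cases y)
    then interpret codereliction C bang bmap \<delta> \<epsilon> \<Delta> e m mI nab u \<eta>
      using that by (simp add: CoD_def)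
    show ?thesis
      unfolding y \<Phi>_def \<Psi>_def DLC_def
      by (simp add: differential_of_eq differential_linear_category codereliction_of_differential_of)
  qed
  have "bij_betw \<Phi> DLC CoD"
    by (rule bij_betw_byWitness[where f' = \<Psi>]) (use \<Phi> \<Psi> in auto)
  moreover have "bij_betw \<Psi> CoD DLC"
    by (rule bij_betw_byWitness[where f' = \<Phi>]) (use \<Phi> \<Psi> in auto)
  ultimately show ?thesis
    using \<Phi> \<Psi> by blast
qed

end
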